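(* Let $d\ge1$ and let $(t_n)_{n\in\mathbb{Z}^d}\subset\mathbb{R}^d$ be a sequence such that the associated exponentials $f_n(x)=\frac{1}{(2\pi)^{d/2}}e^{i\langle x,t_n\rangle}$, $n\in\mathbb{Z}^d$, form a uniformly invertible Riesz basis for $L_2([-\pi,\pi]^d)$. Let $N\in\{0,1,2,\dots\}$ and $A>0$, and let $$E_{\ell,N,A}=\Big[-A(\ell+1/2)^{\frac{2N+1}{2N+2}},\ A(\ell+1/2)^{\frac{2N+1}{2N+2}}\Big].$$ Let $f\in PW_{[-\pi,\pi]^d}$, and for $\ell\in\mathbb{N}$ let $\Psi_\ell$ be the unique polynomial of coordinate degree at most $2\ell$ with $\Psi_\ell(t_n)=f(t_n)$ for all $n\in C_{\ell,d}$. Define $$I_{f,\ell}(t)=\Psi_\ell(t)\,\exp\Big(-\sum_{k=1}^{N}\frac{1}{k(2k-1)}\frac{\|t\|_{2k}^{2k}}{(\ell+1/2)^{2k-1}}\Big).$$ Then $$\lim_{\ell\to\infty}\|f-I_{f,\ell}\|_{L_2((E_{\ell,N,A})^d)}=0\quad\text{and}\quad \lim_{\ell\to\infty}\|f-I_{f,\ell}\|_{L_\infty((E_{\ell,N,A})^d)}=0.$$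
   Context: $\mathbb{N}=\{1,2,\dots\}$. Points of $\mathbb{R}^d$ are written $t=(t(1),\dots,t(d))$, and $\|t\|_{2k}^{2k}=\sum_{i=1}^d t(i)^{2k}$. An empty sum is $0$. $C_{\ell,d}=\{-\ell,\dots,\ell\}^d$. A polynomial in $t(1),\dots,t(d)$ (complex coefficients) has coordinate degree at most $2\ell$ if its degree in each single variable is at most $2\ell$. Under the stated hypothesis the interpolating polynomials $\Psi_\ell$ exist and are unique. $PW_{[-\pi,\pi]^d}$ is the space of $f\in L_2(\mathbb{R}^d)$ (complex-valued) whose (inverse) Fourier transform is supported in $[-\pi,\pi]^d$, with the $L_2(\mathbb{R}^d)$ norm; its elements are identified with their continuous representatives. Let $e_n(x)=\frac{1}{(2\pi)^{d/2}}e^{i\langle x,n\rangle}$, an orthonormal basis of $L_2([-\pi,\pi]^d)$, and let $P_\ell$ be the orthogonal projection onto $\mathrm{span}\{e_n: n\in C_{\ell,d}\}$. A Riesz basis is the image of an orthonormal basis under a bounded linear bijection with bounded inverse. $(f_n)_{n\in\mathbb{Z}^d}$ is a uniformly invertible Riesz basis if the linear map $L$ with $Le_n=f_n$ is a bounded bijection of $L_2([-\pi,\pi]^d)$ with bounded inverse, for every $\ell\in\mathbb{N}$ the compression $P_\ell L P_\ell$ is invertible as an operator on the finite-dimensional space $\mathrm{ran}\,P_\ell$, and $\sup_{\ell\in\mathbb{N}}\|(P_\ell L P_\ell)^{-1}\|<\infty$. *)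

theory Defs
  imports "HOL-Probability.Essential_Supremum"
begin

text \<open>Elements of an \<open>L\<^sub>2\<close> space are represented by functions; equality of elements is equality almost
  everywhere. The norm is extended-valued so that it is infinite, not \<open>0\<close>, off \<open>L\<^sub>2\<close>.\<close>

definition L2 :: "'a measure \<Rightarrow> ('a \<Rightarrow> complex) set" where
  "L2 M = {f \<in> borel_measurable M. integrable M (\<lambda>x. (cmod (f x))\<^sup>2)}"

definition L2_norm :: "'a measure \<Rightarrow> ('a \<Rightarrow> complex) \<Rightarrow> ereal" where
  "L2_norm M f = (if f \<in> L2 M then ereal (sqrt (LINT x|M. (cmod (f x))\<^sup>2)) else \<infinity>)"

definition L2_inner :: "'a measure \<Rightarrow> ('a \<Rightarrow> complex) \<Rightarrow> ('a \<Rightarrow> complex) \<Rightarrow> complex" where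
  "L2_inner M f g = (LINT x|M. f x * cnj (g x))"

definition Linf_norm :: "'a measure \<Rightarrow> ('a \<Rightarrow> complex) \<Rightarrow> ereal" where
  "Linf_norm M f = esssup M (\<lambda>x. ereal (cmod (f x)))"

text \<open>Linearity is required up to null sets. Linearity and boundedness together make the operator
  respect equality almost everywhere, so it is well defined on \<open>L\<^sub>2\<close> classes.\<close>

definition bounded_operator :: "'a measure \<Rightarrow> (('a \<Rightarrow> complex) \<Rightarrow> ('a \<Rightarrow> complex)) \<Rightarrow> bool" where
  "bounded_operator M L \<longleftrightarrow>
     (\<forall>g\<in>L2 M. L g \<in> L2 M) \<and>
     (\<forall>g\<in>L2 M. \<forall>h\<in>L2 M. AE x in M. L (\<lambda>y. g y + h y) x = L g x + L h x) \<and>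
     (\<forall>c. \<forall>g\<in>L2 M. AE x in M. L (\<lambda>y. c * g y) x = c * L g x) \<and>
     (\<exists>C::real. \<forall>g\<in>L2 M. L2_norm M (L g) \<le> ereal C * L2_norm M g)"

definition bounded_bijection :: "'a measure \<Rightarrow> (('a \<Rightarrow> complex) \<Rightarrow> ('a \<Rightarrow> complex)) \<Rightarrow> bool" where
  "bounded_bijection M L \<longleftrightarrow>
     bounded_operator M L \<and>
     (\<exists>K. bounded_operator M K \<and>
        (\<forall>g\<in>L2 M. (AE x in M. K (L g) x = g x) \<and> (AE x in M. L (K g) x = g x)))"

text \<open>The orthogonal projection is used only for subspaces \<open>V\<close> in which functions equal almost
  everywhere on \<open>M\<close> are equal (trigonometric polynomials on a cube), so the value is a unique function.\<close>

definition orth_proj :: "'a measure \<Rightarrow> ('a \<Rightarrow> complex) set \<Rightarrow> ('a \<Rightarrow> complex) \<Rightarrow> ('a \<Rightarrow> complex)" where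
  "orth_proj M V g = (THE p. p \<in> V \<and> (\<forall>v\<in>V. L2_inner M (\<lambda>x. g x - p x) v = 0))"

definition sym_cube :: "real \<Rightarrow> (real^'d) set" where
  "sym_cube a = {x. \<forall>i. - a \<le> x $ i \<and> x $ i \<le> a}"

abbreviation cube_pi :: "(real^'d) measure" where
  "cube_pi \<equiv> lebesgue_on (sym_cube pi)"

definition index_cube :: "nat \<Rightarrow> (int^'d) set" where
  "index_cube l = {n. \<forall>i. - int l \<le> n $ i \<and> n $ i \<le> int l}"

definition expo :: "real^'d \<Rightarrow> real^'d \<Rightarrow> complex" where
  "expo s x = of_real (1 / (2 * pi) powr (real CARD('d) / 2)) * exp (\<i> * of_real (x \<bullet> s))"

definition lattice_expo :: "int^'d \<Rightarrow> real^'d \<Rightarrow> complex" where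
  "lattice_expo n = expo (\<chi> i. real_of_int (n $ i))"

definition trig_span :: "nat \<Rightarrow> (real^'d \<Rightarrow> complex) set" where
  "trig_span l = {p. \<exists>c. p = (\<lambda>x. \<Sum>n\<in>index_cube l. c n * lattice_expo n x)}"

definition trig_proj :: "nat \<Rightarrow> (real^'d \<Rightarrow> complex) \<Rightarrow> (real^'d \<Rightarrow> complex)" where
  "trig_proj l = orth_proj cube_pi (trig_span l)"

definition compression ::
  "nat \<Rightarrow> ((real^'d \<Rightarrow> complex) \<Rightarrow> (real^'d \<Rightarrow> complex)) \<Rightarrow> (real^'d \<Rightarrow> complex) \<Rightarrow> (real^'d \<Rightarrow> complex)"
  where "compression l L = (\<lambda>g. trig_proj l (L (trig_proj l g)))"

definition uniformly_invertible_Riesz_basis :: "(int^'d \<Rightarrow> real^'d \<Rightarrow> complex) \<Rightarrow> bool" where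
  "uniformly_invertible_Riesz_basis F \<longleftrightarrow>
     (\<exists>L. bounded_bijection cube_pi L \<and>
        (\<forall>n. AE x in cube_pi. L (lattice_expo n) x = F n x) \<and>
        (\<forall>l\<ge>1. bij_betw (compression l L) (trig_span l) (trig_span l)) \<and>
        (\<exists>C::real. \<forall>l\<ge>1. \<forall>h\<in>trig_span l.
           L2_norm cube_pi (inv_into (trig_span l) (compression l L) h) \<le> ereal C * L2_norm cube_pi h))"

text \<open>The inverse Fourier transform on \<open>L\<^sub>2\<close>, as the \<open>L\<^sub>2\<close> limit of the transforms of truncations.\<close>

definition is_inv_fourier :: "(real^'d \<Rightarrow> complex) \<Rightarrow> (real^'d \<Rightarrow> complex) \<Rightarrow> bool" where
  "is_inv_fourier f g \<longleftrightarrow> g \<in> L2 lebesgue \<and>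
     ((\<lambda>R. L2_norm lebesgue (\<lambda>x. g x - (LINT t|lebesgue_on (sym_cube R). f t * expo t x)))
        \<longlongrightarrow> 0) at_top"

text \<open>Elements of the Paley-Wiener space are their continuous representatives.\<close>

definition PW :: "(real^'d) set \<Rightarrow> (real^'d \<Rightarrow> complex) set" where
  "PW S = {f. continuous_on UNIV f \<and> f \<in> L2 lebesgue \<and>
     (\<exists>g. is_inv_fourier f g \<and> (AE x in lebesgue. x \<notin> S \<longrightarrow> g x = 0))}"

definition coord_degree_le :: "nat \<Rightarrow> (real^'d \<Rightarrow> complex) \<Rightarrow> bool" where
  "coord_degree_le K p \<longleftrightarrow>
     (\<exists>c. p = (\<lambda>t. \<Sum>m\<in>{m::nat^'d. \<forall>i. m $ i \<le> K}. c m * of_real (\<Prod>i\<in>UNIV. (t $ i) ^ (m $ i))))"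

definition interp_poly ::
  "(int^'d \<Rightarrow> real^'d) \<Rightarrow> (real^'d \<Rightarrow> complex) \<Rightarrow> nat \<Rightarrow> (real^'d \<Rightarrow> complex)" where
  "interp_poly t f l = (THE p. coord_degree_le (2 * l) p \<and> (\<forall>n\<in>index_cube l. p (t n) = f (t n)))"

definition interpolant ::
  "nat \<Rightarrow> (int^'d \<Rightarrow> real^'d) \<Rightarrow> (real^'d \<Rightarrow> complex) \<Rightarrow> nat \<Rightarrow> (real^'d \<Rightarrow> complex)" where
  "interpolant N t f l s = interp_poly t f l s *
     of_real (exp (- (\<Sum>k=1..N. 1 / (real k * (2 * real k - 1)) *
        ((\<Sum>i\<in>UNIV. (s $ i) ^ (2 * k)) / (real l + 1 / 2) ^ (2 * k - 1)))))"

definition E_radius :: "nat \<Rightarrow> nat \<Rightarrow> real \<Rightarrow> real" where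
  "E_radius l N A = A * (real l + 1 / 2) powr ((2 * real N + 1) / (2 * real N + 2))"

end

theory Submission
  imports Defs "HOL-Probability.Probability" "HOL-Real_Asymp.Real_Asymp"
begin

text \<open>
  The central object is the tail \<open>g\<^sub>l(x) = \<Prod>j>l. (1 - x\<^sup>2/j\<^sup>2)\<close> of the product for the sine,
  with \<open>G\<^sub>l(s) = \<Prod>i. g\<^sub>l(s\<^sub>i)\<close>. For \<open>\<bar>k\<bar> \<le> l\<close> the function \<open>sin (\<pi>(k - x)) / (\<pi>(k - x))\<close>
  is \<open>g\<^sub>l(x)\<close> times a polynomial of degree \<open>2l\<close>, and these \<open>2l + 1\<close> polynomials form a basis. Hence the
  Fourier transforms of the trigonometric polynomials with frequencies in the index cube of size \<open>l\<close> are
  exactly the functions \<open>G\<^sub>l p\<close> with \<open>p\<close> a polynomial of coordinate degree at most \<open>2l\<close>, and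
  polynomial interpolation at the nodes \<open>t\<^sub>n\<close> becomes a question about a finite section of the operator that
  sends the lattice exponentials to the given Riesz basis.

  A function \<open>f\<close> of the Paley-Wiener space is the transform of some \<open>F\<close> on the cube
  (\<open>PW_cube_fourier\<close>); its value at \<open>t\<^sub>n\<close> is the inner product of \<open>F\<close> with the \<open>n\<close>-th basis
  element. Let \<open>H\<^sub>l\<close> be the trigonometric polynomial whose transform is \<open>\<Psi>\<^sub>l G\<^sub>l\<close>; its
  values at the nodes are \<open>f(t\<^sub>n) G\<^sub>l(t\<^sub>n)\<close>. Uniform invertibility says that a trigonometric polynomial is
  controlled, with a constant independent of \<open>l\<close>, by the \<open>\<ell>\<^sub>2\<close> norm of its values at the nodes
  (\<open>node_samples_stable\<close>), and that these values can be prescribed (\<open>node_samples_surj\<close>). The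
  difference between \<open>H\<^sub>l\<close> and the Fourier partial sum \<open>P\<^sub>l F\<close> has the values
  \<open>(G\<^sub>l(t\<^sub>n) - 1) f(t\<^sub>n)\<close> plus those of the transform of \<open>F - P\<^sub>l F\<close>. The first part tends to \<open>0\<close> in
  \<open>\<ell>\<^sub>2\<close>, since \<open>\<bar>G\<^sub>l\<bar> \<le> 1\<close> everywhere, \<open>G\<^sub>l \<rightarrow> 1\<close> pointwise and the values \<open>f(t\<^sub>n)\<close> are square
  summable; the second because trigonometric polynomials are dense. So \<open>H\<^sub>l \<rightarrow> F\<close> in \<open>L\<^sub>2\<close>
  (\<open>interpolants_converge\<close>), and the transforms converge to \<open>f\<close> both uniformly and in \<open>L\<^sub>2\<close>.

  What remains is to compare \<open>1/G\<^sub>l\<close> with the explicit Gaussian-like factor. In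
  \<open>- ln g\<^sub>l(x) = \<Sum>k. (x\<^sup>2\<^sup>k / k) \<Sum>j>l. 1/j\<^sup>2\<^sup>k\<close> the inner sum is bounded by the integral of
  \<open>y\<^sup>-\<^sup>2\<^sup>k\<close> from \<open>l + 1/2\<close> on, by the midpoint rule for a convex function. Thus the terms with
  \<open>k \<le> N\<close> are compensated by the explicit factor, and the rest is at most a constant times
  \<open>x\<^sup>2\<^sup>N\<^sup>+\<^sup>2 / (l + 1/2)\<^sup>2\<^sup>N\<^sup>+\<^sup>1\<close>. The exponent in the radius of the cubes is the one
  that keeps this bounded. The quotient \<open>M\<^sub>l\<close> of the explicit factor by \<open>G\<^sub>l\<close> is therefore bounded on the
  cubes, and it tends to \<open>1\<close> locally uniformly. Writing the error as
  \<open>f (1 - M\<^sub>l) + (f - \<Psi>\<^sub>l G\<^sub>l) M\<^sub>l\<close> finishes the proof, since \<open>f\<close> is square integrable and vanishes at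
  infinity.
\<close>

section \<open>Square-integrable functions\<close>

text \<open>The real-valued norm. It is meaningful only for square-integrable functions, where it agrees with the
  extended norm, and it lets the estimates below be carried out in the real numbers.\<close>

definition l2norm :: "'a measure \<Rightarrow> ('a \<Rightarrow> complex) \<Rightarrow> real" where
  "l2norm M f = sqrt (LINT x|M. (cmod (f x))\<^sup>2)"

lemma borel_measurable_cnj [measurable]: "cnj \<in> borel_measurable borel"
  by (intro borel_measurable_continuous_onI continuous_intros)

lemma L2_norm_eq_l2norm: "f \<in> L2 M \<Longrightarrow> L2_norm M f = ereal (l2norm M f)"
  by (simp add: L2_norm_def l2norm_def)

lemma l2norm_nonneg [simp]: "0 \<le> l2norm M f"
  by (simp add: l2norm_def)

lemma l2norm_power2: "(l2norm M f)\<^sup>2 = (LINT x|M. (cmod (f x))\<^sup>2)"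
  by (simp add: l2norm_def)

lemma L2_measurable: "f \<in> L2 M \<Longrightarrow> f \<in> borel_measurable M"
  by (simp add: L2_def)

lemma L2_integrable_square: "f \<in> L2 M \<Longrightarrow> integrable M (\<lambda>x. (cmod (f x))\<^sup>2)"
  by (simp add: L2_def)

lemma L2_bound:
  assumes "g \<in> L2 M" "f \<in> borel_measurable M" "\<And>x. x \<in> space M \<Longrightarrow> cmod (f x) \<le> cmod (g x)"
  shows "f \<in> L2 M"
  unfolding L2_def
proof (intro CollectI conjI)
  show "integrable M (\<lambda>x. (cmod (f x))\<^sup>2)"
  proof (rule Bochner_Integration.integrable_bound [OF L2_integrable_square [OF assms(1)]])
    show "(\<lambda>x. (cmod (f x))\<^sup>2) \<in> borel_measurable M" using assms(2) by measurable
    show "AE x in M. norm ((cmod (f x))\<^sup>2) \<le> norm ((cmod (g x))\<^sup>2)"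
      using assms(3) by (intro AE_I2) (simp add: power_mono)
  qed
qed fact

lemma L2_integrable_mult_norm:
  assumes "f \<in> L2 M" "g \<in> L2 M"
  shows "integrable M (\<lambda>x. cmod (f x) * cmod (g x))"
proof (rule Bochner_Integration.integrable_bound)
  show "integrable M (\<lambda>x. (cmod (f x))\<^sup>2 + (cmod (g x))\<^sup>2)"
    using assms by (simp add: L2_def)
  show "(\<lambda>x. cmod (f x) * cmod (g x)) \<in> borel_measurable M"
    using assms [THEN L2_measurable] by measurable
  have "cmod (f x) * cmod (g x) \<le> (cmod (f x))\<^sup>2 + (cmod (g x))\<^sup>2" for x
    using sum_squares_bound [of "cmod (f x)" "cmod (g x)"]
      mult_nonneg_nonneg [OF norm_ge_zero norm_ge_zero, of "f x" "g x"] by linarith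
  then show "AE x in M. norm (cmod (f x) * cmod (g x)) \<le> norm ((cmod (f x))\<^sup>2 + (cmod (g x))\<^sup>2)"
    by (intro AE_I2) simp
qed

lemma L2_integrable_inner:
  assumes "f \<in> L2 M" "g \<in> L2 M"
  shows "integrable M (\<lambda>x. f x * cnj (g x))"
proof (rule Bochner_Integration.integrable_bound [OF L2_integrable_mult_norm [OF assms]])
  show "(\<lambda>x. f x * cnj (g x)) \<in> borel_measurable M"
    using assms [THEN L2_measurable] by measurable
qed (simp add: norm_mult)

lemma L2_add:
  assumes "f \<in> L2 M" "g \<in> L2 M"
  shows "(\<lambda>x. f x + g x) \<in> L2 M"
  unfolding L2_def
proof (intro CollectI conjI)
  show "integrable M (\<lambda>x. (cmod (f x + g x))\<^sup>2)"
  proof (rule Bochner_Integration.integrable_bound)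
    show "integrable M (\<lambda>x. (cmod (f x))\<^sup>2 + 2 * (cmod (f x) * cmod (g x)) + (cmod (g x))\<^sup>2)"
      using assms L2_integrable_mult_norm [OF assms] by (simp add: L2_def)
    show "(\<lambda>x. (cmod (f x + g x))\<^sup>2) \<in> borel_measurable M"
      using assms [THEN L2_measurable] by measurable
    have "(cmod (f x + g x))\<^sup>2 \<le> (cmod (f x) + cmod (g x))\<^sup>2" for x
      by (intro power_mono norm_triangle_ineq) auto
    then show "AE x in M. norm ((cmod (f x + g x))\<^sup>2)
        \<le> norm ((cmod (f x))\<^sup>2 + 2 * (cmod (f x) * cmod (g x)) + (cmod (g x))\<^sup>2)"
      by (intro AE_I2) (simp add: power2_sum algebra_simps)
  qed
qed (use assms [THEN L2_measurable] in measurable)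

lemma L2_cmult: "f \<in> L2 M \<Longrightarrow> (\<lambda>x. c * f x) \<in> L2 M"
  by (auto simp: L2_def norm_mult power_mult_distrib)

lemma L2_diff: "f \<in> L2 M \<Longrightarrow> g \<in> L2 M \<Longrightarrow> (\<lambda>x. f x - g x) \<in> L2 M"
  using L2_add [OF _ L2_cmult [of g M "-1"]] by simp

lemma L2_sum:
  assumes "\<And>i. i \<in> I \<Longrightarrow> f i \<in> L2 M"
  shows "(\<lambda>x. \<Sum>i\<in>I. f i x) \<in> L2 M"
  using assms
proof (induction I rule: infinite_finite_induct)
  case (insert i I)
  then show ?case by (simp add: L2_add)
qed (auto simp: L2_def)

lemma Cauchy_Schwarz_integral_norm:
  assumes "f \<in> L2 M" "g \<in> L2 M"
  shows "(LINT x|M. cmod (f x) * cmod (g x)) \<le> l2norm M f * l2norm M g"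
proof -
  note [measurable] = assms [THEN L2_measurable]
  have sq: "(\<integral>\<^sup>+x. (ennreal (cmod (h x)))\<^sup>2 \<partial>M) = ennreal ((l2norm M h)\<^sup>2)" if "h \<in> L2 M" for h
    unfolding l2norm_power2
    by (subst nn_integral_eq_integral [symmetric]) (use that in \<open>auto simp: L2_def ennreal_power\<close>)
  have "(\<integral>\<^sup>+x. ennreal (cmod (f x)) * ennreal (cmod (g x)) \<partial>M)
        = ennreal (LINT x|M. cmod (f x) * cmod (g x))"
    by (subst nn_integral_eq_integral [symmetric])
       (auto simp: ennreal_mult intro: L2_integrable_mult_norm assms)
  moreover have "(\<integral>\<^sup>+x. ennreal (cmod (f x)) * ennreal (cmod (g x)) \<partial>M)\<^sup>2
      \<le> (\<integral>\<^sup>+x. (ennreal (cmod (f x)))\<^sup>2 \<partial>M) * (\<integral>\<^sup>+x. (ennreal (cmod (g x)))\<^sup>2 \<partial>M)"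
    by (rule Cauchy_Schwarz_nn_integral) measurable
  ultimately have "(ennreal (LINT x|M. cmod (f x) * cmod (g x)))\<^sup>2
      \<le> ennreal ((l2norm M f)\<^sup>2) * ennreal ((l2norm M g)\<^sup>2)"
    using sq [OF assms(1)] sq [OF assms(2)] by simp
  then have "ennreal ((LINT x|M. cmod (f x) * cmod (g x))\<^sup>2) \<le> ennreal ((l2norm M f * l2norm M g)\<^sup>2)"
    by (simp add: ennreal_power ennreal_mult power_mult_distrib)
  then have "(LINT x|M. cmod (f x) * cmod (g x))\<^sup>2 \<le> (l2norm M f * l2norm M g)\<^sup>2"
    by (simp add: ennreal_le_iff)
  then show ?thesis
    by (rule power2_le_imp_le) simp
qed

lemma L2_inner_Cauchy_Schwarz:
  assumes "f \<in> L2 M" "g \<in> L2 M"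
  shows "cmod (L2_inner M f g) \<le> l2norm M f * l2norm M g"
proof -
  have "cmod (L2_inner M f g) \<le> (LINT x|M. cmod (f x * cnj (g x)))"
    unfolding L2_inner_def by (rule integral_norm_bound)
  also have "\<dots> = (LINT x|M. cmod (f x) * cmod (g x))"
    by (simp add: norm_mult)
  finally show ?thesis
    using Cauchy_Schwarz_integral_norm [OF assms] by linarith
qed

lemma l2norm_triangle:
  assumes "f \<in> L2 M" "g \<in> L2 M"
  shows "l2norm M (\<lambda>x. f x + g x) \<le> l2norm M f + l2norm M g"
proof (rule power2_le_imp_le)
  have "(l2norm M (\<lambda>x. f x + g x))\<^sup>2 \<le>
      (LINT x|M. (cmod (f x))\<^sup>2 + 2 * (cmod (f x) * cmod (g x)) + (cmod (g x))\<^sup>2)"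
    unfolding l2norm_power2
  proof (rule integral_mono)
    show "integrable M (\<lambda>x. (cmod (f x + g x))\<^sup>2)"
      using L2_add [OF assms] by (simp add: L2_def)
    show "integrable M (\<lambda>x. (cmod (f x))\<^sup>2 + 2 * (cmod (f x) * cmod (g x)) + (cmod (g x))\<^sup>2)"
      using assms L2_integrable_mult_norm [OF assms] by (simp add: L2_def)
    fix x
    have "(cmod (f x + g x))\<^sup>2 \<le> (cmod (f x) + cmod (g x))\<^sup>2"
      by (intro power_mono norm_triangle_ineq) auto
    then show "(cmod (f x + g x))\<^sup>2 \<le> (cmod (f x))\<^sup>2 + 2 * (cmod (f x) * cmod (g x)) + (cmod (g x))\<^sup>2"
      by (simp add: power2_sum algebra_simps)
  qed
  also have "\<dots> = (l2norm M f)\<^sup>2 + 2 * (LINT x|M. cmod (f x) * cmod (g x)) + (l2norm M g)\<^sup>2"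
    unfolding l2norm_power2 using assms L2_integrable_mult_norm [OF assms] by (simp add: L2_def)
  also have "\<dots> \<le> (l2norm M f + l2norm M g)\<^sup>2"
    using Cauchy_Schwarz_integral_norm [OF assms] by (simp add: power2_sum)
  finally show "(l2norm M (\<lambda>x. f x + g x))\<^sup>2 \<le> (l2norm M f + l2norm M g)\<^sup>2" .
qed simp

lemma l2norm_cmult: "l2norm M (\<lambda>x. c * f x) = cmod c * l2norm M f"
  by (simp add: l2norm_def norm_mult power_mult_distrib real_sqrt_mult)

lemma l2norm_triangle_diff:
  assumes "f \<in> L2 M" "g \<in> L2 M" "h \<in> L2 M"
  shows "l2norm M (\<lambda>x. f x - h x) \<le> l2norm M (\<lambda>x. f x - g x) + l2norm M (\<lambda>x. g x - h x)"
  using l2norm_triangle [OF L2_diff [OF assms(1,2)] L2_diff [OF assms(2,3)]] by simp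

lemma l2norm_mono:
  assumes "g \<in> L2 M" "f \<in> borel_measurable M" "\<And>x. x \<in> space M \<Longrightarrow> cmod (f x) \<le> cmod (g x)"
  shows "l2norm M f \<le> l2norm M g"
  unfolding l2norm_def
  using L2_integrable_square [OF L2_bound [OF assms]] L2_integrable_square [OF assms(1)] assms(3)
  by (intro real_sqrt_le_mono integral_mono) (auto simp: power_mono)

lemma L2_inner_add_left:
  "f \<in> L2 M \<Longrightarrow> g \<in> L2 M \<Longrightarrow> h \<in> L2 M \<Longrightarrow>
    L2_inner M (\<lambda>x. f x + g x) h = L2_inner M f h + L2_inner M g h"
  unfolding L2_inner_def by (simp add: distrib_right L2_integrable_inner)

lemma L2_inner_diff_left:
  "f \<in> L2 M \<Longrightarrow> g \<in> L2 M \<Longrightarrow> h \<in> L2 M \<Longrightarrow>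
    L2_inner M (\<lambda>x. f x - g x) h = L2_inner M f h - L2_inner M g h"
  unfolding L2_inner_def by (simp add: left_diff_distrib L2_integrable_inner)

lemma L2_inner_sum_left:
  "finite I \<Longrightarrow> (\<And>i. i \<in> I \<Longrightarrow> f i \<in> L2 M) \<Longrightarrow> h \<in> L2 M \<Longrightarrow>
    L2_inner M (\<lambda>x. \<Sum>i\<in>I. c i * f i x) h = (\<Sum>i\<in>I. c i * L2_inner M (f i) h)"
  unfolding L2_inner_def
  by (simp add: sum_distrib_right mult.assoc L2_integrable_inner)

lemma L2_inner_commute: "L2_inner M f g = cnj (L2_inner M g f)"
  unfolding L2_inner_def
  by (subst Bochner_Integration.integral_cnj [symmetric]) (simp add: mult.commute)

lemma L2_inner_sum_right:
  assumes "finite I" "\<And>i. i \<in> I \<Longrightarrow> f i \<in> L2 M" "h \<in> L2 M"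
  shows "L2_inner M h (\<lambda>x. \<Sum>i\<in>I. c i * f i x) = (\<Sum>i\<in>I. cnj (c i) * L2_inner M h (f i))"
proof -
  have "L2_inner M h (\<lambda>x. \<Sum>i\<in>I. c i * f i x) = cnj (\<Sum>i\<in>I. c i * L2_inner M (f i) h)"
    by (subst L2_inner_commute) (simp add: L2_inner_sum_left assms)
  also have "\<dots> = (\<Sum>i\<in>I. cnj (c i) * L2_inner M h (f i))"
    by (simp flip: L2_inner_commute)
  finally show ?thesis .
qed

lemma L2_inner_add_right:
  assumes "f \<in> L2 M" "g \<in> L2 M" "h \<in> L2 M"
  shows "L2_inner M h (\<lambda>x. f x + g x) = L2_inner M h f + L2_inner M h g"
  using L2_inner_add_left [OF assms] by (metis L2_inner_commute complex_cnj_add)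

lemma L2_inner_cong_AE:
  assumes "f \<in> borel_measurable M" "g \<in> borel_measurable M" "h \<in> borel_measurable M"
    "AE x in M. f x = g x"
  shows "L2_inner M h f = L2_inner M h g"
  unfolding L2_inner_def using assms by (intro integral_cong_AE) auto

lemma L2_inner_self: "L2_inner M f f = of_real ((l2norm M f)\<^sup>2)"
  unfolding l2norm_power2 L2_inner_def
  by (simp add: complex_norm_square [symmetric] del: of_real_power)

section \<open>Product integrals and the exponential system\<close>

text \<open>Lebesgue measure on \<open>real^'d\<close> is the image of a product measure indexed by the standard basis vectors,
  so the coordinates have to be matched with those vectors before Fubini's theorem for finite products applies.\<close>

lemma lborel_vec_prod:
  fixes \<phi> :: "'d::finite \<Rightarrow> real \<Rightarrow> 'a::{real_normed_field,banach,second_countable_topology}"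
  assumes "\<And>i. integrable lborel (\<phi> i)"
  shows integrable_lborel_vec_prod: "integrable lborel (\<lambda>x::real^'d. \<Prod>i\<in>UNIV. \<phi> i (x $ i))"
    and integral_lborel_vec_prod: "(LINT x|(lborel::(real^'d) measure). (\<Prod>i\<in>UNIV. \<phi> i (x $ i))) = (\<Prod>i\<in>UNIV. LINT y|lborel. \<phi> i y)"
proof -
  interpret product_sigma_finite "\<lambda>b::real^'d. lborel::real measure" ..
  have inj: "inj (\<lambda>i::'d. axis i (1::real))"
    by (auto intro!: injI simp: axis_eq_axis)
  have Basis: "(Basis::(real^'d) set) = range (\<lambda>i. axis i 1)"
    by (auto simp: Basis_vec_def)
  define \<psi> where "\<psi> b = \<phi> (inv (\<lambda>i. axis i 1) b)" for b :: "real^'d"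
  have \<psi>: "\<psi> (axis i 1) = \<phi> i" for i
    using inv_f_f [OF inj] by (simp add: \<psi>_def)
  have int: "integrable lborel (\<psi> b)" for b
    using assms by (simp add: \<psi>_def)
  have coord: "(\<Sum>b\<in>Basis. f b *\<^sub>R b) $ i = f (axis i 1)" for f :: "real^'d \<Rightarrow> real" and i
  proof -
    have "f (axis j 1) * axis j (1::real) $ i = (if j = i then f (axis i 1) else 0)" for j :: 'd
      by (simp add: axis_def)
    then have "(\<Sum>j\<in>UNIV. f (axis j 1) * axis j (1::real) $ i) = f (axis i 1)"
      by (simp only: sum.delta finite) simp
    then show ?thesis
      by (simp add: Basis sum.reindex inj)
  qed
  have [measurable]: "\<phi> i \<in> borel_measurable borel" for i
    using borel_measurable_integrable [OF assms [of i]] by simp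
  have meas: "(\<lambda>x::real^'d. \<Prod>i\<in>UNIV. \<phi> i (x $ i)) \<in> borel_measurable borel"
    by measurable
  have eq2: "(\<Prod>i\<in>UNIV. \<phi> i (f (axis i 1))) = (\<Prod>b\<in>Basis. \<psi> b (f b))" for f :: "real^'d \<Rightarrow> real"
    by (simp add: Basis prod.reindex inj \<psi>)
  have meas': "(\<lambda>f. \<Sum>b\<in>Basis. f b *\<^sub>R b) \<in> measurable (\<Pi>\<^sub>M b\<in>(Basis::(real^'d) set). lborel) borel"
    by measurable
  show "integrable lborel (\<lambda>x::real^'d. \<Prod>i\<in>UNIV. \<phi> i (x $ i))"
    unfolding lborel_eq [where 'a="real^'d"] integrable_distr_eq [OF meas' meas] coord eq2
    by (intro product_integrable_prod int finite_Basis)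
  show "(LINT x|(lborel::(real^'d) measure). (\<Prod>i\<in>UNIV. \<phi> i (x $ i))) = (\<Prod>i\<in>UNIV. LINT y|lborel. \<phi> i y)"
    unfolding lborel_eq [where 'a="real^'d"] integral_distr [OF meas' meas] coord eq2
    by (subst product_integral_prod [OF finite_Basis int])
       (simp add: Basis prod.reindex inj \<psi>)
qed

lemma sym_cube_eq_cbox: "sym_cube a = cbox (\<chi> i. - a) (\<chi> i. a)"
  by (auto simp: sym_cube_def mem_box_cart)

lemma compact_sym_cube: "compact (sym_cube a)"
  by (simp add: sym_cube_eq_cbox)

lemma sets_sym_cube_borel [measurable]: "sym_cube a \<in> sets borel"
  by (simp add: sym_cube_eq_cbox)

lemma sets_sym_cube [measurable]: "sym_cube a \<in> sets lebesgue"
  by (simp add: sym_cube_eq_cbox)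

lemma sym_cube_lmeasurable: "sym_cube a \<in> lmeasurable"
  by (simp add: sym_cube_eq_cbox)

lemma finite_measure_cube: "finite_measure (lebesgue_on (sym_cube a))"
  by (rule finite_measure_lebesgue_on [OF sym_cube_lmeasurable])

lemma measurable_cube_continuous:
  fixes f :: "real^'d \<Rightarrow> 'b::{second_countable_topology,topological_space}"
  assumes "continuous_on UNIV f" shows "f \<in> borel_measurable (lebesgue_on (sym_cube a))"
  using borel_measurable_continuous_onI [OF assms]
  by (intro measurable_restrict_space1 measurable_completion) auto

lemma integrable_cube_continuous:
  fixes f :: "real^'d \<Rightarrow> 'b::{second_countable_topology,banach}"
  assumes "continuous_on UNIV f" shows "integrable (lebesgue_on (sym_cube a)) f"
proof -
  interpret finite_measure "lebesgue_on (sym_cube a :: (real^'d) set)"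
    by (rule finite_measure_cube)
  have "bounded (f ` sym_cube a)"
    using compact_continuous_image [OF continuous_on_subset [OF assms] compact_sym_cube] compact_imp_bounded
    by auto
  then obtain B where "\<forall>x\<in>sym_cube a. norm (f x) \<le> B"
    by (auto simp: bounded_iff)
  then show ?thesis
    using measurable_cube_continuous [OF assms]
    by (intro integrable_const_bound [where B=B]) auto
qed

lemma L2_cube_continuous:
  assumes "continuous_on UNIV f" shows "f \<in> L2 (lebesgue_on (sym_cube a))"
  unfolding L2_def using assms
  by (auto intro!: measurable_cube_continuous integrable_cube_continuous continuous_intros)

lemma continuous_on_expo [continuous_intros]: "continuous_on S (expo s)"
  unfolding expo_def by (intro continuous_intros)

lemma continuous_on_lattice_expo [continuous_intros]: "continuous_on S (lattice_expo n)"
  unfolding lattice_expo_def by (rule continuous_on_expo)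

lemma expo_commute: "expo s x = expo x s"
  by (simp add: expo_def inner_commute)

lemma expo_L2 [simp]: "expo s \<in> L2 cube_pi"
  by (intro L2_cube_continuous continuous_intros)

lemma lattice_expo_L2 [simp]: "lattice_expo n \<in> L2 cube_pi"
  by (simp add: lattice_expo_def)

lemma norm_expo: "cmod (expo (s::real^'d) x) = 1 / (2 * pi) powr (real CARD('d) / 2)"
  unfolding expo_def norm_mult norm_exp_i_times norm_of_real by simp

text \<open>All integrals of exponentials below factor over the coordinates. The normalising constant
  \<open>(2\<pi>)\<^sup>-\<^sup>d\<close> is distributed evenly over the factors.\<close>

lemma expo_mult_cnj:
  fixes s :: "real^'d"
  shows "expo s x * cnj (expo t x) = (\<Prod>i\<in>UNIV. of_real (1 / (2*pi)) * exp (\<i> * of_real ((s $ i - t $ i) * x $ i)))"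
proof -
  define c where "c = 1 / (2 * pi) powr (real CARD('d) / 2)"
  have c: "c * c = (1 / (2*pi)) ^ CARD('d)"
  proof -
    have "(2 * pi) powr (real CARD('d) / 2) * (2 * pi) powr (real CARD('d) / 2) = (2 * pi) ^ CARD('d)"
      unfolding powr_add [symmetric] field_sum_of_halves by (rule powr_realpow) simp
    then show ?thesis
      unfolding c_def power_divide times_divide_times_eq by (simp only: mult_1 power_one)
  qed
  have "expo s x * cnj (expo t x) =
     of_real (c * c) * (exp (\<i> * of_real (x \<bullet> s)) * exp (- (\<i> * of_real (x \<bullet> t))))"
    unfolding expo_def c_def [symmetric] by (simp add: exp_cnj)
  also have "exp (\<i> * of_real (x \<bullet> s)) * exp (- (\<i> * of_real (x \<bullet> t)))
     = exp (\<i> * complex_of_real (x \<bullet> s - x \<bullet> t))"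
    by (simp add: mult_exp_exp algebra_simps)
  also have "\<i> * complex_of_real (x \<bullet> s - x \<bullet> t)
      = (\<Sum>i\<in>UNIV. \<i> * complex_of_real ((s $ i - t $ i) * x $ i))"
    unfolding inner_vec_def sum_subtractf [symmetric] of_real_sum sum_distrib_left
    by (intro sum.cong refl) (simp add: algebra_simps)
  also have "of_real (c * c) * exp (\<Sum>i\<in>UNIV. \<i> * complex_of_real ((s $ i - t $ i) * x $ i))
      = (\<Prod>i\<in>UNIV. of_real (1 / (2*pi)) * exp (\<i> * of_real ((s $ i - t $ i) * x $ i)))"
    unfolding c by (simp only: exp_sum finite prod.distrib prod_constant of_real_power)
  finally show ?thesis .
qed

text \<open>The cardinal sine, scaled so that it vanishes at all integers other than \<open>0\<close>.\<close>

definition sincpi :: "real \<Rightarrow> real" where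
  "sincpi a = (if a = 0 then 1 else sin (pi * a) / (pi * a))"

lemma integral_exp_symmetric_interval:
  "(LINT y|lborel. indicator {- pi..pi} y *\<^sub>R (of_real (1 / (2*pi)) * exp (\<i> * of_real (a * y))))
    = complex_of_real (sincpi a)"
proof (cases "a = 0")
  case True
  then show ?thesis by (simp add: scaleR_conv_of_real sincpi_def)
next
  case False
  let ?F = "\<lambda>y::real. of_real (1 / (2*pi)) * (exp (\<i> * of_real (a * y)) / (\<i> * of_real a))"
  have "(LINT y|lborel. indicator {- pi..pi} y *\<^sub>R (of_real (1 / (2*pi)) * exp (\<i> * of_real (a * y))))
    = ?F pi - ?F (- pi)"
  proof (rule integral_FTC_atLeastAtMost)
    fix x :: real
    have "((\<lambda>z. of_real (1 / (2*pi)) * (exp (\<i> * (of_real a * z)) / (\<i> * of_real a))) has_field_derivative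
       (of_real (1 / (2*pi)) * exp (\<i> * of_real (a * x)))) (at (of_real x))"
      using False by (auto intro!: derivative_eq_intros simp: field_simps)
    from has_vector_derivative_real_field [OF this]
    show "(?F has_vector_derivative of_real (1 / (2*pi)) * exp (\<i> * of_real (a * x))) (at x within {- pi..pi})"
      by (auto intro: has_vector_derivative_at_within)
  next
    show "continuous_on {- pi..pi} (\<lambda>x. complex_of_real (1 / (2 * pi)) * exp (\<i> * complex_of_real (a * x)))"
      by (intro continuous_intros)
  qed simp
  also have "\<dots> = of_real (sin (pi * a) / (pi * a))"
  proof -
    have e: "exp (\<i> * of_real y) = of_real (cos y) + \<i> * of_real (sin y)" for y
      by (simp add: exp_Euler cos_of_real sin_of_real)
    show ?thesis
      unfolding e using False by (simp add: field_simps)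
  qed
  finally show ?thesis
    using False by (simp add: sincpi_def)
qed

lemma integral_cube_prod:
  fixes \<phi> :: "'d::finite \<Rightarrow> real \<Rightarrow> complex"
  assumes "\<And>i. continuous_on UNIV (\<phi> i)"
  shows "(LINT x|lebesgue_on (sym_cube a). (\<Prod>i\<in>UNIV. \<phi> i (x $ i)))
    = (\<Prod>i\<in>UNIV. LINT y|lborel. indicator {-a..a} y *\<^sub>R \<phi> i y)"
proof -
  have [measurable]: "\<phi> i \<in> borel_measurable borel" for i
    using assms by (rule borel_measurable_continuous_onI)
  have ind: "indicator (sym_cube a) x *\<^sub>R (\<Prod>i\<in>UNIV. \<phi> i (x $ i))
      = (\<Prod>i\<in>UNIV. indicator {-a..a} (x $ i) *\<^sub>R \<phi> i (x $ i))" for x :: "real^'d"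
    by (auto simp: indicator_def sym_cube_def prod_zero_iff)
  have "(LINT x|lebesgue_on (sym_cube a). (\<Prod>i\<in>UNIV. \<phi> i (x $ i)))
     = (LINT x|lebesgue. indicator (sym_cube a) x *\<^sub>R (\<Prod>i\<in>UNIV. \<phi> i (x $ i)))"
    by (rule integral_restrict_space) simp
  also have "\<dots> = (LINT x|lborel. indicator (sym_cube a) x *\<^sub>R (\<Prod>i\<in>UNIV. \<phi> i (x $ i)))"
    by (rule integral_completion) measurable
  also have "\<dots> = (LINT x|(lborel::(real^'d) measure). (\<Prod>i\<in>UNIV. indicator {-a..a} (x $ i) *\<^sub>R \<phi> i (x $ i)))"
    unfolding ind ..
  also have "\<dots> = (\<Prod>i\<in>UNIV. LINT y|lborel. indicator {-a..a} y *\<^sub>R \<phi> i y)"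
  proof (rule integral_lborel_vec_prod)
    fix i
    have "set_integrable lborel {-a..a} (\<phi> i)"
      by (intro borel_integrable_atLeastAtMost' continuous_on_subset [OF assms]) auto
    then show "integrable lborel (\<lambda>y. indicator {-a..a} y *\<^sub>R \<phi> i y)"
      by (simp add: set_integrable_def)
  qed
  finally show ?thesis .
qed

text \<open>This identity is used twice: with integer frequencies it is the orthonormality of the lattice exponentials,
  and with one real frequency it computes the Fourier transform of a trigonometric polynomial.\<close>

lemma expo_inner:
  "L2_inner cube_pi (expo s) (expo t) = of_real (\<Prod>i\<in>UNIV. sincpi ((s $ i - t $ i)))"
  unfolding L2_inner_def expo_mult_cnj of_real_prod
  by (subst integral_cube_prod)
     (intro continuous_intros, simp only: integral_exp_symmetric_interval)

lemma sincpi_of_int: "sincpi (real_of_int k) = (if k = 0 then 1 else 0)"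
  by (auto simp: sincpi_def mult.commute sin_integer_2pi sin_zero_iff_int2)

lemma lattice_expo_orthonormal:
  "L2_inner cube_pi (lattice_expo m) (lattice_expo n) = (if m = n then 1 else 0)"
proof -
  have "L2_inner cube_pi (lattice_expo m) (lattice_expo n)
      = of_real (\<Prod>i\<in>UNIV. sincpi (real_of_int (m $ i - n $ i)))"
    by (simp only: lattice_expo_def expo_inner vec_lambda_beta of_int_diff)
  also have "\<dots> = (if m = n then 1 else 0)"
  proof (cases "m = n")
    case True
    then show ?thesis by (simp add: sincpi_def)
  next
    case False
    then obtain i where "m $ i \<noteq> n $ i" by (auto simp: vec_eq_iff)
    then have "sincpi (real_of_int (m $ i - n $ i)) = 0"
      unfolding sincpi_of_int by simp
    then have "(\<Prod>i\<in>UNIV. sincpi (real_of_int (m $ i - n $ i))) = 0"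
      by (intro prod_zero bexI [of _ i]) auto
    with False show ?thesis by simp
  qed
  finally show ?thesis .
qed

lemma finite_index_cube [simp]: "finite (index_cube l)"
proof (rule finite_imageD)
  show "finite (vec_nth ` index_cube l)"
    by (rule finite_subset [OF _ finite_PiE [of UNIV "\<lambda>i. {- int l..int l}"]])
       (auto simp: index_cube_def)
qed (simp add: inj_on_def vec_eq_iff)

lemma index_cube_mono: "k \<le> l \<Longrightarrow> index_cube k \<subseteq> index_cube l"
  unfolding index_cube_def by (auto intro: order_trans [rotated] order_trans)

definition trig_poly :: "nat \<Rightarrow> (int^'d \<Rightarrow> complex) \<Rightarrow> real^'d \<Rightarrow> complex" where
  "trig_poly l c = (\<lambda>x. \<Sum>n\<in>index_cube l. c n * lattice_expo n x)"

abbreviation fourier_coeff :: "(real^'d \<Rightarrow> complex) \<Rightarrow> int^'d \<Rightarrow> complex" where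
  "fourier_coeff g n \<equiv> L2_inner cube_pi g (lattice_expo n)"

lemma trig_span_eq: "trig_span l = range (trig_poly l)"
  by (auto simp: trig_span_def trig_poly_def)

lemma trig_poly_L2 [simp]: "trig_poly l c \<in> L2 cube_pi"
  unfolding trig_poly_def by (intro L2_sum L2_cmult lattice_expo_L2)

lemma trig_span_L2: "p \<in> trig_span l \<Longrightarrow> p \<in> L2 cube_pi"
  by (auto simp: trig_span_eq)

lemma fourier_coeff_trig_poly:
  assumes "n \<in> index_cube l" shows "fourier_coeff (trig_poly l c) n = c n"
  unfolding trig_poly_def
  by (subst L2_inner_sum_left)
     (auto simp: lattice_expo_orthonormal assms if_distrib [of "\<lambda>z. _ * z"] cong: if_cong)

lemma inner_trig_poly_right:
  "g \<in> L2 cube_pi \<Longrightarrow> L2_inner cube_pi g (trig_poly l c) = (\<Sum>n\<in>index_cube l. cnj (c n) * fourier_coeff g n)"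
  unfolding trig_poly_def by (subst L2_inner_sum_right) auto

lemma trig_poly_diff: "trig_poly l c x - trig_poly l d x = trig_poly l (\<lambda>n. c n - d n) x"
  by (simp add: trig_poly_def left_diff_distrib sum_subtractf)

lemma trig_poly_fourier_coeff:
  assumes "p \<in> trig_span l" shows "trig_poly l (fourier_coeff p) = p"
proof -
  obtain c where "p = trig_poly l c" using assms by (auto simp: trig_span_eq)
  then have "fourier_coeff p n = c n" if "n \<in> index_cube l" for n
    using that by (simp add: fourier_coeff_trig_poly)
  then have "trig_poly l (fourier_coeff p) = trig_poly l c"
    unfolding trig_poly_def by (intro ext sum.cong) auto
  with \<open>p = trig_poly l c\<close> show ?thesis by simp
qed

lemma l2norm_trig_poly: "(l2norm cube_pi (trig_poly l c))\<^sup>2 = (\<Sum>n\<in>index_cube l. (cmod (c n))\<^sup>2)"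
proof -
  have "complex_of_real ((l2norm cube_pi (trig_poly l c))\<^sup>2) = (\<Sum>n\<in>index_cube l. cnj (c n) * c n)"
    unfolding L2_inner_self [symmetric]
    by (subst inner_trig_poly_right) (auto simp: fourier_coeff_trig_poly)
  also have "\<dots> = complex_of_real (\<Sum>n\<in>index_cube l. (cmod (c n))\<^sup>2)"
    by (simp add: complex_norm_square mult.commute del: of_real_power)
  finally show ?thesis
    by (simp only: of_real_eq_iff)
qed

lemma trig_poly_projection_orthogonal:
  assumes "g \<in> L2 cube_pi" "v \<in> trig_span l"
  shows "L2_inner cube_pi (\<lambda>x. g x - trig_poly l (fourier_coeff g) x) v = 0"
proof -
  obtain c where v: "v = trig_poly l c" using assms by (auto simp: trig_span_eq)
  show ?thesis
    unfolding v using assms(1)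
    by (subst inner_trig_poly_right)
       (auto simp: L2_diff L2_inner_diff_left fourier_coeff_trig_poly)
qed

text \<open>The projection is specified by a description operator, so uniqueness matters: a trigonometric polynomial is
  recovered as a function from its Fourier coefficients.\<close>

lemma trig_proj_eq:
  assumes g: "g \<in> L2 cube_pi"
  shows "trig_proj l g = trig_poly l (fourier_coeff g)"
  unfolding trig_proj_def orth_proj_def
proof (rule the_equality)
  show "trig_poly l (fourier_coeff g) \<in> trig_span l \<and>
    (\<forall>v\<in>trig_span l. L2_inner cube_pi (\<lambda>x. g x - trig_poly l (fourier_coeff g) x) v = 0)"
    using trig_poly_projection_orthogonal [OF g] by (auto simp: trig_span_eq)
next
  fix p assume p: "p \<in> trig_span l \<and> (\<forall>v\<in>trig_span l. L2_inner cube_pi (\<lambda>x. g x - p x) v = 0)"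
  have "fourier_coeff p n = fourier_coeff g n" if n: "n \<in> index_cube l" for n
  proof -
    have "lattice_expo n = trig_poly l (\<lambda>m. if m = n then 1 else 0)"
      using n by (simp add: trig_poly_def fun_eq_iff if_distrib [of "\<lambda>z. z * _"] cong: if_cong)
    then have "lattice_expo n \<in> trig_span l"
      by (simp add: trig_span_eq)
    with p have "L2_inner cube_pi (\<lambda>x. g x - p x) (lattice_expo n) = 0" by blast
    then show ?thesis
      using p g by (subst (asm) L2_inner_diff_left) (auto intro: trig_span_L2)
  qed
  then have "trig_poly l (fourier_coeff g) = trig_poly l (fourier_coeff p)"
    by (auto simp: trig_poly_def fun_eq_iff intro!: sum.cong)
  then show "p = trig_poly l (fourier_coeff g)"
    using p trig_poly_fourier_coeff by metis
qed

text \<open>Bessel's inequality and the optimality of the Fourier partial sum among all trigonometric polynomials of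
  the same size are the two consequences that are needed.\<close>

lemma pythagoras_trig:
  assumes g: "g \<in> L2 cube_pi"
  shows "(l2norm cube_pi (\<lambda>x. g x - trig_poly l c x))\<^sup>2 =
    (l2norm cube_pi (\<lambda>x. g x - trig_poly l (fourier_coeff g) x))\<^sup>2 +
    (\<Sum>n\<in>index_cube l. (cmod (fourier_coeff g n - c n))\<^sup>2)"
proof -
  let ?u = "\<lambda>x. g x - trig_poly l (fourier_coeff g) x"
  let ?v = "trig_poly l (\<lambda>n. fourier_coeff g n - c n)"
  have u: "?u \<in> L2 cube_pi" by (intro L2_diff g trig_poly_L2)
  have v: "?v \<in> L2 cube_pi" by simp
  have uv: "L2_inner cube_pi ?u ?v = 0"
    by (intro trig_poly_projection_orthogonal g) (simp add: trig_span_eq)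
  then have vu: "L2_inner cube_pi ?v ?u = 0"
    using L2_inner_commute [of cube_pi ?v ?u] by simp
  have eq: "(\<lambda>x. g x - trig_poly l c x) = (\<lambda>x. ?u x + ?v x)"
    unfolding trig_poly_diff [symmetric] by (simp add: fun_eq_iff)
  have "complex_of_real ((l2norm cube_pi (\<lambda>x. g x - trig_poly l c x))\<^sup>2)
     = complex_of_real ((l2norm cube_pi ?u)\<^sup>2 + (l2norm cube_pi ?v)\<^sup>2)"
    unfolding L2_inner_self [symmetric] of_real_add eq
    by (simp only: L2_inner_add_left [OF u v L2_add [OF u v]] L2_inner_add_right [OF u v u]
          L2_inner_add_right [OF u v v] uv vu add_0 add_0_right)
  then show ?thesis
    by (simp only: of_real_eq_iff l2norm_trig_poly)
qed

lemma bessel: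
  fixes g :: "real^'d \<Rightarrow> complex"
  assumes g: "g \<in> L2 cube_pi"
  shows "(\<Sum>n\<in>index_cube l. (cmod (fourier_coeff g n))\<^sup>2) \<le> (l2norm cube_pi g)\<^sup>2"
proof -
  have "trig_poly l (\<lambda>n. 0) x = 0" for x :: "real^'d" by (simp add: trig_poly_def)
  then have "(\<lambda>x. g x - trig_poly l (\<lambda>n. 0) x) = g" by (simp add: fun_eq_iff)
  with pythagoras_trig [OF g, of l "\<lambda>n. 0"] show ?thesis by simp
qed

lemma best_approximation:
  assumes g: "g \<in> L2 cube_pi" and p: "p \<in> trig_span l"
  shows "l2norm cube_pi (\<lambda>x. g x - trig_poly l (fourier_coeff g) x) \<le> l2norm cube_pi (\<lambda>x. g x - p x)"
proof (rule power2_le_imp_le)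
  obtain c where "p = trig_poly l c" using p by (auto simp: trig_span_eq)
  then show "(l2norm cube_pi (\<lambda>x. g x - trig_poly l (fourier_coeff g) x))\<^sup>2 \<le> (l2norm cube_pi (\<lambda>x. g x - p x))\<^sup>2"
    using pythagoras_trig [OF g, of l c] by (simp add: sum_nonneg)
qed simp

lemma trig_span_mono: "k \<le> l \<Longrightarrow> trig_span k \<subseteq> trig_span l"
proof
  fix p assume "k \<le> l" "p \<in> trig_span k"
  then obtain c where "p = trig_poly k c" by (auto simp: trig_span_eq)
  also have "\<dots> = trig_poly l (\<lambda>n. if n \<in> index_cube k then c n else 0)"
    unfolding trig_poly_def
    using index_cube_mono [OF \<open>k \<le> l\<close>]
    by (intro ext sum.mono_neutral_cong_left) auto
  finally show "p \<in> trig_span l" by (simp add: trig_span_eq)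
qed

section \<open>Density of trigonometric polynomials\<close>

definition trig_polys :: "(real^'d \<Rightarrow> complex) set" where
  "trig_polys = (\<Union>l. trig_span l)"

lemma trig_polys_L2: "p \<in> trig_polys \<Longrightarrow> p \<in> L2 cube_pi"
  by (auto simp: trig_polys_def trig_span_L2)

lemma trig_polys_add:
  assumes "p \<in> trig_polys" "q \<in> trig_polys"
  shows "(\<lambda>x. p x + q x) \<in> trig_polys"
proof -
  obtain k l where "p \<in> trig_span k" "q \<in> trig_span l"
    using assms by (auto simp: trig_polys_def)
  then have "p \<in> trig_span (max k l)" "q \<in> trig_span (max k l)"
    using trig_span_mono max.cobounded1 max.cobounded2 by blast+
  then obtain c d where "p = trig_poly (max k l) c" "q = trig_poly (max k l) d"
    by (auto simp: trig_span_eq)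
  then have "(\<lambda>x. p x + q x) = trig_poly (max k l) (\<lambda>n. c n + d n)"
    by (auto simp: trig_poly_def distrib_right sum.distrib)
  then show ?thesis
    by (auto simp: trig_polys_def trig_span_eq)
qed

lemma trig_polys_cmult:
  assumes "p \<in> trig_polys"
  shows "(\<lambda>x. a * p x) \<in> trig_polys"
proof -
  obtain l c where "p = trig_poly l c"
    using assms by (auto simp: trig_polys_def trig_span_eq)
  then have "(\<lambda>x. a * p x) = trig_poly l (\<lambda>n. a * c n)"
    by (auto simp: trig_poly_def sum_distrib_left mult.assoc)
  then show ?thesis
    by (auto simp: trig_polys_def trig_span_eq)
qed

lemma lattice_expo_trig_polys: "lattice_expo n \<in> trig_polys"
proof -
  define l where "l = nat (\<Sum>i\<in>UNIV. \<bar>n $ i\<bar>)"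
  have "\<bar>n $ i\<bar> \<le> (\<Sum>i\<in>UNIV. \<bar>n $ i\<bar>)" for i
    by (rule member_le_sum) auto
  then have n: "n \<in> index_cube l"
    unfolding index_cube_def l_def by (simp add: abs_le_iff minus_le_iff sum_nonneg)
  have "lattice_expo n = trig_poly l (\<lambda>m. if m = n then 1 else 0)"
    using n by (simp add: trig_poly_def fun_eq_iff if_distrib [of "\<lambda>z. z * _"] cong: if_cong)
  then show ?thesis
    by (auto simp: trig_polys_def trig_span_eq)
qed

lemma trig_polys_0: "(\<lambda>x. 0) \<in> trig_polys"
  using trig_polys_cmult [OF lattice_expo_trig_polys, of 0] by simp

lemma trig_polys_sum:
  "(\<And>i. i \<in> I \<Longrightarrow> p i \<in> trig_polys) \<Longrightarrow> (\<lambda>x. \<Sum>i\<in>I. p i x) \<in> trig_polys"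
  by (induction I rule: infinite_finite_induct) (auto simp: trig_polys_0 intro: trig_polys_add)

lemma exp_trig_polys: "(\<lambda>x. exp (\<i> * of_real (x \<bullet> (\<chi> i. real_of_int (n $ i))))) \<in> trig_polys"
  using trig_polys_cmult [OF lattice_expo_trig_polys, of "of_real ((2 * pi) powr (real CARD('a) / 2))" n]
  by (simp add: lattice_expo_def expo_def)

lemma trig_polys_const: "(\<lambda>x. c) \<in> trig_polys"
  using trig_polys_cmult [OF exp_trig_polys [of 0], of c] by (simp add: inner_vec_def)

lemma lattice_expo_mult_trig_polys: "(\<lambda>x. lattice_expo m x * lattice_expo n x) \<in> trig_polys"
proof -
  have eq: "(\<chi> i. real_of_int ((m + n) $ i)) = (\<chi> i. real_of_int (m $ i)) + (\<chi> i. real_of_int (n $ i))"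
    by (simp add: vec_eq_iff)
  define c where "c = complex_of_real (1 / (2 * pi) powr (real CARD('a) / 2))"
  have "(\<lambda>x. lattice_expo m x * lattice_expo n x) = (\<lambda>x. c * lattice_expo (m + n) x)"
    unfolding lattice_expo_def expo_def eq c_def [symmetric]
    by (simp add: fun_eq_iff inner_add_right distrib_left exp_add)
  then show ?thesis
    by (simp add: trig_polys_cmult lattice_expo_trig_polys)
qed

lemma trig_polys_mult:
  assumes "p \<in> trig_polys" "q \<in> trig_polys"
  shows "(\<lambda>x. p x * q x) \<in> trig_polys"
proof -
  obtain k c where p: "p = trig_poly k c"
    using assms by (auto simp: trig_polys_def trig_span_eq)
  obtain l d where q: "q = trig_poly l d"
    using assms by (auto simp: trig_polys_def trig_span_eq)
  have "(\<lambda>x. p x * q x) = (\<lambda>x. \<Sum>m\<in>index_cube k. \<Sum>n\<in>index_cube l.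
      (c m * d n) * (lattice_expo m x * lattice_expo n x))"
    by (simp add: p q trig_poly_def sum_product mult_ac)
  then show ?thesis
    by (simp only:) (intro trig_polys_sum trig_polys_cmult lattice_expo_mult_trig_polys)
qed

lemma cos_sin_trig_polys:
  fixes i :: "'d::finite"
  shows "(\<lambda>x. of_real (cos (x $ i))) \<in> trig_polys" "(\<lambda>x. of_real (sin (x $ i))) \<in> trig_polys"
proof -
  have e: "(\<lambda>x::real^'d. exp (\<i> * of_real (of_int k * x $ i))) \<in> trig_polys" for k
  proof -
    have "(\<chi> j. real_of_int (axis i k $ j)) = axis i (real_of_int k)"
      by (simp add: axis_def vec_eq_iff)
    then show ?thesis
      using exp_trig_polys [of "axis i k"] by (simp add: inner_axis mult.commute)
  qed
  have "(\<lambda>x. of_real (cos (x $ i))) =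
      (\<lambda>x. (1/2) * exp (\<i> * of_real (of_int 1 * x $ i)) + (1/2) * exp (\<i> * of_real (of_int (-1) * x $ i)))"
    by (simp add: fun_eq_iff cos_of_real [symmetric] cos_exp_eq field_simps)
  then show "(\<lambda>x. of_real (cos (x $ i))) \<in> trig_polys"
    by (simp only:) (intro trig_polys_add trig_polys_cmult e)
  have "(\<lambda>x. of_real (sin (x $ i))) =
      (\<lambda>x. (1/(2*\<i>)) * exp (\<i> * of_real (of_int 1 * x $ i)) + (-1/(2*\<i>)) * exp (\<i> * of_real (of_int (-1) * x $ i)))"
    by (simp add: fun_eq_iff sin_of_real [symmetric] sin_exp_eq field_simps)
  then show "(\<lambda>x. of_real (sin (x $ i))) \<in> trig_polys"
    by (simp only:) (intro trig_polys_add trig_polys_cmult e)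
qed

text \<open>Trigonometric polynomials cannot separate opposite faces of the cube, so the Stone-Weierstrass theorem is
  applied on the torus, which is the image of the cube under this map.\<close>

definition torus_map :: "real^'d \<Rightarrow> complex^'d" where
  "torus_map x = (\<chi> i. cis (x $ i))"

lemma continuous_on_torus_map: "continuous_on S torus_map"
  unfolding torus_map_def cis_conv_exp by (intro continuous_intros)

text \<open>Linear functionals of \<open>torus_map x\<close> are combinations of cosines and sines of single coordinates, and
  trigonometric polynomials are closed under sums and products.\<close>

lemma polynomial_torus_map_trig_polys:
  fixes q :: "complex^'d \<Rightarrow> real"
  assumes "real_polynomial_function q"
  shows "(\<lambda>x. complex_of_real (q (torus_map x))) \<in> trig_polys"
  using assms
proof induction
  case (linear f)
  interpret f: bounded_linear f by fact
  have "torus_map x = (\<Sum>i\<in>UNIV. cos (x $ i) *\<^sub>R axis i 1 + sin (x $ i) *\<^sub>R axis i \<i>)" for x :: "real^'d"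
  proof -
    have "cos (x $ j) *\<^sub>R axis j 1 $ i + sin (x $ j) *\<^sub>R axis j \<i> $ i = (if j = i then cis (x $ i) else 0)" for i j
      by (auto simp: axis_def complex_eq_iff)
    then show ?thesis
      by (simp add: vec_eq_iff torus_map_def)
  qed
  then have "(\<lambda>x. complex_of_real (f (torus_map x))) =
     (\<lambda>x. \<Sum>i\<in>UNIV. of_real (f (axis i 1)) * of_real (cos (x $ i)) + of_real (f (axis i \<i>)) * of_real (sin (x $ i)))"
    by (simp add: f.sum f.add f.scaleR mult.commute)
  then show ?case
    by (simp only:) (intro trig_polys_sum trig_polys_add trig_polys_cmult cos_sin_trig_polys)
qed (auto simp: trig_polys_const trig_polys_add trig_polys_mult)

text \<open>A function that vanishes on the boundary of the cube takes equal values at points that the torus map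
  identifies, so it descends to a function on the torus. The descended function is continuous because the torus
  map, being continuous on a compact set, sends closed sets to closed sets.\<close>

lemma Stone_Weierstrass_trig:
  fixes \<phi> :: "real^'d \<Rightarrow> complex"
  assumes cont: "continuous_on UNIV \<phi>" and zero: "\<And>x i. pi \<le> \<bar>x $ i\<bar> \<Longrightarrow> \<phi> x = 0" and "e > 0"
  shows "\<exists>p\<in>trig_polys. \<forall>x\<in>sym_cube pi. cmod (\<phi> x - p x) < e"
proof -
  let ?S = "sym_cube pi :: (real^'d) set"
  define T where "T = torus_map ` ?S"
  \<comment> \<open>The principal argument inverts the torus map except on the faces where some coordinate is \<open>- \<pi>\<close>;
    there \<open>\<phi>\<close> vanishes.\<close>
  define G where "G z = \<phi> (\<chi> i. Arg (z $ i))" for z :: "complex^'d"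
  have G: "G (torus_map x) = \<phi> x" if x: "x \<in> ?S" for x
  proof (cases "\<forall>i. - pi < x $ i")
    case True
    then have "(\<chi> i. Arg (torus_map x $ i)) = x"
      using x by (auto simp: sym_cube_def torus_map_def vec_eq_iff intro!: cis_Arg_unique Arg_cis)
    then show ?thesis by (simp add: G_def)
  next
    case False
    then obtain i where i: "x $ i = - pi"
      using x by (auto simp: sym_cube_def not_less intro: antisym)
    moreover have "cis (- pi) = - 1"
      by (simp add: complex_eq_iff)
    ultimately have "Arg (torus_map x $ i) = pi"
      using cis_Arg_unique [of "- 1" pi] by (simp add: torus_map_def sgn_minus)
    then have "G (torus_map x) = 0"
      unfolding G_def by (intro zero [of _ i]) simp
    moreover have "\<phi> x = 0"
      using i by (intro zero [of _ i]) simp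
    ultimately show ?thesis by simp
  qed
  have "compact T"
    unfolding T_def by (intro compact_continuous_image continuous_on_torus_map compact_sym_cube)
  have contG: "continuous_on T G"
    unfolding continuous_on_closed_vimage [OF compact_imp_closed [OF \<open>compact T\<close>]]
  proof (intro allI impI)
    fix C :: "complex set" assume "closed C"
    have "G -` C \<inter> T = torus_map ` (?S \<inter> \<phi> -` C)"
      using G by (auto simp: T_def)
    moreover have "compact (?S \<inter> \<phi> -` C)"
      using continuous_closed_vimage [OF \<open>closed C\<close>] cont compact_sym_cube
      by (intro compact_Int_closed) (auto simp: continuous_on_eq_continuous_at)
    ultimately show "closed (G -` C \<inter> T)"
      by (simp add: compact_imp_closed compact_continuous_image continuous_on_torus_map)
  qed
  obtain q where q: "polynomial_function q" "\<And>z. z \<in> T \<Longrightarrow> cmod (G z - q z) < e"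
    using Stone_Weierstrass_polynomial_function [OF \<open>compact T\<close> contG \<open>e > 0\<close>] by blast
  have "real_polynomial_function (\<lambda>z. Re (q z))" "real_polynomial_function (\<lambda>z. Im (q z))"
    using q(1) bounded_linear_Re bounded_linear_Im unfolding polynomial_function_def o_def by blast+
  then have "(\<lambda>x. of_real (Re (q (torus_map x))) + \<i> * of_real (Im (q (torus_map x)))) \<in> trig_polys"
    by (intro trig_polys_add trig_polys_cmult polynomial_torus_map_trig_polys)
  then have "(\<lambda>x. q (torus_map x)) \<in> trig_polys"
    unfolding complex_eq [symmetric] .
  moreover have "cmod (\<phi> x - q (torus_map x)) < e" if "x \<in> ?S" for x
    using q(2) [of "torus_map x"] G [OF that] that by (simp add: T_def)
  ultimately show ?thesis by (intro bexI [of _ "\<lambda>x. q (torus_map x)"]) auto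
qed

text \<open>The dominated convergence theorem in \<open>L\<^sub>2\<close>.\<close>

lemma l2norm_tendsto_0:
  assumes [measurable]: "g \<in> borel_measurable M" "\<And>n. F n \<in> borel_measurable M"
    and lim: "AE x in M. (\<lambda>n. F n x) \<longlonglongrightarrow> g x"
    and w: "integrable M w" "\<And>n. AE x in M. (cmod (g x - F n x))\<^sup>2 \<le> w x"
  shows "(\<lambda>n. l2norm M (\<lambda>x. g x - F n x)) \<longlonglongrightarrow> 0"
proof -
  have "(\<lambda>n. LINT x|M. (cmod (g x - F n x))\<^sup>2) \<longlonglongrightarrow> (LINT x|M. 0)"
  proof (rule integral_dominated_convergence [OF _ _ w(1)])
    show "AE x in M. (\<lambda>n. (cmod (g x - F n x))\<^sup>2) \<longlonglongrightarrow> 0"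
      using lim
    proof eventually_elim
      case (elim x)
      have "(\<lambda>n. (cmod (g x - F n x))\<^sup>2) \<longlonglongrightarrow> (cmod (g x - g x))\<^sup>2"
        by (intro tendsto_intros elim)
      then show ?case by simp
    qed
    show "AE x in M. norm ((cmod (g x - F n x))\<^sup>2) \<le> w x" for n
      using w(2) [of n] by simp
  qed simp_all
  then show ?thesis
    unfolding l2norm_def using tendsto_real_sqrt by fastforce
qed

text \<open>A measurable function is an almost everywhere limit of continuous functions. Truncating these at height
  \<open>B\<close> makes dominated convergence applicable, and multiplying them by cut-off functions that increase to the
  indicator of the open cube produces the boundary values \<open>0\<close>; the boundary itself is a null set.\<close>

lemma bounded_L2_approx_continuous:
  fixes h :: "real^'d \<Rightarrow> complex"
  assumes meas [measurable]: "h \<in> borel_measurable cube_pi" and bound: "\<And>x. x \<in> sym_cube pi \<Longrightarrow> cmod (h x) \<le> B"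
    and "B > 0" "e > 0"
  shows "\<exists>\<phi>. continuous_on UNIV \<phi> \<and> (\<forall>x i. pi \<le> \<bar>x $ i\<bar> \<longrightarrow> \<phi> x = 0) \<and> l2norm cube_pi (\<lambda>x. h x - \<phi> x) < e"
proof -
  let ?S = "sym_cube pi :: (real^'d) set"
  have "h measurable_on ?S"
    using meas by (simp add: measurable_on_iff_borel_measurable)
  then obtain N g where N: "negligible N" and contg: "\<And>n. continuous_on UNIV (g n)"
    and lim: "\<And>x. x \<notin> N \<Longrightarrow> (\<lambda>n. g n x) \<longlonglongrightarrow> (if x \<in> ?S then h x else 0)"
    unfolding measurable_on_def by blast
  \<comment> \<open>The complement of the open cube, towards which the approximants are cut off.\<close>
  define K where "K = {x::real^'d. \<exists>i. pi \<le> \<bar>x $ i\<bar>}"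
  have "closed K"
    unfolding K_def Collect_ex_eq by (intro closed_UN closed_Collect_le continuous_intros ballI) auto
  have "K \<noteq> {}"
    unfolding K_def by (auto intro!: exI [of _ "\<chi> i. pi"])
  define \<phi> where "\<phi> n x = of_real (min 1 (real n * infdist x K)) * (of_real (B / max B (cmod (g n x))) * g n x)" for n x
  have cont: "continuous_on UNIV (\<phi> n)" for n
    unfolding \<phi>_def using \<open>B > 0\<close>
    by (intro continuous_intros contg) auto
  have zero: "\<phi> n x = 0" if "pi \<le> \<bar>x $ i\<bar>" for n x i
  proof -
    have "x \<in> K" using that by (auto simp: K_def)
    then show ?thesis by (simp add: \<phi>_def)
  qed
  have le: "cmod (\<phi> n x) \<le> B" for n x
  proof -
    have "cmod (\<phi> n x) = min 1 (real n * infdist x K) * (B / max B (cmod (g n x)) * cmod (g n x))"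
      unfolding \<phi>_def norm_mult norm_of_real using \<open>B > 0\<close>
      by (subst (1 2) abs_of_nonneg) (auto simp: infdist_nonneg)
    also have "\<dots> \<le> 1 * B"
      using \<open>B > 0\<close> by (intro mult_mono) (auto simp: divide_simps max_def)
    finally show ?thesis by simp
  qed
  have ae: "AE x in cube_pi. (\<lambda>n. \<phi> n x) \<longlonglongrightarrow> h x"
  proof -
    have "K \<inter> ?S \<subseteq> cbox (\<chi> i. - pi) (\<chi> i. pi) - box (\<chi> i. - pi) (\<chi> i. pi)"
    proof
      fix x assume x: "x \<in> K \<inter> ?S"
      then obtain i where "pi \<le> \<bar>x $ i\<bar>" by (auto simp: K_def)
      then have "\<not> (- pi < x $ i \<and> x $ i < pi)" by linarith
      with x show "x \<in> cbox (\<chi> i. - pi) (\<chi> i. pi) - box (\<chi> i. - pi) (\<chi> i. pi)"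
        by (auto simp: sym_cube_eq_cbox mem_box_cart)
    qed
    then have "negligible (N \<union> (K \<inter> ?S))"
      using negligible_subset [OF negligible_frontier_interval] N negligible_Un by blast
    then have "AE x in lebesgue. x \<notin> N \<union> (K \<inter> ?S)"
      by (intro AE_not_in) (simp add: negligible_iff_null_sets)
    then have "AE x in lebesgue. x \<in> ?S \<longrightarrow> (\<lambda>n. \<phi> n x) \<longlonglongrightarrow> h x"
    proof eventually_elim
      case (elim x)
      show ?case
      proof
        assume x: "x \<in> ?S"
        then have "x \<notin> K" "x \<notin> N" using elim by auto
        then have pos: "infdist x K > 0"
          using \<open>closed K\<close> \<open>K \<noteq> {}\<close> infdist_pos_not_in_closed by blast
        have gx: "(\<lambda>n. g n x) \<longlonglongrightarrow> h x"
          using lim [OF \<open>x \<notin> N\<close>] x by simp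
        have "eventually (\<lambda>n. real n \<ge> 1 / infdist x K) sequentially"
          using eventually_ge_at_top filterlim_real_sequentially filterlim_at_top by blast
        then have "eventually (\<lambda>n. min 1 (real n * infdist x K) = 1) sequentially"
          by eventually_elim (use pos in \<open>auto simp: field_simps\<close>)
        then have "(\<lambda>n. min 1 (real n * infdist x K)) \<longlonglongrightarrow> 1"
          by (rule tendsto_eventually)
        then have "(\<lambda>n. \<phi> n x) \<longlonglongrightarrow> of_real 1 * (of_real (B / max B (cmod (h x))) * h x)"
          unfolding \<phi>_def using \<open>B > 0\<close> by (intro tendsto_intros gx) auto
        moreover have "max B (cmod (h x)) = B"
          using bound [OF x] by simp
        ultimately show "(\<lambda>n. \<phi> n x) \<longlonglongrightarrow> h x"
          using \<open>B > 0\<close> by simp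
      qed
    qed
    then show ?thesis
      by (simp add: AE_restrict_space_iff)
  qed
  have "(\<lambda>n. l2norm cube_pi (\<lambda>x. h x - \<phi> n x)) \<longlonglongrightarrow> 0"
  proof (rule l2norm_tendsto_0 [OF meas _ ae])
    show "\<phi> n \<in> borel_measurable cube_pi" for n
      by (intro measurable_cube_continuous cont)
    show "integrable cube_pi (\<lambda>x::real^'d. (2 * B)\<^sup>2)"
      by (intro integrable_cube_continuous continuous_intros)
    fix n
    have "(cmod (h x - \<phi> n x))\<^sup>2 \<le> (2 * B)\<^sup>2" if "x \<in> ?S" for x
      using norm_triangle_ineq4 [of "h x" "\<phi> n x"] bound [OF that] le [of n x]
      by (intro power_mono) auto
    then show "AE x in cube_pi. (cmod (h x - \<phi> n x))\<^sup>2 \<le> (2 * B)\<^sup>2"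
      by (intro AE_I2) simp
  qed
  then have "eventually (\<lambda>n. l2norm cube_pi (\<lambda>x. h x - \<phi> n x) < e) sequentially"
    using \<open>e > 0\<close> by (rule order_tendstoD)
  then obtain n where "l2norm cube_pi (\<lambda>x. h x - \<phi> n x) < e"
    by (auto simp: eventually_sequentially)
  then show ?thesis
    using cont zero by blast
qed

lemma trig_polys_dense:
  fixes g :: "real^'d \<Rightarrow> complex"
  assumes g: "g \<in> L2 cube_pi" and "e > 0"
  shows "\<exists>p\<in>trig_polys. l2norm cube_pi (\<lambda>x. g x - p x) < e"
proof -
  have [measurable]: "g \<in> borel_measurable cube_pi" using L2_measurable [OF g] .
  define h where "h m x = (if cmod (g x) \<le> real (Suc m) then g x else 0)" for m x
  have [measurable]: "h m \<in> borel_measurable cube_pi" for m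
    unfolding h_def by measurable
  have "(\<lambda>m. l2norm cube_pi (\<lambda>x. g x - h m x)) \<longlonglongrightarrow> 0"
  proof (rule l2norm_tendsto_0 [OF _ _ _ L2_integrable_square [OF g]])
    show "AE x in cube_pi. (\<lambda>m. h m x) \<longlonglongrightarrow> g x"
    proof (rule AE_I2)
      fix x
      obtain k where "cmod (g x) \<le> real k" using real_arch_simple by blast
      then have "eventually (\<lambda>m. h m x = g x) sequentially"
        unfolding h_def by (auto simp: eventually_sequentially intro!: exI [of _ k])
      then show "(\<lambda>m. h m x) \<longlonglongrightarrow> g x" by (rule tendsto_eventually)
    qed
  qed (auto simp: h_def)
  then have "eventually (\<lambda>m. l2norm cube_pi (\<lambda>x. g x - h m x) < e/3) sequentially"
    using \<open>e > 0\<close> by (intro order_tendstoD) auto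
  then obtain m where m: "l2norm cube_pi (\<lambda>x. g x - h m x) < e/3"
    by (auto simp: eventually_sequentially)
  have hm: "h m \<in> L2 cube_pi"
    by (rule L2_bound [OF g]) (auto simp: h_def)
  obtain \<phi> where \<phi>: "continuous_on UNIV \<phi>" "\<And>x i. pi \<le> \<bar>x $ i\<bar> \<Longrightarrow> \<phi> x = 0"
    "l2norm cube_pi (\<lambda>x. h m x - \<phi> x) < e/3"
  proof -
    have "cmod (h m x) \<le> real (Suc m)" for x
      by (simp add: h_def)
    then show thesis
      using bounded_L2_approx_continuous [of "h m" "real (Suc m)" "e/3"] \<open>e > 0\<close> that by auto
  qed
  have \<phi>L2: "\<phi> \<in> L2 cube_pi" by (intro L2_cube_continuous \<phi>)
  define V where "V = l2norm cube_pi (\<lambda>x::real^'d. 1)"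
  have "V \<ge> 0" by (simp add: V_def)
  \<comment> \<open>The uniform error that keeps the \<open>L\<^sub>2\<close> error on the cube below \<open>e/3\<close>.\<close>
  define \<delta> where "\<delta> = e / (3 * (V + 1))"
  have \<delta>: "\<delta> > 0" "\<delta> * V < e/3"
    using \<open>e > 0\<close> \<open>V \<ge> 0\<close> by (auto simp: \<delta>_def field_simps add_pos_nonneg)
  obtain p where p: "p \<in> trig_polys" "\<And>x. x \<in> sym_cube pi \<Longrightarrow> cmod (\<phi> x - p x) < \<delta>"
    using Stone_Weierstrass_trig [OF \<phi>(1) _ \<delta>(1)] \<phi>(2) by metis
  have pL2: "p \<in> L2 cube_pi" by (rule trig_polys_L2 [OF p(1)])
  have c: "(\<lambda>x::real^'d. complex_of_real \<delta> * 1) \<in> L2 cube_pi"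
    by (intro L2_cube_continuous continuous_intros)
  have "l2norm cube_pi (\<lambda>x. \<phi> x - p x) \<le> l2norm cube_pi (\<lambda>x::real^'d. complex_of_real \<delta> * 1)"
    using p(2) \<delta>(1) L2_measurable [OF L2_diff [OF \<phi>L2 pL2]] by (intro l2norm_mono [OF c]) (auto intro: less_imp_le)
  also have "\<dots> = \<delta> * V"
    using \<delta>(1) by (simp only: l2norm_cmult V_def) simp
  finally have "l2norm cube_pi (\<lambda>x. \<phi> x - p x) < e/3" using \<delta> by linarith
  then have "l2norm cube_pi (\<lambda>x. g x - p x) < e"
    using l2norm_triangle_diff [OF g hm pL2] l2norm_triangle_diff [OF hm \<phi>L2 pL2] m \<phi>(3) by linarith
  then show ?thesis using p(1) by blast
qed

text \<open>The partial sum is a best approximation and the spans increase with \<open>l\<close>, so this follows from density.\<close>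

lemma fourier_partial_sums_converge:
  fixes g :: "real^'d \<Rightarrow> complex"
  assumes g: "g \<in> L2 cube_pi"
  shows "(\<lambda>l. l2norm cube_pi (\<lambda>x. g x - trig_poly l (fourier_coeff g) x)) \<longlonglongrightarrow> 0"
proof (rule LIMSEQ_I)
  fix e :: real assume "e > 0"
  obtain p where p: "p \<in> trig_polys" "l2norm cube_pi (\<lambda>x. g x - p x) < e"
    using trig_polys_dense [OF g \<open>e > 0\<close>] by blast
  then obtain k where k: "p \<in> trig_span k" by (auto simp: trig_polys_def)
  have "l2norm cube_pi (\<lambda>x. g x - trig_poly l (fourier_coeff g) x) < e" if "l \<ge> k" for l
    using best_approximation [OF g, of p l] trig_span_mono [OF that] k p(2) by force
  then show "\<exists>k. \<forall>l\<ge>k. norm (l2norm cube_pi (\<lambda>x. g x - trig_poly l (fourier_coeff g) x) - 0) < e"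
    by auto
qed

section \<open>Fourier transforms of functions on the cube\<close>

text \<open>The Fourier transform of a function on the cube: the kernel is the complex conjugate of \<open>expo s\<close>. Its
  value at a node is the inner product with the corresponding exponential.\<close>

definition cube_fourier :: "(real^'d \<Rightarrow> complex) \<Rightarrow> real^'d \<Rightarrow> complex" where
  "cube_fourier G s = L2_inner cube_pi G (expo s)"

lemma l2norm_expo: "l2norm cube_pi (expo s) = 1"
proof -
  have "complex_of_real ((l2norm cube_pi (expo s))\<^sup>2) = 1"
    unfolding L2_inner_self [symmetric] expo_inner by (simp add: sincpi_def)
  then have "(l2norm cube_pi (expo s))\<^sup>2 = 1"
    by (metis of_real_1 of_real_eq_iff)
  then show ?thesis
    using l2norm_nonneg [of cube_pi "expo s"] by (simp add: power2_eq_1_iff)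
qed

lemma norm_cube_fourier_le: "G \<in> L2 cube_pi \<Longrightarrow> cmod (cube_fourier G s) \<le> l2norm cube_pi G"
  using L2_inner_Cauchy_Schwarz [of G cube_pi "expo s"] by (simp add: cube_fourier_def l2norm_expo)

lemma cube_fourier_diff:
  "F \<in> L2 cube_pi \<Longrightarrow> G \<in> L2 cube_pi \<Longrightarrow>
    cube_fourier (\<lambda>x. F x - G x) s = cube_fourier F s - cube_fourier G s"
  by (simp add: cube_fourier_def L2_inner_diff_left)

lemma cube_fourier_trig_poly:
  "cube_fourier (trig_poly l c) s =
    (\<Sum>n\<in>index_cube l. c n * of_real (\<Prod>i\<in>UNIV. sincpi (real_of_int (n $ i) - s $ i)))"
  unfolding cube_fourier_def trig_poly_def
  by (subst L2_inner_sum_left) (simp_all add: lattice_expo_def expo_inner)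

lemma continuous_on_sincpi: "continuous_on S sincpi"
proof -
  have eq: "sincpi = (\<lambda>a. sinc (pi * a))"
    by (auto simp: sincpi_def fun_eq_iff)
  have "isCont sincpi a" for a
    unfolding eq by (rule isCont_o2 [OF _ isCont_sinc]) (intro continuous_intros)
  then show ?thesis
    by (simp add: continuous_at_imp_continuous_on)
qed

lemma sincpi_le_1: "\<bar>sincpi a\<bar> \<le> 1"
proof (cases "a = 0")
  case False
  have "\<bar>sin (pi * a)\<bar> \<le> \<bar>pi * a\<bar>"
    by (rule abs_sin_x_le_abs_x)
  then show ?thesis
    using False by (simp add: sincpi_def abs_divide divide_le_eq abs_mult)
qed (simp add: sincpi_def)

lemma sincpi_decay: "\<bar>a\<bar> * \<bar>sincpi a\<bar> \<le> 1"
proof (cases "a = 0")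
  case False
  then have "\<bar>a\<bar> * \<bar>sincpi a\<bar> = \<bar>sin (pi * a)\<bar> / pi"
    by (simp add: sincpi_def abs_divide abs_mult)
  also have "\<dots> \<le> 1 / pi"
    by (intro divide_right_mono) auto
  also have "\<dots> \<le> 1"
    using pi_gt3 by simp
  finally show ?thesis .
qed simp

lemma continuous_on_cube_fourier_trig_poly: "continuous_on S (cube_fourier (trig_poly l c))"
  unfolding cube_fourier_trig_poly [abs_def]
  by (intro continuous_intros continuous_on_compose2 [OF continuous_on_sincpi [of UNIV]]) auto

lemma cube_fourier_uniform_approx:
  fixes G :: "real^'d \<Rightarrow> complex"
  assumes G: "G \<in> L2 cube_pi" and "e > 0"
  shows "\<exists>l c. \<forall>s. cmod (cube_fourier G s - cube_fourier (trig_poly l c) s) < e"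
proof -
  have "eventually (\<lambda>l. l2norm cube_pi (\<lambda>x. G x - trig_poly l (fourier_coeff G) x) < e) sequentially"
    using fourier_partial_sums_converge [OF G] \<open>e > 0\<close> by (rule order_tendstoD)
  then obtain l where l: "l2norm cube_pi (\<lambda>x. G x - trig_poly l (fourier_coeff G) x) < e"
    by (auto simp: eventually_sequentially)
  have "cmod (cube_fourier G s - cube_fourier (trig_poly l (fourier_coeff G)) s) < e" for s
    using norm_cube_fourier_le [OF L2_diff [OF G trig_poly_L2], of l "fourier_coeff G" s] l
    by (simp add: cube_fourier_diff G)
  then show ?thesis by blast
qed

lemma continuous_on_cube_fourier:
  fixes G :: "real^'d \<Rightarrow> complex"
  assumes G: "G \<in> L2 cube_pi"
  shows "continuous_on S (cube_fourier G)"
proof (rule uniform_limit_theorem [of _ _ sequentially])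
  show "\<forall>\<^sub>F l in sequentially. continuous_on S (cube_fourier (trig_poly l (fourier_coeff G)))"
    by (simp add: continuous_on_cube_fourier_trig_poly)
  show "uniform_limit S (\<lambda>l. cube_fourier (trig_poly l (fourier_coeff G))) (cube_fourier G) sequentially"
  proof (rule uniform_limitI)
    fix e :: real assume "e > 0"
    have "eventually (\<lambda>l. l2norm cube_pi (\<lambda>x. G x - trig_poly l (fourier_coeff G) x) < e) sequentially"
      using fourier_partial_sums_converge [OF G] \<open>e > 0\<close> by (rule order_tendstoD)
    then show "\<forall>\<^sub>F l in sequentially. \<forall>s\<in>S. dist (cube_fourier (trig_poly l (fourier_coeff G)) s) (cube_fourier G s) < e"
    proof eventually_elim
      case (elim l)
      have "dist (cube_fourier (trig_poly l (fourier_coeff G)) s) (cube_fourier G s) < e" for s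
        using norm_cube_fourier_le [OF L2_diff [OF G trig_poly_L2], of l "fourier_coeff G" s] elim
        by (simp add: cube_fourier_diff G dist_norm norm_minus_commute)
      then show ?case by blast
    qed
  qed
qed simp

lemma cube_fourier_trig_poly_decay:
  fixes c :: "int^'d \<Rightarrow> complex"
  assumes "\<bar>s $ i\<bar> > R + real l" "R > 0"
  shows "cmod (cube_fourier (trig_poly l c) s) \<le> (\<Sum>n\<in>index_cube l. cmod (c n)) / R"
proof -
  have "\<bar>\<Prod>i\<in>UNIV. sincpi (real_of_int (n $ i) - s $ i)\<bar> \<le> 1 / R" if n: "n \<in> index_cube l" for n
  proof -
    have "\<bar>real_of_int (n $ i)\<bar> \<le> real l"
      using n unfolding index_cube_def by (auto simp: abs_le_iff) (smt (verit) of_int_of_nat_eq of_int_le_iff of_int_minus)+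
    then have R: "R < \<bar>real_of_int (n $ i) - s $ i\<bar>"
      using assms by linarith
    have "\<bar>\<Prod>i\<in>UNIV. sincpi (real_of_int (n $ i) - s $ i)\<bar>
        = \<bar>sincpi (real_of_int (n $ i) - s $ i)\<bar> * (\<Prod>j\<in>UNIV - {i}. \<bar>sincpi (real_of_int (n $ j) - s $ j)\<bar>)"
      by (simp add: prod.remove [of UNIV i] abs_mult abs_prod)
    also have "\<dots> \<le> \<bar>sincpi (real_of_int (n $ i) - s $ i)\<bar> * 1"
      by (intro mult_left_mono prod_le_1) (auto simp: sincpi_le_1)
    also have "\<dots> \<le> 1 / R"
    proof -
      have "R * \<bar>sincpi (real_of_int (n $ i) - s $ i)\<bar> \<le> \<bar>real_of_int (n $ i) - s $ i\<bar> * \<bar>sincpi (real_of_int (n $ i) - s $ i)\<bar>"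
        using R by (intro mult_right_mono) auto
      then have "R * \<bar>sincpi (real_of_int (n $ i) - s $ i)\<bar> \<le> 1"
        using sincpi_decay [of "real_of_int (n $ i) - s $ i"] by linarith
      then show ?thesis using \<open>R > 0\<close> by (simp add: field_simps)
    qed
    finally show ?thesis .
  qed
  then have "cmod (c n * of_real (\<Prod>i\<in>UNIV. sincpi (real_of_int (n $ i) - s $ i))) \<le> cmod (c n) * (1 / R)"
    if "n \<in> index_cube l" for n
    unfolding norm_mult norm_of_real using that by (intro mult_left_mono) auto
  then have "cmod (cube_fourier (trig_poly l c) s) \<le> (\<Sum>n\<in>index_cube l. cmod (c n) * (1 / R))"
    unfolding cube_fourier_trig_poly by (rule sum_norm_le)
  then show ?thesis
    by (simp add: sum_divide_distrib)
qed

text \<open>The Riemann-Lebesgue lemma for the cube: transforms of trigonometric polynomials are finite sums of products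
  of cardinal sines, which decay, and they approximate every transform uniformly.\<close>

lemma cube_fourier_vanishes_at_infinity:
  fixes G :: "real^'d \<Rightarrow> complex"
  assumes G: "G \<in> L2 cube_pi" and "e > 0"
  shows "\<exists>R. \<forall>s. s \<notin> sym_cube R \<longrightarrow> cmod (cube_fourier G s) < e"
proof -
  obtain l c where lc: "\<And>s. cmod (cube_fourier G s - cube_fourier (trig_poly l c) s) < e/2"
    using cube_fourier_uniform_approx [OF G, of "e/2"] \<open>e > 0\<close> by auto
  define R where "R = (\<Sum>n\<in>index_cube l. cmod (c n)) / (e/2) + 1"
  have "R \<ge> 1" unfolding R_def using \<open>e > 0\<close> by (simp add: sum_nonneg)
  have "cmod (cube_fourier G s) < e" if s: "s \<notin> sym_cube (R + real l)" for s
  proof -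
    obtain i where "\<not> (- (R + real l) \<le> s $ i \<and> s $ i \<le> R + real l)"
      using s unfolding sym_cube_def by blast
    then have "\<bar>s $ i\<bar> > R + real l" by linarith
    then have "cmod (cube_fourier (trig_poly l c) s) \<le> (\<Sum>n\<in>index_cube l. cmod (c n)) / R"
      using \<open>R \<ge> 1\<close> by (intro cube_fourier_trig_poly_decay) auto
    also have "\<dots> \<le> e/2"
      using \<open>R \<ge> 1\<close> \<open>e > 0\<close> by (simp add: R_def field_simps)
    finally show ?thesis
      using lc [of s] norm_triangle_ineq2 [of "cube_fourier G s" "cube_fourier (trig_poly l c) s"] by linarith
  qed
  then show ?thesis by blast
qed

text \<open>Multiplying \<open>G\<close> by a character of frequency \<open>s\<close> shifts its transform, so the values of the transform on
  a translated lattice are again Fourier coefficients, and Bessel's inequality applies.\<close>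

lemma sum_cube_fourier_translates_le:
  fixes G :: "real^'d \<Rightarrow> complex"
  assumes G: "G \<in> L2 cube_pi"
  shows "(\<Sum>n\<in>index_cube K. (cmod (cube_fourier G (s + (\<chi> i. real_of_int (n $ i)))))\<^sup>2) \<le> (l2norm cube_pi G)\<^sup>2"
proof -
  \<comment> \<open>The character is chosen so that the lattice Fourier coefficients of \<open>Gs\<close> are the translated samples.\<close>
  define Gs where "Gs x = exp (- (\<i> * of_real (x \<bullet> s))) * G x" for x
  have norm: "cmod (Gs x) = cmod (G x)" for x
    using norm_exp_i_times [of "- (x \<bullet> s)"] by (simp add: Gs_def norm_mult)
  have "continuous_on UNIV (\<lambda>x. exp (- (\<i> * complex_of_real (x \<bullet> s))))"
    by (intro continuous_intros)
  from measurable_cube_continuous [OF this] L2_measurable [OF G]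
  have "Gs \<in> borel_measurable cube_pi"
    unfolding Gs_def by measurable
  then have Gs: "Gs \<in> L2 cube_pi"
    by (rule L2_bound [OF G]) (simp add: norm)
  have "fourier_coeff Gs n = cube_fourier G (s + (\<chi> i. real_of_int (n $ i)))" for n
  proof -
    have "Gs x * cnj (lattice_expo n x) = G x * cnj (expo (s + (\<chi> i. real_of_int (n $ i))) x)" for x
      unfolding Gs_def lattice_expo_def expo_def
      by (simp add: exp_cnj inner_add_right distrib_left exp_add exp_minus mult_ac)
    then show ?thesis
      by (simp add: L2_inner_def cube_fourier_def)
  qed
  moreover have "l2norm cube_pi Gs = l2norm cube_pi G"
    by (simp add: l2norm_def norm)
  ultimately show ?thesis
    using bessel [OF Gs, of K] by simp
qed

lemma integral_lborel_translate:
  fixes u :: "'a::euclidean_space \<Rightarrow> real"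
  assumes [measurable]: "u \<in> borel_measurable borel"
  shows "(LINT x|lborel. u (c + x)) = (LINT x|lborel. u x)"
proof -
  have "(LINT x|lborel. u x) = (LINT x|distr lborel borel ((+) c). u x)"
    by (simp add: lborel_distr_plus)
  also have "\<dots> = (LINT x|lborel. u (c + x))"
    by (rule integral_distr) auto
  finally show ?thesis by simp
qed

lemma integral_cube_lborel:
  fixes u :: "real^'d \<Rightarrow> 'b::{banach,second_countable_topology}"
  assumes u: "continuous_on UNIV u"
  shows "(LINT x|lebesgue_on (sym_cube a). u x) = (LINT x|lborel. indicator (sym_cube a) x *\<^sub>R u x)"
proof -
  have [measurable]: "u \<in> borel_measurable borel"
    using u by (rule borel_measurable_continuous_onI)
  have "(LINT x|lebesgue_on (sym_cube a). u x) = (LINT x|lebesgue. indicator (sym_cube a) x *\<^sub>R u x)"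
    by (rule integral_restrict_space) simp
  also have "\<dots> = (LINT x|lborel. indicator (sym_cube a) x *\<^sub>R u x)"
    by (rule integral_completion) measurable
  finally show ?thesis .
qed

text \<open>The cube is covered by integer translates of the unit cube, and each translate contributes the integral over
  the unit cube of the translated function.\<close>

lemma integral_cube_le_sum_translates:
  fixes u :: "real^'d \<Rightarrow> real"
  assumes u: "continuous_on UNIV u" and nonneg: "\<And>x. 0 \<le> u x"
    and bound: "\<And>s. (\<Sum>n\<in>index_cube K. u (s + (\<chi> i. real_of_int (n $ i)))) \<le> B"
  shows "(LINT x|lebesgue_on (sym_cube (real K)). u x) \<le> B"
proof -
  let ?v = "\<lambda>n::int^'d. \<chi> i. real_of_int (n $ i)"
  let ?Q = "cbox 0 1 :: (real^'d) set"
  have [measurable]: "u \<in> borel_measurable borel"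
    using u by (rule borel_measurable_continuous_onI)
  have intQ: "integrable lborel (\<lambda>s. indicator ?Q s * u (s + c))" for c
  proof -
    have "continuous_on ?Q (\<lambda>s. u (s + c))"
      by (rule continuous_on_compose2 [OF u]) (auto intro: continuous_intros)
    then show ?thesis
      using borel_integrable_compact [OF compact_cbox, of 0 1 "\<lambda>s. u (s + c)"] by simp
  qed
  have intQ': "integrable lborel (\<lambda>x. indicator ?Q (x - c) * u x)" for c
  proof -
    have "integrable (distr lborel borel ((+) c)) (\<lambda>x. indicator ?Q (x - c) * u x)"
      by (subst integrable_distr_eq) (use intQ [of c] in \<open>auto simp: add.commute\<close>)
    then show ?thesis by (simp add: lborel_distr_plus)
  qed
  have Q: "(LINT x|lborel. indicator ?Q (x - c) * u x) = (LINT s|lborel. indicator ?Q s * u (s + c))" for c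
    using integral_lborel_translate [of "\<lambda>x. indicator ?Q (x - c) * u x" c] by (simp add: add.commute)
  have "(LINT x|lebesgue_on (sym_cube (real K)). u x) = (LINT x|lborel. indicator (sym_cube (real K)) x *\<^sub>R u x)"
    by (rule integral_cube_lborel [OF u])
  also have "\<dots> \<le> (LINT x|lborel. (\<Sum>n\<in>index_cube K. indicator ?Q (x - ?v n) * u x))"
  proof (rule integral_mono)
    show "integrable lborel (\<lambda>x. indicator (sym_cube (real K)) x *\<^sub>R u x)"
      using borel_integrable_compact [OF compact_sym_cube continuous_on_subset [OF u]] by auto
    show "integrable lborel (\<lambda>x. \<Sum>n\<in>index_cube K. indicator ?Q (x - ?v n) * u x)"
      by (intro Bochner_Integration.integrable_sum intQ')
    fix x :: "real^'d"
    show "indicator (sym_cube (real K)) x *\<^sub>R u x \<le> (\<Sum>n\<in>index_cube K. indicator ?Q (x - ?v n) * u x)"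
    proof (cases "x \<in> sym_cube (real K)")
      case True
      define n where "n = (\<chi> i. \<lfloor>x $ i\<rfloor>)"
      have "- int K \<le> \<lfloor>x $ i\<rfloor>" "\<lfloor>x $ i\<rfloor> \<le> int K" for i
        using True by (auto simp: sym_cube_def le_floor_iff floor_le_iff intro: order_le_less_trans)
      then have n: "n \<in> index_cube K"
        by (auto simp: index_cube_def n_def)
      have "x - ?v n \<in> ?Q"
        unfolding mem_box_cart n_def by (auto simp: algebra_simps) (smt (verit) real_of_int_floor_add_one_ge)
      then have "indicator (sym_cube (real K)) x *\<^sub>R u x = indicator ?Q (x - ?v n) * u x"
        using True by simp
      also have "\<dots> \<le> (\<Sum>n\<in>index_cube K. indicator ?Q (x - ?v n) * u x)"
        by (rule member_le_sum [OF n]) (auto simp: nonneg)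
      finally show ?thesis .
    qed (auto intro!: sum_nonneg simp: nonneg)
  qed
  also have "\<dots> = (\<Sum>n\<in>index_cube K. LINT s|lborel. indicator ?Q s * u (s + ?v n))"
    by (subst Bochner_Integration.integral_sum [OF intQ']) (simp add: Q)
  also have "\<dots> = (LINT s|lborel. (\<Sum>n\<in>index_cube K. indicator ?Q s * u (s + ?v n)))"
    by (rule Bochner_Integration.integral_sum [OF intQ, symmetric])
  also have "\<dots> \<le> (LINT s|lborel. indicator ?Q s * B)"
  proof (rule integral_mono)
    show "integrable lborel (\<lambda>s. \<Sum>n\<in>index_cube K. indicator ?Q s * u (s + ?v n))"
      by (intro Bochner_Integration.integrable_sum intQ)
    show "integrable lborel (\<lambda>s. indicator ?Q s * B)"
      using borel_integrable_compact [OF compact_cbox, of 0 1 "\<lambda>s. B"] by auto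
    show "(\<Sum>n\<in>index_cube K. indicator ?Q s * u (s + ?v n)) \<le> indicator ?Q s * B" for s
      unfolding sum_distrib_left [symmetric] by (intro mult_left_mono bound) auto
  qed
  also have "\<dots> = B"
  proof -
    have "measure lborel ?Q = 1"
      by (subst content_cbox_cart) (auto simp: interval_ne_empty_cart)
    then show ?thesis by simp
  qed
  finally show ?thesis .
qed

lemma sym_cube_mono:
  assumes "a \<le> b" shows "sym_cube a \<subseteq> sym_cube b"
proof
  fix x :: "real^'d" assume "x \<in> sym_cube a"
  then have "- a \<le> x $ i \<and> x $ i \<le> a" for i by (simp add: sym_cube_def)
  then have "- b \<le> x $ i \<and> x $ i \<le> b" for i using assms by (meson order_trans neg_le_iff_le)
  then show "x \<in> sym_cube b" by (simp add: sym_cube_def)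
qed

text \<open>One half of Plancherel's theorem, obtained from Bessel's inequality by integrating over the translations of
  the lattice by points of the unit cube.\<close>

lemma l2norm_cube_fourier_le:
  fixes G :: "real^'d \<Rightarrow> complex"
  assumes G: "G \<in> L2 cube_pi"
  shows "l2norm (lebesgue_on (sym_cube R)) (cube_fourier G) \<le> l2norm cube_pi G"
proof -
  let ?u = "\<lambda>s. (cmod (cube_fourier G s))\<^sup>2"
  have cont: "continuous_on UNIV ?u"
    by (intro continuous_intros continuous_on_cube_fourier G)
  obtain K where K: "R \<le> real K" using real_arch_simple by blast
  have sub: "sym_cube R \<subseteq> (sym_cube (real K) :: (real^'d) set)"
    by (rule sym_cube_mono [OF K])
  have int: "integrable lborel (\<lambda>x. indicator (sym_cube a) x *\<^sub>R ?u x)" for a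
    using borel_integrable_compact [OF compact_sym_cube continuous_on_subset [OF cont]] by auto
  have "(LINT s|lebesgue_on (sym_cube R). ?u s) \<le> (LINT s|lebesgue_on (sym_cube (real K)). ?u s)"
    unfolding integral_cube_lborel [OF cont]
    by (intro integral_mono int) (use sub in \<open>auto simp: indicator_def\<close>)
  also have "\<dots> \<le> (l2norm cube_pi G)\<^sup>2"
    by (rule integral_cube_le_sum_translates [OF cont])
       (auto intro: sum_cube_fourier_translates_le G)
  finally show ?thesis
    unfolding l2norm_power2 [symmetric] by (rule power2_le_imp_le) simp
qed

section \<open>Paley-Wiener functions as transforms of functions on the cube\<close>

text \<open>The product Gaussian density with centre \<open>s\<close> and standard deviation \<open>\<epsilon>\<close> in each coordinate. By
  \<open>gaussian_fourier\<close> it is the inverse transform of the conjugate of \<open>expo s\<close>, damped by \<open>gauss_damp \<epsilon>\<close>.\<close>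

definition gauss_kernel :: "real \<Rightarrow> real^'d \<Rightarrow> real^'d \<Rightarrow> real" where
  "gauss_kernel \<epsilon> s t = (\<Prod>i\<in>UNIV. normal_density (s $ i) \<epsilon> (t $ i))"

definition gauss_damp :: "real \<Rightarrow> real^'d \<Rightarrow> real" where
  "gauss_damp \<epsilon> x = (\<Prod>i\<in>UNIV. exp (- (\<epsilon> * x $ i)\<^sup>2 / 2))"

lemma continuous_on_gauss_kernel: "\<epsilon> > 0 \<Longrightarrow> continuous_on S (gauss_kernel \<epsilon> s)"
  unfolding gauss_kernel_def normal_density_def by (intro continuous_intros) auto

lemma continuous_on_gauss_damp: "continuous_on S (gauss_damp \<epsilon>)"
  unfolding gauss_damp_def by (intro continuous_intros) auto

lemma gauss_kernel_nonneg: "0 \<le> gauss_kernel \<epsilon> s t"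
  unfolding gauss_kernel_def by (intro prod_nonneg) simp

lemma gauss_damp_nonneg: "0 \<le> gauss_damp \<epsilon> x"
  unfolding gauss_damp_def by (intro prod_nonneg) simp

lemma gauss_damp_le_1: "gauss_damp \<epsilon> x \<le> 1"
  unfolding gauss_damp_def by (intro prod_le_1) auto

lemma integrable_gauss_kernel: "\<epsilon> > 0 \<Longrightarrow> integrable lborel (gauss_kernel \<epsilon> s)"
  unfolding gauss_kernel_def [abs_def] by (intro integrable_lborel_vec_prod integrable_normal_density)

lemma integral_gauss_kernel: "\<epsilon> > 0 \<Longrightarrow> (LINT t|lborel. gauss_kernel \<epsilon> s t) = 1"
  unfolding gauss_kernel_def by (subst integral_lborel_vec_prod) auto

lemma gauss_damp_eq:
  assumes "\<epsilon> > 0"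
  shows "gauss_damp \<epsilon> (x::real^'d) = (sqrt (2 * pi) / \<epsilon>) ^ CARD('d) * gauss_kernel (1/\<epsilon>) 0 x"
proof -
  have e: "exp (- (\<epsilon> * y)\<^sup>2 / 2) = (sqrt (2 * pi) / \<epsilon>) * normal_density 0 (1/\<epsilon>) y" for y
    using assms by (simp add: normal_density_def real_sqrt_mult real_sqrt_divide power_divide power_mult_distrib field_simps)
  then show ?thesis
    by (simp only: gauss_damp_def gauss_kernel_def e prod.distrib prod_constant zero_index)
qed

lemma integrable_gauss_damp:
  assumes "\<epsilon> > 0" shows "integrable lborel (gauss_damp \<epsilon> :: real^'d \<Rightarrow> real)"
proof -
  have "gauss_damp \<epsilon> = (\<lambda>x::real^'d. (sqrt (2 * pi) / \<epsilon>) ^ CARD('d) * gauss_kernel (1/\<epsilon>) 0 x)"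
    using gauss_damp_eq [OF assms] by (intro ext)
  then show ?thesis
    using integrable_gauss_kernel [of "1/\<epsilon>" 0] assms by simp
qed

lemma gauss_kernel_le:
  assumes "\<epsilon> > 0"
  shows "gauss_kernel \<epsilon> s (t::real^'d) \<le> (1 / (sqrt (2 * pi) * \<epsilon>)) ^ CARD('d)"
proof -
  have "normal_density m \<epsilon> y \<le> 1 / (sqrt (2 * pi) * \<epsilon>)" for m y
    using assms by (simp add: normal_density_def real_sqrt_mult divide_simps)
  then have "gauss_kernel \<epsilon> s t \<le> (\<Prod>i\<in>(UNIV::'d set). 1 / (sqrt (2 * pi) * \<epsilon>))"
    unfolding gauss_kernel_def by (intro prod_mono) auto
  then show ?thesis by simp
qed

lemma L2_lebesgue_bounded_integrable:
  fixes k :: "real^'d \<Rightarrow> real"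
  assumes cont: "continuous_on UNIV k" and int: "integrable lborel k" and nonneg: "\<And>x. 0 \<le> k x" and le: "\<And>x. k x \<le> B"
  shows "(\<lambda>x. complex_of_real (k x)) \<in> L2 lebesgue"
proof -
  have [measurable]: "k \<in> borel_measurable borel"
    using cont by (rule borel_measurable_continuous_onI)
  have "integrable lborel (\<lambda>x. (k x)\<^sup>2)"
  proof (rule Bochner_Integration.integrable_bound)
    show "integrable lborel (\<lambda>x. B * k x)" using int by simp
    have "\<bar>k x * k x\<bar> \<le> \<bar>B * k x\<bar>" for x
      unfolding abs_mult using nonneg [of x] le [of x] by (intro mult_right_mono) auto
    then show "AE x in lborel. norm ((k x)\<^sup>2) \<le> norm (B * k x)"
      by (simp add: power2_eq_square)
  qed measurable
  then have "integrable lebesgue (\<lambda>x. (k x)\<^sup>2)"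
    by (subst integrable_completion) auto
  moreover have "(\<lambda>x. complex_of_real (k x)) \<in> borel_measurable lebesgue"
    by (intro measurable_completion) measurable
  ultimately show ?thesis
    by (simp add: L2_def)
qed

lemma gauss_kernel_L2: "\<epsilon> > 0 \<Longrightarrow> (\<lambda>t. complex_of_real (gauss_kernel \<epsilon> s t)) \<in> L2 lebesgue"
  by (rule L2_lebesgue_bounded_integrable [OF continuous_on_gauss_kernel integrable_gauss_kernel
        gauss_kernel_nonneg gauss_kernel_le])

lemma gauss_damp_L2: "\<epsilon> > 0 \<Longrightarrow> (\<lambda>t. complex_of_real (gauss_damp \<epsilon> t)) \<in> L2 lebesgue"
  by (rule L2_lebesgue_bounded_integrable [OF continuous_on_gauss_damp integrable_gauss_damp
        gauss_damp_nonneg gauss_damp_le_1])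

text \<open>The characteristic function of the standard normal distribution, rescaled.\<close>

lemma gaussian_fourier_1d:
  assumes "\<epsilon> > 0"
  shows "(LINT y|lborel. of_real (1 / (2*pi)) * exp (\<i> * of_real ((t - s) * y)) * of_real (exp (- (\<epsilon> * y)\<^sup>2 / 2)))
    = complex_of_real (normal_density s \<epsilon> t)"
proof -
  have char: "(LINT u|lborel. complex_of_real (std_normal_density u) * exp (\<i> * of_real (a * u))) = of_real (exp (- a\<^sup>2 / 2))" for a
  proof -
    have "char std_normal_distribution a = (LINT u|lborel. std_normal_density u *\<^sub>R exp (\<i> * of_real (a * u)))"
      unfolding char_def by (rule integral_density) auto
    then show ?thesis
      unfolding char_std_normal_distribution by (simp add: scaleR_conv_of_real)
  qed
  let ?a = "(t - s) / \<epsilon>"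
  have "(LINT y|lborel. of_real (1 / (2*pi)) * exp (\<i> * of_real ((t - s) * y)) * of_real (exp (- (\<epsilon> * y)\<^sup>2 / 2)))
    = \<bar>1/\<epsilon>\<bar> *\<^sub>R (LINT u|lborel. of_real (1 / (2*pi)) * exp (\<i> * of_real ((t - s) * (0 + 1/\<epsilon> * u))) * of_real (exp (- (\<epsilon> * (0 + 1/\<epsilon> * u))\<^sup>2 / 2)))"
    using assms by (intro lborel_integral_real_affine) auto
  also have "\<dots> = (1/\<epsilon>) *\<^sub>R (LINT u|lborel. of_real (1 / sqrt (2*pi)) * (complex_of_real (std_normal_density u) * exp (\<i> * of_real (?a * u))))"
  proof -
    have "complex_of_real (1 / (2*pi)) * exp (\<i> * of_real ((t - s) * (0 + 1/\<epsilon> * u))) * of_real (exp (- (\<epsilon> * (0 + 1/\<epsilon> * u))\<^sup>2 / 2))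
      = of_real (1 / sqrt (2*pi)) * (complex_of_real (std_normal_density u) * exp (\<i> * of_real (?a * u)))" for u
    proof -
      have c: "1 / (2*pi) = 1 / sqrt (2*pi) * (1 / sqrt (2*pi))"
        by (simp add: real_sqrt_mult_self)
      have e: "(t - s) * (0 + 1/\<epsilon> * u) = ?a * u" "\<epsilon> * (0 + 1/\<epsilon> * u) = u"
        using assms by auto
      show ?thesis
        unfolding c std_normal_density_def e of_real_mult by (simp only: mult_ac)
    qed
    then show ?thesis using assms by simp
  qed
  also have "\<dots> = of_real (1/\<epsilon> * (1 / sqrt (2*pi) * exp (- ?a\<^sup>2 / 2)))"
    unfolding integral_mult_right_zero char by (simp only: scaleR_conv_of_real of_real_mult)
  also have "1/\<epsilon> * (1 / sqrt (2*pi) * exp (- ?a\<^sup>2 / 2)) = normal_density s \<epsilon> t"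
    using assms by (simp add: normal_density_def real_sqrt_mult power_divide mult_ac)
  finally show ?thesis .
qed

lemma gaussian_fourier:
  assumes "\<epsilon> > 0"
  shows "(LINT x|lborel. expo t x * cnj (expo s x) * of_real (gauss_damp \<epsilon> x)) = complex_of_real (gauss_kernel \<epsilon> s t)"
proof -
  have "(LINT x|lborel. expo t x * cnj (expo s x) * of_real (gauss_damp \<epsilon> x)) =
    (LINT x|lborel. (\<Prod>i\<in>UNIV. of_real (1 / (2*pi)) * exp (\<i> * of_real ((t $ i - s $ i) * x $ i)) * of_real (exp (- (\<epsilon> * x $ i)\<^sup>2 / 2))))"
    unfolding expo_mult_cnj gauss_damp_def of_real_prod prod.distrib ..
  also have "\<dots> = (\<Prod>i\<in>UNIV. LINT y|lborel. of_real (1 / (2*pi)) * exp (\<i> * of_real ((t $ i - s $ i) * y)) * of_real (exp (- (\<epsilon> * y)\<^sup>2 / 2)))"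
  proof (rule integral_lborel_vec_prod)
    fix i
    have e: "exp (- (\<epsilon> * y)\<^sup>2 / 2) = (sqrt (2 * pi) / \<epsilon>) * normal_density 0 (1/\<epsilon>) y" for y
      using assms by (simp add: normal_density_def real_sqrt_mult real_sqrt_divide power_divide power_mult_distrib field_simps)
    have int: "integrable lborel (\<lambda>y. exp (- (\<epsilon> * y)\<^sup>2 / 2))"
      unfolding e using assms by simp
    have meas: "(\<lambda>y. of_real (1 / (2*pi)) * exp (\<i> * complex_of_real ((t $ i - s $ i) * y)) * of_real (exp (- (\<epsilon> * y)\<^sup>2 / 2))) \<in> borel_measurable lborel"
      by measurable
    have le: "cmod (of_real (1 / (2*pi)) * exp (\<i> * complex_of_real ((t $ i - s $ i) * y)) * of_real (exp (- (\<epsilon> * y)\<^sup>2 / 2))) \<le> exp (- (\<epsilon> * y)\<^sup>2 / 2)" for y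
    proof -
      have "1 / (2 * pi) * exp (- (\<epsilon> * y)\<^sup>2 / 2) \<le> 1 * exp (- (\<epsilon> * y)\<^sup>2 / 2)"
        using pi_gt3 by (intro mult_right_mono) auto
      then show ?thesis
        unfolding norm_mult norm_exp_i_times norm_of_real by simp
    qed
    show "integrable lborel (\<lambda>y. of_real (1 / (2*pi)) * exp (\<i> * complex_of_real ((t $ i - s $ i) * y)) * of_real (exp (- (\<epsilon> * y)\<^sup>2 / 2)))"
      by (rule Bochner_Integration.integrable_bound [OF int meas], rule AE_I2) (use le in simp)
  qed
  also have "\<dots> = (\<Prod>i\<in>UNIV. complex_of_real (normal_density (s $ i) \<epsilon> (t $ i)))"
    by (simp only: gaussian_fourier_1d [OF assms])
  finally show ?thesis
    by (simp add: gauss_kernel_def)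
qed

text \<open>Fubini's theorem moves the Fourier transform from the truncated function to the damped exponential, where
  it is the Gaussian kernel. The truncation and the damping make the double integral absolutely convergent.\<close>

lemma truncated_transform_gaussian:
  fixes f :: "real^'d \<Rightarrow> complex"
  assumes f: "continuous_on UNIV f" and "\<epsilon> > 0"
  shows "(LINT x|lebesgue. (LINT t|lebesgue_on (sym_cube R). f t * expo t x) * cnj (expo s x * of_real (gauss_damp \<epsilon> x)))
    = (LINT t|lborel. indicator (sym_cube R) t *\<^sub>R (f t * of_real (gauss_kernel \<epsilon> s t)))"
proof -
  let ?H = "\<lambda>x. cnj (expo s x) * of_real (gauss_damp \<epsilon> x)"
  let ?u = "\<lambda>t. indicator (sym_cube R) t *\<^sub>R f t"
  let ?F = "\<lambda>t x. ?u t * (expo t x * ?H x)"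
  have [measurable]: "f \<in> borel_measurable borel"
    using f by (rule borel_measurable_continuous_onI)
  have [measurable]: "gauss_damp \<epsilon> \<in> borel_measurable (borel :: (real^'d) measure)"
    by (intro borel_measurable_continuous_onI continuous_on_gauss_damp)
  have [measurable]: "expo s \<in> borel_measurable borel"
    by (intro borel_measurable_continuous_onI continuous_on_expo)
  have "continuous_on UNIV (\<lambda>p::(real^'d) \<times> (real^'d). expo (fst p) (snd p))"
    unfolding expo_def by (intro continuous_intros)
  then have e: "(\<lambda>p::(real^'d) \<times> (real^'d). expo (fst p) (snd p)) \<in> borel_measurable (borel \<Otimes>\<^sub>M borel)"
    unfolding borel_prod by (rule borel_measurable_continuous_onI)
  have [measurable]: "(\<lambda>p. expo (f1 p) (f2 p)) \<in> borel_measurable M"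
    if "f1 \<in> M \<rightarrow>\<^sub>M borel" "f2 \<in> M \<rightarrow>\<^sub>M borel" for M and f1 f2 :: "'b \<Rightarrow> real^'d"
    using measurable_compose [OF measurable_Pair [OF that] e] by simp
  define c where "c = (1 / (2 * pi) powr (real CARD('d) / 2))"
  have normF: "norm (?F t x) = norm (?u t) * (c * c * gauss_damp \<epsilon> x)" for t x
    by (simp add: norm_mult norm_expo c_def gauss_damp_nonneg)
  have intu: "integrable lborel ?u"
    using borel_integrable_compact [OF compact_sym_cube continuous_on_subset [OF f]] by auto
  have intF: "integrable (lborel \<Otimes>\<^sub>M lborel) (\<lambda>(t, x). ?F t x)"
  proof (rule lborel_pair.Fubini_integrable)
    show "(\<lambda>(t, x). ?F t x) \<in> borel_measurable (lborel \<Otimes>\<^sub>M lborel)"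
      by measurable
    show "integrable lborel (\<lambda>t. LINT x|lborel. norm (case (t, x) of (t, x) \<Rightarrow> ?F t x))"
      unfolding prod.case normF integral_mult_right_zero by (intro integrable_mult_left integrable_norm intu)
    show "AE t in lborel. integrable lborel (\<lambda>x. case (t, x) of (t, x) \<Rightarrow> ?F t x)"
    proof (rule AE_I2)
      fix t :: "real^'d"
      show "integrable lborel (\<lambda>x. case (t, x) of (t, x) \<Rightarrow> ?F t x)"
      proof (rule Bochner_Integration.integrable_bound)
        show "integrable lborel (\<lambda>x::real^'d. norm (?u t) * (c * c * gauss_damp \<epsilon> x))"
          by (intro integrable_mult_right integrable_gauss_damp \<open>\<epsilon> > 0\<close>)
        show "AE x in lborel. norm (case (t, x) of (t, x) \<Rightarrow> ?F t x) \<le> norm (norm (?u t) * (c * c * gauss_damp \<epsilon> x))"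
          unfolding prod.case normF by simp
        show "(\<lambda>x. case (t, x) of (t, x) \<Rightarrow> ?F t x) \<in> borel_measurable lborel"
          unfolding prod.case measurable_lborel2
          by (intro borel_measurable_continuous_onI continuous_intros continuous_on_gauss_damp)
      qed
    qed
  qed
  have phi: "(LINT t|lebesgue_on (sym_cube R). f t * expo t x) = (LINT t|lborel. ?u t * expo t x)" for x
    by (subst integral_cube_lborel)
       (auto intro!: continuous_intros f continuous_on_expo simp: expo_commute [of _ x])
  have "(LINT x|lebesgue. (LINT t|lebesgue_on (sym_cube R). f t * expo t x) * cnj (expo s x * of_real (gauss_damp \<epsilon> x)))
      = (LINT x|lebesgue. (LINT t|lborel. ?F t x))"
    unfolding phi integral_mult_left_zero [symmetric] by (simp add: mult.assoc)
  also have "\<dots> = (LINT x|lborel. (LINT t|lborel. ?F t x))"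
    by (rule integral_completion) measurable
  also have "\<dots> = (LINT t|lborel. (LINT x|lborel. ?F t x))"
    by (rule lborel_pair.Fubini_integral [OF intF])
  also have "\<dots> = (LINT t|lborel. ?u t * of_real (gauss_kernel \<epsilon> s t))"
    by (simp only: integral_mult_right_zero mult.assoc [symmetric] gaussian_fourier [OF \<open>\<epsilon> > 0\<close>] )
       (simp add: mult.assoc gaussian_fourier [OF \<open>\<epsilon> > 0\<close>, unfolded mult.assoc])
  finally show ?thesis by simp
qed

lemma l2norm_less_of_L2_norm_less:
  assumes "L2_norm M f < ereal e"
  shows "f \<in> L2 M" "l2norm M f < e"
  using assms by (auto simp: L2_norm_def l2norm_def split: if_splits)

lemma L2_inner_truncated_tendsto:
  assumes lim: "((\<lambda>R. L2_norm M (\<lambda>x. g x - \<phi> R x)) \<longlongrightarrow> 0) F"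
    and g: "g \<in> L2 M" and H: "H \<in> L2 M"
  shows "((\<lambda>R. L2_inner M (\<phi> R) H) \<longlongrightarrow> L2_inner M g H) F"
proof (rule tendstoI)
  fix e :: real assume "e > 0"
  define e' where "e' = e / (l2norm M H + 1)"
  have "e' > 0"
    using \<open>e > 0\<close> by (simp add: e'_def add_nonneg_pos)
  then have "\<forall>\<^sub>F R in F. L2_norm M (\<lambda>x. g x - \<phi> R x) < ereal e'"
    using order_tendstoD(2) [OF lim, of "ereal e'"] by simp
  then show "\<forall>\<^sub>F R in F. dist (L2_inner M (\<phi> R) H) (L2_inner M g H) < e"
  proof eventually_elim
    case (elim R)
    note d = l2norm_less_of_L2_norm_less [OF elim]
    have phi: "\<phi> R \<in> L2 M"
      using L2_diff [OF g d(1)] by simp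
    have "dist (L2_inner M (\<phi> R) H) (L2_inner M g H) = cmod (L2_inner M (\<lambda>x. g x - \<phi> R x) H)"
      by (simp add: dist_norm norm_minus_commute L2_inner_diff_left g phi H)
    also have "\<dots> \<le> l2norm M (\<lambda>x. g x - \<phi> R x) * l2norm M H"
      by (rule L2_inner_Cauchy_Schwarz [OF d(1) H])
    also have "\<dots> \<le> e' * l2norm M H"
      using d(2) by (intro mult_right_mono) auto
    also have "\<dots> < e' * (l2norm M H + 1)"
      using \<open>e' > 0\<close> by simp
    also have "\<dots> = e"
    proof -
      have "l2norm M H + 1 \<noteq> 0" using l2norm_nonneg [of M H] by linarith
      then show ?thesis by (simp add: e'_def)
    qed
    finally show ?case .
  qed
qed

lemma expo_gauss_damp_L2:
  assumes "\<epsilon> > 0"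
  shows "(\<lambda>x. expo s x * of_real (gauss_damp \<epsilon> x)) \<in> L2 lebesgue"
proof -
  define c where "c = 1 / (2 * pi) powr (real CARD('a) / 2)"
  have "continuous_on UNIV (\<lambda>x. expo s x * complex_of_real (gauss_damp \<epsilon> x))"
    by (intro continuous_intros continuous_on_gauss_damp)
  then have "(\<lambda>x. expo s x * of_real (gauss_damp \<epsilon> x)) \<in> borel_measurable lebesgue"
    by (intro measurable_completion) (simp add: borel_measurable_continuous_onI)
  then show ?thesis
    by (rule L2_bound [OF L2_cmult [OF gauss_damp_L2 [OF assms], of "of_real c"]])
       (simp only: norm_mult norm_expo c_def norm_of_real, simp)
qed

text \<open>Both sides are limits of the same quantities as the truncation radius grows: the left-hand side by dominated
  convergence, the right-hand side because the truncated transforms converge to \<open>g\<close> in \<open>L\<^sub>2\<close>.\<close>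

lemma gaussian_mean_eq:
  fixes f :: "real^'d \<Rightarrow> complex"
  assumes cont: "continuous_on UNIV f" and f: "f \<in> L2 lebesgue" and g: "is_inv_fourier f g" and "\<epsilon> > 0"
  shows "(LINT t|lborel. f t * of_real (gauss_kernel \<epsilon> s t))
    = L2_inner lebesgue g (\<lambda>x. expo s x * of_real (gauss_damp \<epsilon> x))"
proof -
  let ?H = "\<lambda>x. expo s x * of_real (gauss_damp \<epsilon> x)"
  let ?fK = "\<lambda>t. f t * of_real (gauss_kernel \<epsilon> s t)"
  have meas [measurable]: "?fK \<in> borel_measurable borel"
    by (intro borel_measurable_continuous_onI continuous_intros cont continuous_on_gauss_kernel \<open>\<epsilon> > 0\<close>)
  have int: "integrable lborel ?fK"
    using L2_integrable_inner [OF f gauss_kernel_L2 [OF \<open>\<epsilon> > 0\<close>, of s]]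
    by (simp add: integrable_completion meas)
  have "((\<lambda>R. L2_inner lebesgue (\<lambda>x. LINT t|lebesgue_on (sym_cube R). f t * expo t x) ?H) \<longlongrightarrow> L2_inner lebesgue g ?H) at_top"
    using g expo_gauss_damp_L2 [OF \<open>\<epsilon> > 0\<close>, of s]
    unfolding is_inv_fourier_def by (intro L2_inner_truncated_tendsto) auto
  then have "((\<lambda>R. LINT t|lborel. indicator (sym_cube R) t *\<^sub>R ?fK t) \<longlongrightarrow> L2_inner lebesgue g ?H) at_top"
    unfolding L2_inner_def truncated_transform_gaussian [OF cont \<open>\<epsilon> > 0\<close>] .
  moreover have "((\<lambda>R. LINT t|lborel. indicator (sym_cube R) t *\<^sub>R ?fK t) \<longlongrightarrow> (LINT t|lborel. ?fK t)) at_top"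
  proof (rule integral_dominated_convergence_at_top)
    show "integrable lborel (\<lambda>t. norm (?fK t))"
      using int by (rule integrable_norm)
    show "AE t in lborel. ((\<lambda>R. indicator (sym_cube R) t *\<^sub>R ?fK t) \<longlongrightarrow> ?fK t) at_top"
    proof (rule AE_I2)
      fix t :: "real^'d"
      have "\<forall>\<^sub>F R in at_top. t \<in> sym_cube R"
        using eventually_ge_at_top [of "norm t"]
      proof eventually_elim
        case (elim R)
        have "- R \<le> t $ i \<and> t $ i \<le> R" for i
          using component_le_norm_cart [of t i] elim by linarith
        then show ?case by (simp add: sym_cube_def)
      qed
      then have "\<forall>\<^sub>F R in at_top. indicator (sym_cube R) t *\<^sub>R ?fK t = ?fK t"
        by eventually_elim simp
      then show "((\<lambda>R. indicator (sym_cube R) t *\<^sub>R ?fK t) \<longlongrightarrow> ?fK t) at_top"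
        by (rule tendsto_eventually)
    qed
    show "\<forall>\<^sub>F R in at_top. AE t in lborel. norm (indicator (sym_cube R) t *\<^sub>R ?fK t) \<le> norm (?fK t)"
      by (auto intro!: always_eventually AE_I2 simp: indicator_def)
  qed auto
  ultimately show ?thesis
    using tendsto_unique [OF trivial_limit_at_top_linorder] by blast
qed

text \<open>Half of the exponent is spent on the small factor. With the other half the
  kernel is, for \<open>\<epsilon> \<le> 1\<close>, below a multiple of one fixed Gaussian of variance \<open>2\<close>, against which
  square-integrable functions can be integrated.\<close>

lemma gauss_kernel_off_centre:
  fixes s t :: "real^'d"
  assumes "0 < \<epsilon>" "\<epsilon> \<le> 1" "\<delta> > 0" "\<delta> \<le> norm (t - s)"
  shows "gauss_kernel \<epsilon> s t \<le> (sqrt 2 / \<epsilon>) ^ CARD('d) * exp (- \<delta>\<^sup>2 / (4 * \<epsilon>\<^sup>2)) * gauss_kernel (sqrt 2) s t"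
proof -
  have q: "sqrt 2 * (sqrt 2 * z) = 2 * z" for z :: real
    by (simp flip: mult.assoc)
  have one: "normal_density m \<epsilon> y \<le> sqrt 2 / \<epsilon> * exp (- (y - m)\<^sup>2 / (4 * \<epsilon>\<^sup>2)) * normal_density m (sqrt 2) y" for m y :: real
  proof -
    have "(y - m)\<^sup>2 * \<epsilon>\<^sup>2 \<le> (y - m)\<^sup>2 * 1"
      using assms by (intro mult_left_mono) (auto simp: power_le_one)
    then have "(y - m)\<^sup>2 / 4 \<le> (y - m)\<^sup>2 / (4 * \<epsilon>\<^sup>2)"
      using assms by (simp add: field_simps)
    moreover have "(y - m)\<^sup>2 / (2 * \<epsilon>\<^sup>2) = (y - m)\<^sup>2 / (4 * \<epsilon>\<^sup>2) + (y - m)\<^sup>2 / (4 * \<epsilon>\<^sup>2)"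
      using assms by (simp add: field_simps)
    ultimately have "- ((y - m)\<^sup>2 / (2 * \<epsilon>\<^sup>2)) \<le> - ((y - m)\<^sup>2 / (4 * \<epsilon>\<^sup>2)) + - ((y - m)\<^sup>2 / 4)"
      by linarith
    then have "exp (- ((y - m)\<^sup>2 / (2 * \<epsilon>\<^sup>2))) \<le> exp (- ((y - m)\<^sup>2 / (4 * \<epsilon>\<^sup>2))) * exp (- ((y - m)\<^sup>2 / 4))"
      unfolding exp_add [symmetric] by simp
    then have "1 / (sqrt (2 * pi) * \<epsilon>) * exp (- ((y - m)\<^sup>2 / (2 * \<epsilon>\<^sup>2)))
       \<le> 1 / (sqrt (2 * pi) * \<epsilon>) * (exp (- ((y - m)\<^sup>2 / (4 * \<epsilon>\<^sup>2))) * exp (- ((y - m)\<^sup>2 / 4)))"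
      using assms by (intro mult_left_mono) auto
    then show ?thesis
      using assms by (simp add: normal_density_def real_sqrt_mult field_simps) (simp only: q)
  qed
  have "gauss_kernel \<epsilon> s t \<le> (\<Prod>i\<in>UNIV. sqrt 2 / \<epsilon> * exp (- (t $ i - s $ i)\<^sup>2 / (4 * \<epsilon>\<^sup>2)) * normal_density (s $ i) (sqrt 2) (t $ i))"
    unfolding gauss_kernel_def by (intro prod_mono conjI one) simp
  also have "\<dots> = (sqrt 2 / \<epsilon>) ^ CARD('d) * exp (\<Sum>i\<in>UNIV. - (t $ i - s $ i)\<^sup>2 / (4 * \<epsilon>\<^sup>2)) * gauss_kernel (sqrt 2) s t"
    unfolding gauss_kernel_def prod.distrib prod_constant exp_sum [OF finite] ..
  also have "(\<Sum>i\<in>UNIV. - (t $ i - s $ i)\<^sup>2 / (4 * \<epsilon>\<^sup>2)) = - ((norm (t - s))\<^sup>2) / (4 * \<epsilon>\<^sup>2)"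
    by (simp add: norm_vec_def L2_set_def sum_nonneg sum_negf flip: sum_divide_distrib)
  also have "(sqrt 2 / \<epsilon>) ^ CARD('d) * exp (- ((norm (t - s))\<^sup>2) / (4 * \<epsilon>\<^sup>2)) * gauss_kernel (sqrt 2) s t
     \<le> (sqrt 2 / \<epsilon>) ^ CARD('d) * exp (- \<delta>\<^sup>2 / (4 * \<epsilon>\<^sup>2)) * gauss_kernel (sqrt 2) s t"
    using assms by (intro mult_right_mono mult_left_mono gauss_kernel_nonneg)
       (auto intro!: divide_right_mono power_mono)
  finally show ?thesis .
qed

lemma gaussian_tail_factor_tendsto_0:
  assumes "\<delta> > 0"
  shows "(\<lambda>m. (sqrt 2 / (1 / real (Suc m))) ^ d * exp (- \<delta>\<^sup>2 / (4 * (1 / real (Suc m))\<^sup>2))) \<longlonglongrightarrow> 0"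
proof -
  \<comment> \<open>With \<open>- X m\<close> the argument of the exponential, the prefactor is at most a constant times \<open>X m ^ d\<close>.\<close>
  define X where "X m = \<delta>\<^sup>2 / 4 * (real (Suc m))\<^sup>2" for m
  define C where "C = 4 * sqrt 2 / \<delta>\<^sup>2"
  have "filterlim X at_top sequentially"
    unfolding X_def using assms by real_asymp
  then have "(\<lambda>m. C ^ d * (X m ^ d / exp (X m))) \<longlonglongrightarrow> C ^ d * 0"
    by (intro tendsto_mult_left filterlim_compose [OF tendsto_power_div_exp_0])
  then have lim: "(\<lambda>m. C ^ d * (X m ^ d / exp (X m))) \<longlonglongrightarrow> 0" by simp
  show ?thesis
  proof (rule tendsto_sandwich [OF _ _ tendsto_const lim])
    show "\<forall>\<^sub>F m in sequentially. (sqrt 2 / (1 / real (Suc m))) ^ d * exp (- \<delta>\<^sup>2 / (4 * (1 / real (Suc m))\<^sup>2))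
        \<le> C ^ d * (X m ^ d / exp (X m))"
    proof (intro always_eventually allI)
      fix m
      define n where "n = real (Suc m)"
      have n: "1 \<le> n" by (simp add: n_def)
      have CX: "C * X m = sqrt 2 * n\<^sup>2"
        unfolding C_def X_def n_def [symmetric] using assms by simp
      have "n * 1 \<le> n * n" using n by (intro mult_left_mono) auto
      then have "(sqrt 2 * n) ^ d \<le> (C * X m) ^ d"
        using n unfolding CX by (intro power_mono) (auto simp: power2_eq_square)
      then have "(sqrt 2 * n) ^ d * exp (- X m) \<le> (C * X m) ^ d * exp (- X m)"
        by (rule mult_right_mono) simp
      moreover have "(C * X m) ^ d * exp (- X m) = C ^ d * (X m ^ d / exp (X m))"
        by (simp add: power_mult_distrib exp_minus divide_inverse)
      moreover have "- \<delta>\<^sup>2 / (4 * (1 / n)\<^sup>2) = - X m"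
        unfolding X_def n_def [symmetric] by (simp add: power_divide)
      ultimately show "(sqrt 2 / (1 / real (Suc m))) ^ d * exp (- \<delta>\<^sup>2 / (4 * (1 / real (Suc m))\<^sup>2))
        \<le> C ^ d * (X m ^ d / exp (X m))"
        unfolding n_def [symmetric] by (simp only: divide_divide_eq_right div_by_1)
    qed
  qed (auto intro!: always_eventually)
qed

text \<open>The Gaussian kernels are an approximate identity. As \<open>f\<close> is merely square integrable, the part away from
  the centre is estimated by integrability against one fixed Gaussian rather than by boundedness of \<open>f\<close>.\<close>

lemma gaussian_mean_tendsto:
  fixes f :: "real^'d \<Rightarrow> complex"
  assumes cont: "continuous_on UNIV f" and f: "f \<in> L2 lebesgue"
  shows "(\<lambda>m. LINT t|lborel. f t * of_real (gauss_kernel (1 / real (Suc m)) s t)) \<longlonglongrightarrow> f s"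
proof (rule LIMSEQ_I)
  fix r :: real assume "r > 0"
  let ?K = "\<lambda>m t. gauss_kernel (1 / real (Suc m)) s t"
  let ?W = "gauss_kernel (sqrt 2) s :: real^'d \<Rightarrow> real"
  obtain \<delta> where \<delta>: "\<delta> > 0" "\<And>t. norm (t - s) < \<delta> \<Longrightarrow> cmod (f t - f s) < r/2"
    using cont \<open>r > 0\<close> unfolding continuous_on_iff dist_norm by (metis UNIV_I half_gt_zero)
  have int: "integrable lborel (\<lambda>t. f t * of_real (gauss_kernel \<epsilon> s t))" if "\<epsilon> > 0" for \<epsilon>
  proof -
    have "(\<lambda>t. f t * complex_of_real (gauss_kernel \<epsilon> s t)) \<in> borel_measurable borel"
      by (intro borel_measurable_continuous_onI continuous_intros cont continuous_on_gauss_kernel that)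
    then show ?thesis
      using L2_integrable_inner [OF f gauss_kernel_L2 [OF that, of s]] by (simp add: integrable_completion)
  qed
  have intd: "integrable lborel (\<lambda>t. (f t - f s) * of_real (gauss_kernel \<epsilon> s t))" if "\<epsilon> > 0" for \<epsilon>
    using int [OF that] integrable_gauss_kernel [OF that, of s] by (simp add: left_diff_distrib)
  have intn: "integrable lborel (\<lambda>t. cmod (f t - f s) * gauss_kernel \<epsilon> s t)" if "\<epsilon> > 0" for \<epsilon>
    using integrable_norm [OF intd [OF that]] by (simp add: norm_mult gauss_kernel_nonneg)
  define W where "W = (LINT t|lborel. cmod (f t - f s) * ?W t)"
  define C where "C m = (sqrt 2 / (1 / real (Suc m))) ^ CARD('d) * exp (- \<delta>\<^sup>2 / (4 * (1 / real (Suc m))\<^sup>2))" for m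
  have est: "cmod ((LINT t|lborel. f t * of_real (?K m t)) - f s) \<le> r/2 + C m * W" for m
  proof -
    have pos: "1 / real (Suc m) > 0" by simp
    have "(LINT t|lborel. (f t - f s) * of_real (?K m t)) = (LINT t|lborel. f t * of_real (?K m t)) - f s * (LINT t|lborel. of_real (?K m t))"
      using int [OF pos] integrable_gauss_kernel [OF pos, of s] by (simp add: left_diff_distrib)
    also have "(LINT t|lborel. complex_of_real (?K m t)) = 1"
      using integral_gauss_kernel [OF pos, of s] by simp
    finally have "cmod ((LINT t|lborel. f t * of_real (?K m t)) - f s) = cmod (LINT t|lborel. (f t - f s) * of_real (?K m t))"
      by simp
    also have "\<dots> \<le> (LINT t|lborel. cmod ((f t - f s) * of_real (?K m t)))"
      by (rule integral_norm_bound)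
    also have "\<dots> = (LINT t|lborel. cmod (f t - f s) * ?K m t)"
      by (simp add: norm_mult gauss_kernel_nonneg)
    also have "\<dots> \<le> (LINT t|lborel. r/2 * ?K m t + C m * (cmod (f t - f s) * ?W t))"
    proof (rule integral_mono [OF intn [OF pos]])
      show "integrable lborel (\<lambda>t. r/2 * ?K m t + C m * (cmod (f t - f s) * ?W t))"
        by (intro Bochner_Integration.integrable_add integrable_mult_right integrable_gauss_kernel pos intn) auto
      fix t
      have "0 \<le> C m * (cmod (f t - f s) * ?W t)" "0 \<le> r/2 * ?K m t"
        using \<open>r > 0\<close> by (auto simp: C_def gauss_kernel_nonneg)
      moreover have "cmod (f t - f s) * ?K m t \<le> r/2 * ?K m t" if "norm (t - s) < \<delta>"
        using \<delta>(2) [OF that] by (intro mult_right_mono gauss_kernel_nonneg) auto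
      moreover have "cmod (f t - f s) * ?K m t \<le> cmod (f t - f s) * (C m * ?W t)" if "\<not> norm (t - s) < \<delta>"
        unfolding C_def using \<delta>(1) that
        by (intro mult_left_mono gauss_kernel_off_centre) auto
      ultimately show "cmod (f t - f s) * ?K m t \<le> r/2 * ?K m t + C m * (cmod (f t - f s) * ?W t)"
        by (cases "norm (t - s) < \<delta>") (auto simp: mult_ac)
    qed
    also have "\<dots> = r/2 + C m * W"
    proof -
      have i1: "integrable lborel (\<lambda>t. r/2 * ?K m t)"
        by (intro integrable_mult_right integrable_gauss_kernel pos)
      have i2: "integrable lborel (\<lambda>t. C m * (cmod (f t - f s) * ?W t))"
        by (intro integrable_mult_right intn) simp
      show ?thesis
        unfolding Bochner_Integration.integral_add [OF i1 i2] integral_mult_right_zero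
          integral_gauss_kernel [OF pos] W_def by simp
    qed
    finally show ?thesis .
  qed
  have "(\<lambda>m. r/2 + C m * W) \<longlonglongrightarrow> r/2 + 0 * W"
    unfolding C_def by (intro tendsto_intros gaussian_tail_factor_tendsto_0 \<delta>(1))
  from order_tendstoD(2) [OF this, of r] have "\<forall>\<^sub>F m in sequentially. r/2 + C m * W < r"
    using \<open>r > 0\<close> by simp
  then have "\<forall>\<^sub>F m in sequentially. cmod ((LINT t|lborel. f t * of_real (?K m t)) - f s) < r"
    by eventually_elim (use est in \<open>auto intro: le_less_trans\<close>)
  then show "\<exists>no. \<forall>m\<ge>no. cmod ((LINT t|lborel. f t * of_real (?K m t)) - f s) < r"
    by (simp add: eventually_sequentially)
qed

text \<open>Fourier inversion for the Paley-Wiener space. The Gaussian means of \<open>f\<close> tend to \<open>f s\<close> by continuity, and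
  they equal damped transforms of \<open>g\<close>, which tend to the transform because \<open>g\<close> lives on the bounded cube.\<close>

lemma PW_cube_fourier:
  fixes f :: "real^'d \<Rightarrow> complex"
  assumes "f \<in> PW (sym_cube pi)"
  obtains G where "G \<in> L2 cube_pi" "\<And>s. f s = cube_fourier G s"
proof -
  let ?S = "sym_cube pi :: (real^'d) set"
  obtain g where cont: "continuous_on UNIV f" and f: "f \<in> L2 lebesgue" and inv: "is_inv_fourier f g"
    and supp: "AE x in lebesgue. x \<notin> ?S \<longrightarrow> g x = 0"
    using assms by (auto simp: PW_def)
  have g: "g \<in> L2 lebesgue" using inv by (simp add: is_inv_fourier_def)
  have gS: "g \<in> L2 cube_pi"
    using g integrable_mult_indicator [OF sets_sym_cube [of pi] L2_integrable_square [OF g]]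
    by (simp add: L2_def measurable_restrict_space1 integrable_restrict_space)
  have inner: "L2_inner lebesgue g H = L2_inner cube_pi g H" if "H \<in> borel_measurable lebesgue" for H
  proof -
    note [measurable] = L2_measurable [OF g] that
    have "L2_inner lebesgue g H = (LINT x|lebesgue. indicator ?S x *\<^sub>R (g x * cnj (H x)))"
      unfolding L2_inner_def
    proof (rule integral_cong_AE)
      show "AE x in lebesgue. g x * cnj (H x) = indicator ?S x *\<^sub>R (g x * cnj (H x))"
        using supp by eventually_elim (auto simp: indicator_def)
    qed measurable
    also have "\<dots> = L2_inner cube_pi g H"
      unfolding L2_inner_def by (rule integral_restrict_space [symmetric]) simp
    finally show ?thesis .
  qed
  have "f s = cube_fourier g s" for s
  proof (rule LIMSEQ_unique [OF gaussian_mean_tendsto [OF cont f]])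
    let ?H = "\<lambda>m x. expo s x * complex_of_real (gauss_damp (1 / real (Suc m)) x)"
    have "(LINT t|lborel. f t * of_real (gauss_kernel (1 / real (Suc m)) s t)) = L2_inner cube_pi g (?H m)" for m
      using gaussian_mean_eq [OF cont f inv, of "1 / real (Suc m)" s]
        inner [OF L2_measurable [OF expo_gauss_damp_L2 [of "1 / real (Suc m)" s]]] by simp
    moreover have "(\<lambda>m. L2_inner cube_pi g (?H m)) \<longlonglongrightarrow> cube_fourier g s"
      unfolding L2_inner_def cube_fourier_def
    proof (rule integral_dominated_convergence)
      show "integrable cube_pi (\<lambda>x. cmod (g x * cnj (expo s x)))"
        by (intro integrable_norm L2_integrable_inner gS expo_L2)
      show "(\<lambda>x. g x * cnj (expo s x)) \<in> borel_measurable cube_pi"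
        using L2_measurable [OF gS] L2_measurable [OF expo_L2 [of s]] by measurable
      fix m
      have "?H m \<in> borel_measurable cube_pi"
        by (intro measurable_cube_continuous continuous_intros continuous_on_gauss_damp)
      then show "(\<lambda>x. g x * cnj (?H m x)) \<in> borel_measurable cube_pi"
        using L2_measurable [OF gS] by measurable
      have "cmod (g x * cnj (?H m x)) \<le> cmod (g x * cnj (expo s x)) * 1" for x
      proof -
        have "cmod (g x * cnj (?H m x)) = cmod (g x * cnj (expo s x)) * gauss_damp (1 / real (Suc m)) x"
          by (simp add: norm_mult gauss_damp_nonneg)
        then show ?thesis
          by (simp only:) (intro mult_left_mono gauss_damp_le_1 norm_ge_zero)
      qed
      then show "AE x in cube_pi. cmod (g x * cnj (?H m x)) \<le> cmod (g x * cnj (expo s x))"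
        by simp
    next
      show "AE x in cube_pi. (\<lambda>m. g x * cnj (?H m x)) \<longlonglongrightarrow> g x * cnj (expo s x)"
      proof (rule AE_I2)
        fix x :: "real^'d"
        have "(\<lambda>m. 1 / real (Suc m)) \<longlonglongrightarrow> 0"
          by real_asymp
        then have "(\<lambda>m. gauss_damp (1 / real (Suc m)) x) \<longlonglongrightarrow> (\<Prod>i\<in>UNIV. exp (- (0 * x $ i)\<^sup>2 / 2))"
          unfolding gauss_damp_def by (intro tendsto_intros) auto
        then have "(\<lambda>m. gauss_damp (1 / real (Suc m)) x) \<longlonglongrightarrow> 1" by simp
        then have "(\<lambda>m. g x * cnj (?H m x)) \<longlonglongrightarrow> g x * cnj (expo s x * of_real 1)"
          by (intro tendsto_intros)
        then show "(\<lambda>m. g x * cnj (?H m x)) \<longlonglongrightarrow> g x * cnj (expo s x)" by simp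
      qed
    qed
    ultimately show "(\<lambda>m. LINT t|lborel. f t * of_real (gauss_kernel (1 / real (Suc m)) s t)) \<longlonglongrightarrow> cube_fourier g s"
      by simp
  qed
  then show thesis using that gS by blast
qed

section \<open>Finite sections and the values at the nodes\<close>

lemma bounded_operator_l2norm:
  assumes "bounded_operator M L"
  obtains C where "C \<ge> 0" "\<And>g. g \<in> L2 M \<Longrightarrow> l2norm M (L g) \<le> C * l2norm M g"
proof -
  obtain C :: real where C: "\<forall>g\<in>L2 M. L2_norm M (L g) \<le> ereal C * L2_norm M g"
    and L: "\<forall>g\<in>L2 M. L g \<in> L2 M"
    using assms by (auto simp: bounded_operator_def)
  have "l2norm M (L g) \<le> \<bar>C\<bar> * l2norm M g" if "g \<in> L2 M" for g
  proof -
    have "l2norm M (L g) \<le> C * l2norm M g"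
      using C L that by (auto simp: L2_norm_eq_l2norm)
    also have "\<dots> \<le> \<bar>C\<bar> * l2norm M g"
      by (intro mult_right_mono) auto
    finally show ?thesis .
  qed
  then show thesis by (intro that [of "\<bar>C\<bar>"]) auto
qed

lemma bounded_operator_sum:
  assumes L: "bounded_operator M L" and "finite I" and "\<And>i. i \<in> I \<Longrightarrow> f i \<in> L2 M" and "g \<in> L2 M"
  shows "AE x in M. L (\<lambda>y. \<Sum>i\<in>I. c i * f i y) x = (\<Sum>i\<in>I. c i * L (f i) x)"
  using assms(2,3)
proof (induction I rule: finite_induct)
  case empty
  have "AE x in M. L (\<lambda>y. 0 * g y) x = 0 * L g x"
    using L \<open>g \<in> L2 M\<close> unfolding bounded_operator_def by blast
  then show ?case by simp
next
  case (insert i I)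
  have "AE x in M. L (\<lambda>y. c i * f i y + (\<Sum>i\<in>I. c i * f i y)) x
      = L (\<lambda>y. c i * f i y) x + L (\<lambda>y. \<Sum>i\<in>I. c i * f i y) x"
  proof -
    have add: "AE x in M. L (\<lambda>y. g y + h y) x = L g x + L h x" if "g \<in> L2 M" "h \<in> L2 M" for g h
      using L that by (simp add: bounded_operator_def)
    have "(\<lambda>y. c i * f i y) \<in> L2 M" "(\<lambda>y. \<Sum>i\<in>I. c i * f i y) \<in> L2 M"
      using insert.prems by (auto intro!: L2_cmult L2_sum)
    from add [OF this] show ?thesis .
  qed
  moreover have "AE x in M. L (\<lambda>y. c i * f i y) x = c i * L (f i) x"
    using L insert.prems unfolding bounded_operator_def by auto
  moreover have "AE x in M. L (\<lambda>y. \<Sum>i\<in>I. c i * f i y) x = (\<Sum>i\<in>I. c i * L (f i) x)"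
    using insert by auto
  ultimately show ?case
  proof eventually_elim
    case (elim x)
    then show ?case using insert.hyps by simp
  qed
qed

lemma bounded_operator_L2: "bounded_operator M L \<Longrightarrow> g \<in> L2 M \<Longrightarrow> L g \<in> L2 M"
  by (auto simp: bounded_operator_def)

lemma L2_inner_operator_sum:
  assumes L: "bounded_operator M L" and "finite I" and f: "\<And>i. i \<in> I \<Longrightarrow> f i \<in> L2 M" and F: "F \<in> L2 M"
  shows "L2_inner M F (L (\<lambda>y. \<Sum>i\<in>I. c i * f i y)) = (\<Sum>i\<in>I. cnj (c i) * L2_inner M F (L (f i)))"
proof -
  have Lf: "L (f i) \<in> L2 M" if "i \<in> I" for i
    using L f that by (simp add: bounded_operator_L2)
  have "L2_inner M F (L (\<lambda>y. \<Sum>i\<in>I. c i * f i y)) = L2_inner M F (\<lambda>x. \<Sum>i\<in>I. c i * L (f i) x)"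
    by (intro L2_inner_cong_AE bounded_operator_sum [OF L \<open>finite I\<close> f F] L2_measurable L2_sum L2_cmult Lf f F
        bounded_operator_L2 [OF L])
  also have "\<dots> = (\<Sum>i\<in>I. cnj (c i) * L2_inner M F (L (f i)))"
    by (intro L2_inner_sum_right \<open>finite I\<close> Lf F)
  finally show ?thesis .
qed

lemma sum_norm_mult_le_sqrt:
  fixes a b :: "'i \<Rightarrow> complex"
  shows "(\<Sum>i\<in>I. cmod (a i) * cmod (b i)) \<le> sqrt (\<Sum>i\<in>I. (cmod (a i))\<^sup>2) * sqrt (\<Sum>i\<in>I. (cmod (b i))\<^sup>2)"
  using L2_set_mult_ineq [where A=I and f="\<lambda>i. cmod (a i)" and g="\<lambda>i. cmod (b i)"] by (simp add: L2_set_def)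

text \<open>The data extracted from a uniformly invertible Riesz basis: the operator \<open>L\<close> sends lattice exponentials to
  the exponentials at the nodes, \<open>B\<close> bounds its norm and \<open>C\<close> bounds the inverses of all its finite sections.\<close>

locale section_system =
  fixes t :: "int^'d \<Rightarrow> real^'d" and L :: "(real^'d \<Rightarrow> complex) \<Rightarrow> (real^'d \<Rightarrow> complex)"
    and B C :: real
  assumes L: "bounded_operator cube_pi L"
    and L_expo: "\<And>n. AE x in cube_pi. L (lattice_expo n) x = expo (t n) x"
    and L_bound: "\<And>g. g \<in> L2 cube_pi \<Longrightarrow> l2norm cube_pi (L g) \<le> B * l2norm cube_pi g"
    and compression_bij: "\<And>l. l \<ge> 1 \<Longrightarrow> bij_betw (compression l L) (trig_span l) (trig_span l)"
    and inverse_bound: "\<And>l h. l \<ge> 1 \<Longrightarrow> h \<in> trig_span l \<Longrightarrow>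
      l2norm cube_pi (inv_into (trig_span l) (compression l L) h) \<le> C * l2norm cube_pi h"
    and nonneg: "B \<ge> 0" "C \<ge> 0"
begin

lemma L_lattice_expo_inner:
  assumes "F \<in> L2 cube_pi" shows "L2_inner cube_pi F (L (lattice_expo n)) = cube_fourier F (t n)"
  unfolding cube_fourier_def
  by (intro L2_inner_cong_AE L2_measurable bounded_operator_L2 [OF L] L_expo assms expo_L2 lattice_expo_L2)

lemma inner_L_trig_poly:
  assumes "F \<in> L2 cube_pi"
  shows "L2_inner cube_pi F (L (trig_poly l c)) = (\<Sum>n\<in>index_cube l. cnj (c n) * cube_fourier F (t n))"
  unfolding trig_poly_def
  by (subst L2_inner_operator_sum [OF L]) (auto simp: assms L_lattice_expo_inner)

text \<open>The values at the nodes are the Fourier coefficients of the adjoint of \<open>L\<close> applied to \<open>F\<close>. Testing with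
  the trigonometric polynomial that has these values as coefficients avoids constructing the adjoint.\<close>

lemma node_samples_bessel:
  assumes F: "F \<in> L2 cube_pi"
  shows "(\<Sum>n\<in>index_cube l. (cmod (cube_fourier F (t n)))\<^sup>2) \<le> (B * l2norm cube_pi F)\<^sup>2"
proof -
  \<comment> \<open>Testing \<open>L\<close> against the trigonometric polynomial with coefficients \<open>a\<close> produces the sum of squares.\<close>
  define a where "a n = cube_fourier F (t n)" for n
  define s where "s = (\<Sum>n\<in>index_cube l. (cmod (a n))\<^sup>2)"
  have "s \<ge> 0" by (simp add: s_def sum_nonneg)
  have n: "l2norm cube_pi (trig_poly l a) = sqrt s"
    using l2norm_trig_poly [of l a] real_sqrt_unique [of "l2norm cube_pi (trig_poly l a)" s] by (simp add: s_def)
  have "complex_of_real s = L2_inner cube_pi F (L (trig_poly l a))"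
    unfolding inner_L_trig_poly [OF F] s_def a_def [symmetric] of_real_sum
    by (intro sum.cong refl) (simp add: complex_norm_square mult.commute del: of_real_power)
  then have "s = cmod (L2_inner cube_pi F (L (trig_poly l a)))"
    using \<open>s \<ge> 0\<close> by (metis norm_of_real abs_of_nonneg)
  also have "\<dots> \<le> l2norm cube_pi F * l2norm cube_pi (L (trig_poly l a))"
    by (intro L2_inner_Cauchy_Schwarz F bounded_operator_L2 [OF L] trig_poly_L2)
  also have "\<dots> \<le> l2norm cube_pi F * (B * sqrt s)"
    using L_bound [OF trig_poly_L2, of l a] by (intro mult_left_mono) (auto simp: n)
  finally have le: "sqrt s * sqrt s \<le> (B * l2norm cube_pi F) * sqrt s"
    using \<open>s \<ge> 0\<close> by (simp add: mult_ac)
  have "sqrt s \<le> B * l2norm cube_pi F"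
  proof (cases "s = 0")
    case False
    with \<open>s \<ge> 0\<close> show ?thesis by (intro mult_right_le_imp_le [OF le]) simp
  qed (use nonneg in simp)
  then have "(sqrt s)\<^sup>2 \<le> (B * l2norm cube_pi F)\<^sup>2"
    using \<open>s \<ge> 0\<close> by (intro power_mono) auto
  then show ?thesis
    using \<open>s \<ge> 0\<close> by (simp add: s_def a_def)
qed

lemma compression_eq:
  assumes "h \<in> trig_span l"
  shows "compression l L h = trig_poly l (fourier_coeff (L h))"
  using assms unfolding compression_def
  by (simp add: trig_proj_eq trig_span_L2 bounded_operator_L2 [OF L] trig_poly_fourier_coeff)

lemma inner_compression:
  assumes P: "P \<in> trig_span l" and h: "h \<in> trig_span l"
  shows "L2_inner cube_pi P (compression l L h) = L2_inner cube_pi P (L h)"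
proof -
  have Lh: "L h \<in> L2 cube_pi" by (rule bounded_operator_L2 [OF L trig_span_L2 [OF h]])
  have "L2_inner cube_pi (\<lambda>x. L h x - trig_poly l (fourier_coeff (L h)) x) P = 0"
    by (rule trig_poly_projection_orthogonal [OF Lh P])
  then have "L2_inner cube_pi (L h) P = L2_inner cube_pi (compression l L h) P"
    by (simp add: compression_eq [OF h] L2_inner_diff_left Lh trig_span_L2 [OF P])
  then show ?thesis
    using L2_inner_commute [of cube_pi P] by simp
qed

text \<open>With \<open>H\<close> the trigonometric polynomial and \<open>h\<close> its preimage under the finite section, \<open>\<langle>H, H\<rangle> = \<langle>H, L h\<rangle>\<close>
  is a combination of the values of the transform at the nodes with the coefficients of \<open>h\<close>, whose norm is at
  most \<open>C\<close> times that of \<open>H\<close>.\<close>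

lemma node_samples_stable:
  assumes l: "l \<ge> 1"
  shows "l2norm cube_pi (trig_poly l c) \<le> C * sqrt (\<Sum>n\<in>index_cube l. (cmod (cube_fourier (trig_poly l c) (t n)))\<^sup>2)"
proof -
  let ?H = "trig_poly l c" and ?T = "trig_span l"
  define d where "d n = cube_fourier ?H (t n)" for n
  define h where "h = inv_into ?T (compression l L) ?H"
  have H: "?H \<in> ?T" by (simp add: trig_span_eq)
  have h: "h \<in> ?T" "compression l L h = ?H"
    unfolding h_def
    by (rule bij_betw_apply [OF bij_betw_inv_into [OF compression_bij [OF l]] H],
        rule bij_betw_inv_into_right [OF compression_bij [OF l] H])
  have hn: "l2norm cube_pi h \<le> C * l2norm cube_pi ?H"
    unfolding h_def by (rule inverse_bound [OF l H])
  obtain b where b: "h = trig_poly l b" using h by (auto simp: trig_span_eq)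
  have "complex_of_real ((l2norm cube_pi ?H)\<^sup>2) = L2_inner cube_pi ?H (L h)"
    using inner_compression [OF H h(1)] by (simp add: h(2) L2_inner_self)
  also have "\<dots> = (\<Sum>n\<in>index_cube l. cnj (b n) * d n)"
    unfolding b d_def by (rule inner_L_trig_poly) simp
  finally have "(l2norm cube_pi ?H)\<^sup>2 = cmod (\<Sum>n\<in>index_cube l. cnj (b n) * d n)"
    by (metis norm_of_real abs_of_nonneg zero_le_power2)
  also have "\<dots> \<le> (\<Sum>n\<in>index_cube l. cmod (b n) * cmod (d n))"
    by (rule order_trans [OF norm_sum]) (simp add: norm_mult)
  also have "\<dots> \<le> sqrt (\<Sum>n\<in>index_cube l. (cmod (b n))\<^sup>2) * sqrt (\<Sum>n\<in>index_cube l. (cmod (d n))\<^sup>2)"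
    by (rule sum_norm_mult_le_sqrt)
  also have "sqrt (\<Sum>n\<in>index_cube l. (cmod (b n))\<^sup>2) = l2norm cube_pi h"
    unfolding b l2norm_trig_poly [symmetric] by simp
  also have "l2norm cube_pi h * sqrt (\<Sum>n\<in>index_cube l. (cmod (d n))\<^sup>2)
      \<le> (C * l2norm cube_pi ?H) * sqrt (\<Sum>n\<in>index_cube l. (cmod (d n))\<^sup>2)"
    by (intro mult_right_mono hn real_sqrt_ge_zero sum_nonneg) auto
  finally have "l2norm cube_pi ?H * l2norm cube_pi ?H \<le> (C * sqrt (\<Sum>n\<in>index_cube l. (cmod (d n))\<^sup>2)) * l2norm cube_pi ?H"
    by (simp add: power2_eq_square mult_ac)
  moreover have "0 \<le> C * sqrt (\<Sum>n\<in>index_cube l. (cmod (d n))\<^sup>2)"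
    using nonneg by (simp add: sum_nonneg)
  moreover have "0 \<le> l2norm cube_pi ?H" by simp
  ultimately show ?thesis
    unfolding d_def [symmetric] by (metis mult_right_le_imp_le order_le_less)
qed

lemma node_samples_inj:
  assumes l: "l \<ge> 1" and "\<And>n. n \<in> index_cube l \<Longrightarrow> cube_fourier (trig_poly l c) (t n) = 0" and "n \<in> index_cube l"
  shows "c n = 0"
proof -
  have "l2norm cube_pi (trig_poly l c) \<le> 0"
    using node_samples_stable [OF l, of c] assms(2) by simp
  then have "(\<Sum>n\<in>index_cube l. (cmod (c n))\<^sup>2) = 0"
    unfolding l2norm_trig_poly [symmetric] using l2norm_nonneg [of cube_pi "trig_poly l c"] by simp
  then show ?thesis
    using \<open>n \<in> index_cube l\<close> by (simp add: sum_nonneg_eq_0_iff)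
qed

text \<open>The solution is written down explicitly: its coefficients are those of the inverse adjoint of the finite
  section applied to the data, with \<open>h n\<close> the preimage of the \<open>n\<close>-th lattice exponential.\<close>

lemma node_samples_surj:
  assumes l: "l \<ge> 1"
  shows "\<exists>c. \<forall>n\<in>index_cube l. cube_fourier (trig_poly l c) (t n) = d n"
proof -
  let ?T = "trig_span l" and ?K = "compression l L"
  define e where "e n = trig_poly l (\<lambda>m. if m = n then 1 else 0)" for n :: "int^'d"
  have e: "e n = lattice_expo n" if "n \<in> index_cube l" for n
    using that by (simp add: e_def trig_poly_def fun_eq_iff if_distrib [of "\<lambda>z. z * _"] cong: if_cong)
  have eT: "e n \<in> ?T" for n by (simp add: e_def trig_span_eq)
  define h where "h n = inv_into ?T ?K (e n)" for n
  have h: "h n \<in> ?T" "?K (h n) = e n" for n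
    unfolding h_def
    by (rule bij_betw_apply [OF bij_betw_inv_into [OF compression_bij [OF l]] eT],
        rule bij_betw_inv_into_right [OF compression_bij [OF l] eT])
  define c where "c n = (\<Sum>p\<in>index_cube l. d p * cnj (fourier_coeff (h n) p))" for n
  have "cube_fourier (trig_poly l c) (t m) = d m" if m: "m \<in> index_cube l" for m
  proof -
    define k where "k n = fourier_coeff (L (e m)) n" for n
    \<comment> \<open>By linearity the finite section sends \<open>g\<close> to the projection of \<open>L (e m)\<close>, so \<open>g = e m\<close> by injectivity.\<close>
    define g where "g x = (\<Sum>n\<in>index_cube l. k n * h n x)" for x
    have hL2: "h n \<in> L2 cube_pi" for n by (rule trig_span_L2 [OF h(1)])
    have gT: "g \<in> ?T"
    proof -
      have "g = trig_poly l (\<lambda>p. \<Sum>n\<in>index_cube l. k n * fourier_coeff (h n) p)"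
      proof
        fix x
        have "g x = (\<Sum>n\<in>index_cube l. k n * trig_poly l (fourier_coeff (h n)) x)"
          by (simp add: g_def trig_poly_fourier_coeff h)
        also have "\<dots> = (\<Sum>p\<in>index_cube l. \<Sum>n\<in>index_cube l. k n * (fourier_coeff (h n) p * lattice_expo p x))"
          unfolding trig_poly_def sum_distrib_left by (rule sum.swap)
        also have "\<dots> = trig_poly l (\<lambda>p. \<Sum>n\<in>index_cube l. k n * fourier_coeff (h n) p) x"
          by (simp add: trig_poly_def sum_distrib_right mult.assoc)
        finally show "g x = trig_poly l (\<lambda>p. \<Sum>n\<in>index_cube l. k n * fourier_coeff (h n) p) x" .
      qed
      then show ?thesis by (simp add: trig_span_eq)
    qed
    have gL2: "g \<in> L2 cube_pi" using gT by (rule trig_span_L2)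
    have "fourier_coeff (L g) p = fourier_coeff (L (e m)) p" if p: "p \<in> index_cube l" for p
    proof -
      have "L2_inner cube_pi (lattice_expo p) (L g) = (\<Sum>n\<in>index_cube l. cnj (k n) * L2_inner cube_pi (lattice_expo p) (L (h n)))"
        unfolding g_def [abs_def] by (intro L2_inner_operator_sum L hL2 finite_index_cube lattice_expo_L2)
      also have "\<dots> = (\<Sum>n\<in>index_cube l. cnj (k n) * L2_inner cube_pi (lattice_expo p) (lattice_expo n))"
      proof (intro sum.cong refl)
        fix n :: "int^'d" assume n: "n \<in> index_cube l"
        show "cnj (k n) * L2_inner cube_pi (lattice_expo p) (L (h n)) = cnj (k n) * L2_inner cube_pi (lattice_expo p) (lattice_expo n)"
          using inner_compression [OF eT [of p] h(1) [of n]] by (simp add: h(2) e n p)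
      qed
      also have "\<dots> = cnj (k p)"
        using p by (simp add: lattice_expo_orthonormal if_distrib cong: if_cong)
      finally show ?thesis
        using L2_inner_commute [of cube_pi "L g"] by (simp add: k_def)
    qed
    then have "trig_poly l (fourier_coeff (L g)) = trig_poly l (fourier_coeff (L (e m)))"
      unfolding trig_poly_def by (intro ext sum.cong) auto
    then have "?K g = ?K (e m)"
      by (simp add: compression_eq gT eT)
    then have g: "g = e m"
      using compression_bij [OF l] gT eT by (auto simp: bij_betw_def inj_on_def)
    have HT: "trig_poly l c \<in> ?T" by (simp add: trig_span_eq)
    have "cube_fourier (trig_poly l c) (t m) = L2_inner cube_pi (trig_poly l c) (L (e m))"
      by (simp add: L_lattice_expo_inner e m)
    also have "\<dots> = L2_inner cube_pi (trig_poly l c) (trig_poly l k)"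
      using inner_compression [OF HT eT [of m]] by (simp add: compression_eq eT k_def [abs_def])
    also have "\<dots> = (\<Sum>n\<in>index_cube l. cnj (k n) * c n)"
      by (simp add: inner_trig_poly_right fourier_coeff_trig_poly)
    also have "\<dots> = (\<Sum>p\<in>index_cube l. d p * cnj (\<Sum>n\<in>index_cube l. k n * fourier_coeff (h n) p))"
      unfolding c_def sum_distrib_left cnj_sum by (subst sum.swap) (simp add: mult_ac)
    also have "\<dots> = (\<Sum>p\<in>index_cube l. d p * cnj (fourier_coeff g p))"
      unfolding g_def [abs_def] by (subst L2_inner_sum_left) (auto simp: hL2)
    also have "\<dots> = d m"
      using m by (simp add: g e_def fourier_coeff_trig_poly if_distrib cong: if_cong)
    finally show ?thesis .
  qed
  then show ?thesis by blast
qed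

end

lemma uniformly_invertible_section_system:
  assumes "uniformly_invertible_Riesz_basis (\<lambda>n. expo (t n))"
  obtains L B C where "section_system t L B C"
proof -
  obtain L C where L: "bounded_bijection cube_pi L"
    and expo: "\<And>n. AE x in cube_pi. L (lattice_expo n) x = expo (t n) x"
    and bij: "\<And>l. l \<ge> 1 \<Longrightarrow> bij_betw (compression l L) (trig_span l) (trig_span l)"
    and inv: "\<And>l h. l \<ge> 1 \<Longrightarrow> h \<in> trig_span l \<Longrightarrow>
      L2_norm cube_pi (inv_into (trig_span l) (compression l L) h) \<le> ereal C * L2_norm cube_pi h"
    using assms unfolding uniformly_invertible_Riesz_basis_def by blast
  have Lb: "bounded_operator cube_pi L" using L by (simp add: bounded_bijection_def)
  obtain B where B: "B \<ge> 0" "\<And>g. g \<in> L2 cube_pi \<Longrightarrow> l2norm cube_pi (L g) \<le> B * l2norm cube_pi g"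
    using bounded_operator_l2norm [OF Lb] by blast
  have "section_system t L B \<bar>C\<bar>"
  proof
    fix l :: nat and h :: "real^'a \<Rightarrow> complex" assume l: "1 \<le> l" and h: "h \<in> trig_span l"
    have "inv_into (trig_span l) (compression l L) h \<in> trig_span l"
      using bij [OF l] h unfolding bij_betw_def by (auto intro: inv_into_into)
    then have "l2norm cube_pi (inv_into (trig_span l) (compression l L) h) \<le> C * l2norm cube_pi h"
      using inv [OF l h] h by (simp add: L2_norm_eq_l2norm trig_span_L2)
    also have "\<dots> \<le> \<bar>C\<bar> * l2norm cube_pi h"
      by (intro mult_right_mono) auto
    finally show "l2norm cube_pi (inv_into (trig_span l) (compression l L) h) \<le> \<bar>C\<bar> * l2norm cube_pi h" .
  qed (use Lb expo bij B in auto)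
  then show thesis using that by blast
qed

section \<open>The tail of the sine product\<close>

text \<open>The product of \<open>1 - x\<^sup>2/j\<^sup>2\<close> over all \<open>j > l\<close>; see \<open>sine_tail_LIMSEQ\<close>. The form with the entire
  function \<open>1/\<Gamma>\<close> makes continuity and the factorisation of the cardinal sine available at every point,
  including the integers, where quotients of sines would need a separate treatment.\<close>

definition sine_tail :: "nat \<Rightarrow> real \<Rightarrow> real" where
  "sine_tail l x = (fact l)\<^sup>2 * (rGamma (1 + real l - x) * rGamma (1 + real l + x))"

lemma continuous_on_gtail: "continuous_on S (sine_tail l)"
  unfolding sine_tail_def by (intro continuous_intros continuous_on_compose2 [OF continuous_on_rGamma [of UNIV]]) auto

lemma sine_tail_minus: "sine_tail l (- x) = sine_tail l x"
  by (simp add: sine_tail_def mult.commute)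

lemma sine_tail_Suc: "sine_tail l x = (1 - (x / real (Suc l))\<^sup>2) * sine_tail (Suc l) x"
proof -
  define q where "q = 1 + real l"
  have q: "q \<noteq> 0" "real (Suc l) = q" "1 + q = q + 1" by (auto simp: q_def)
  have a: "rGamma (q - x) = (q - x) * rGamma (q + 1 - x)"
    using rGamma_plus1 [of "q - x"] by (simp add: algebra_simps)
  have b: "rGamma (q + x) = (q + x) * rGamma (q + 1 + x)"
    using rGamma_plus1 [of "q + x"] by (simp add: algebra_simps)
  have c: "(q - x) * (q + x) = (1 - (x / q)\<^sup>2) * q\<^sup>2"
    using q(1) by (simp add: field_simps power2_eq_square)
  have f: "(fact (Suc l) :: real) = q * fact l"
    by (simp add: q_def)
  have "sine_tail l x = (fact l)\<^sup>2 * (((q - x) * (q + x)) * (rGamma (q + 1 - x) * rGamma (q + 1 + x)))"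
    unfolding sine_tail_def q_def [symmetric] a b by (simp only: mult_ac)
  also have "\<dots> = (1 - (x / q)\<^sup>2) * ((q * fact l)\<^sup>2 * (rGamma (q + 1 - x) * rGamma (q + 1 + x)))"
    unfolding c by (simp only: power_mult_distrib mult_ac)
  finally show ?thesis
    unfolding sine_tail_def f q .
qed

lemma sine_tail_eq_partial_product:
  "sine_tail l x = (\<Prod>j\<in>{l<..l + m}. 1 - (x / real j)\<^sup>2) * sine_tail (l + m) x"
proof (induction m)
  case (Suc m)
  have "{l<..l + Suc m} = insert (l + Suc m) {l<..l + m}" by auto
  then show ?case
    using Suc sine_tail_Suc [of "l + m" x] by simp
qed simp

text \<open>Gauss's limit formula for the Gamma function, applied to a shifted argument.\<close>

lemma rGamma_shift_tendsto_1:
  fixes z :: real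
  assumes "z > 0"
  shows "(\<lambda>n. rGamma (z + real n + 1) * (fact n * exp (z * ln (real n)))) \<longlonglongrightarrow> 1"
proof -
  have nz: "rGamma z \<noteq> 0"
    using assms by (auto simp: rGamma_eq_zero_iff elim!: nonpos_Ints_cases')
  have "(\<lambda>n. rGamma z / rGamma_series z n) \<longlonglongrightarrow> rGamma z / rGamma z"
    by (intro tendsto_intros nz)
  moreover have "rGamma z / rGamma_series z n = rGamma (z + real n + 1) * (fact n * exp (z * ln (real n)))" for n
  proof -
    have "rGamma z = pochhammer z (n+1) * rGamma (z + real n + 1)"
      using pochhammer_rGamma [of z "n+1"] by (simp add: add_ac)
    moreover have "pochhammer z (n+1) \<noteq> 0"
      using assms pochhammer_pos [of z "n+1"] by simp
    ultimately show ?thesis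
      by (simp add: rGamma_series_def)
  qed
  ultimately show ?thesis using nz by simp
qed

text \<open>Apply \<open>rGamma_shift_tendsto_1\<close> at \<open>K - x\<close>, \<open>K + x\<close> and \<open>K\<close>, where \<open>K > \<bar>x\<bar>\<close> keeps the arguments positive. The
  powers of \<open>n\<close> cancel in the quotient.\<close>

lemma sine_tail_tendsto_1: "(\<lambda>l. sine_tail l x) \<longlonglongrightarrow> 1"
proof -
  obtain K :: nat where K: "\<bar>x\<bar> < real K" using reals_Archimedean2 by blast
  \<comment> \<open>The quantity of Gauss\'s formula at \<open>K + y\<close>.\<close>
  define u where "u y n = rGamma (real K + y + real n + 1) * (fact n * exp ((real K + y) * ln (real n)))" for y n
  have u: "u y \<longlonglongrightarrow> 1" if "\<bar>y\<bar> \<le> \<bar>x\<bar>" for y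
    unfolding u_def using K that by (intro rGamma_shift_tendsto_1) linarith
  have "(\<lambda>n. u (- x) n * u x n / (u 0 n)\<^sup>2) \<longlonglongrightarrow> 1 * 1 / 1\<^sup>2"
    by (intro tendsto_intros u) auto
  moreover have "u (- x) n * u x n / (u 0 n)\<^sup>2 = sine_tail (n + K) x" for n
  proof -
    define a where "a = ln (real n)"
    have e: "exp ((real K + - x) * a) * exp ((real K + x) * a) = (exp ((real K + 0) * a))\<^sup>2"
      by (simp add: power2_eq_square algebra_simps flip: exp_add)
    have f: "rGamma (real K + 0 + real n + 1) = 1 / fact (n + K)"
      using Gamma_fact [of "n + K", where 'a=real] by (simp add: rGamma_inverse_Gamma add_ac divide_inverse)
    have "u (- x) n * u x n = rGamma (real K + - x + real n + 1) * rGamma (real K + x + real n + 1)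
        * ((fact n)\<^sup>2 * (exp ((real K + - x) * a) * exp ((real K + x) * a)))"
      by (simp add: u_def a_def power2_eq_square)
    also have "\<dots> = rGamma (real K + - x + real n + 1) * rGamma (real K + x + real n + 1)
        * (fact n * exp ((real K + 0) * a))\<^sup>2"
      unfolding e by (simp add: power_mult_distrib)
    finally have "u (- x) n * u x n / (u 0 n)\<^sup>2 = rGamma (real K + - x + real n + 1) * rGamma (real K + x + real n + 1) * (fact (n + K))\<^sup>2"
      unfolding u_def [of 0] f a_def [symmetric] by (simp add: power_divide power_mult_distrib)
    moreover have "real K + - x + real n + 1 = 1 + real (n + K) - x" "real K + x + real n + 1 = 1 + real (n + K) + x"
      by auto
    ultimately show ?thesis
      by (simp only: sine_tail_def mult_ac)
  qed
  ultimately have "(\<lambda>n. sine_tail (n + K) x) \<longlonglongrightarrow> 1" by simp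
  then show ?thesis by (rule LIMSEQ_offset)
qed

lemma sine_tail_LIMSEQ: "(\<lambda>m. \<Prod>j\<in>{l<..l + m}. 1 - (x / real j)\<^sup>2) \<longlonglongrightarrow> sine_tail l x"
proof -
  have "(\<lambda>m. sine_tail (m + l) x) \<longlonglongrightarrow> 1"
    using sine_tail_tendsto_1 [of x] by (rule LIMSEQ_ignore_initial_segment)
  then have lim: "(\<lambda>m. sine_tail (l + m) x) \<longlonglongrightarrow> 1" by (simp add: add.commute)
  then have "(\<lambda>m. sine_tail l x / sine_tail (l + m) x) \<longlonglongrightarrow> sine_tail l x / 1"
    by (intro tendsto_intros) auto
  moreover have "\<forall>\<^sub>F m in sequentially. sine_tail (l + m) x > 0"
    using lim by (rule order_tendstoD) simp
  then have "\<forall>\<^sub>F m in sequentially. sine_tail l x / sine_tail (l + m) x = (\<Prod>j\<in>{l<..l + m}. 1 - (x / real j)\<^sup>2)"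
  proof eventually_elim
    case (elim m)
    then show ?case using sine_tail_eq_partial_product [of l x m] by (simp add: field_simps)
  qed
  ultimately show ?thesis
    by (simp add: tendsto_cong)
qed

lemma square_ratio_less_1:
  fixes x a :: real
  assumes "\<bar>x\<bar> < a" shows "(x / a)\<^sup>2 < 1"
proof -
  have "a > 0" using assms by linarith
  then show ?thesis
    using assms unfolding abs_square_less_1 abs_divide by simp
qed

lemma sine_tail_le_1:
  assumes "\<bar>x\<bar> < real l + 1"
  shows "sine_tail l x \<le> 1"
proof (rule LIMSEQ_le_const2 [OF sine_tail_LIMSEQ])
  have "0 \<le> 1 - (x / real j)\<^sup>2 \<and> 1 - (x / real j)\<^sup>2 \<le> 1" if "j \<in> {l<..l+m}" for j m
  proof -
    have "\<bar>x\<bar> < real j" using that assms by simp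
    then show ?thesis using square_ratio_less_1 [of x "real j"] by simp
  qed
  then show "\<exists>N. \<forall>m\<ge>N. (\<Prod>j\<in>{l<..l + m}. 1 - (x / real j)\<^sup>2) \<le> 1"
    by (intro exI [of _ 0] allI impI prod_le_1) blast+
qed

text \<open>The Taylor series of \<open>- ln (1 - u)\<close> cut off after \<open>N\<close> terms, with the remainder bounded by a geometric
  series.\<close>

lemma exp_neg_log_series_le:
  fixes u :: real
  assumes "0 \<le> u" "u < 1"
  shows "exp (- ((\<Sum>k=1..N. u ^ k / real k) + u ^ Suc N / (1 - u))) \<le> 1 - u"
proof -
  \<comment> \<open>\<open>h\<close> vanishes at \<open>0\<close> and its derivative is nonnegative.\<close>
  define h where "h v = ln (1 - v) + ((\<Sum>k=1..N. v ^ k / real k) + v ^ Suc N / (1 - v))" for v :: real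
  have "h 0 \<le> h u"
  proof (rule DERIV_nonneg_imp_nondecreasing [OF assms(1)])
    fix v assume v: "0 \<le> v" "v \<le> u"
    then have "v < 1" using assms by simp
    have "(\<Sum>k=1..N. v ^ (k - 1)) = (\<Sum>k<N. v ^ k)"
      by (simp add: sum.atLeast1_atMost_eq)
    also have "\<dots> = (1 - v ^ N) / (1 - v)"
      using \<open>v < 1\<close> by (simp add: sum_gp_strict)
    finally have s: "(\<Sum>k=1..N. v ^ (k - 1)) = (1 - v ^ N) / (1 - v)" .
    have deriv: "((\<lambda>v. v ^ k / real k) has_real_derivative v ^ (k - 1)) (at v)" if "k \<in> {1..N}" for k
      using that by (auto intro!: derivative_eq_intros)
    have sum: "((\<lambda>v. \<Sum>k=1..N. v ^ k / real k) has_real_derivative (\<Sum>k=1..N. v ^ (k - 1))) (at v)"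
      by (rule DERIV_sum [OF deriv])
    have tail: "((\<lambda>v. v ^ Suc N / (1 - v)) has_real_derivative (real (Suc N) * v ^ N * (1 - v) + v ^ Suc N) / (1 - v)\<^sup>2) (at v)"
    proof (rule DERIV_cong [OF DERIV_divide [OF DERIV_pow]])
      show "((\<lambda>v. 1 - v) has_real_derivative - 1) (at v)"
        by (auto intro!: derivative_eq_intros)
    qed (use \<open>v < 1\<close> in \<open>auto simp: power2_eq_square\<close>)
    have ln: "((\<lambda>v. ln (1 - v)) has_real_derivative - 1 / (1 - v)) (at v)"
      using \<open>v < 1\<close> by (auto intro!: derivative_eq_intros)
    have D: "(h has_real_derivative - 1 / (1 - v) + ((\<Sum>k=1..N. v ^ (k - 1)) + (real (Suc N) * v ^ N * (1 - v) + v ^ Suc N) / (1 - v)\<^sup>2)) (at v)"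
      unfolding h_def by (intro DERIV_add ln sum tail)
    have "- 1 / (1 - v) + ((\<Sum>k=1..N. v ^ (k - 1)) + (real (Suc N) * v ^ N * (1 - v) + v ^ Suc N) / (1 - v)\<^sup>2)
        = (real N * v ^ N * (1 - v) + v ^ Suc N) / (1 - v)\<^sup>2"
    proof -
      have "- 1 / w + ((1 - a) / w + ((r + 1) * a * w + b) / w\<^sup>2) = (r * a * w + b) / w\<^sup>2"
        if "w \<noteq> 0" for w a b r :: real
        using that by (simp add: field_simps power2_eq_square)
      from this [of "1 - v" "v ^ N" "real N" "v ^ Suc N"] show ?thesis
        unfolding s using \<open>v < 1\<close> by (simp add: add.commute)
    qed
    also have "\<dots> \<ge> 0"
      using v \<open>v < 1\<close> by simp
    finally show "\<exists>y. DERIV h v :> y \<and> 0 \<le> y"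
      using D by blast
  qed
  moreover have "h 0 = 0"
    by (simp add: h_def power_0_left)
  ultimately have "- ((\<Sum>k=1..N. u ^ k / real k) + u ^ Suc N / (1 - u)) \<le> ln (1 - u)"
    by (simp add: h_def)
  then show ?thesis
    using assms by (simp add: ln_ge_iff)
qed

text \<open>The midpoint rule underestimates the integral of the convex function \<open>y\<^sup>-\<^sup>2\<^sup>k\<^sup>-\<^sup>2\<close> over an interval of
  length \<open>1\<close> centred at \<open>j\<close>. The right-hand side is \<open>2k + 1\<close> times this integral.\<close>

lemma inverse_power_midpoint:
  fixes j :: real
  assumes "j \<ge> 1"
  shows "real (Suc (2 * k)) * inverse j ^ (2 * k + 2) \<le> inverse (j - 1/2) ^ Suc (2 * k) - inverse (j + 1/2) ^ Suc (2 * k)"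
proof -
  \<comment> \<open>The derivative of \<open>h\<close> is nonnegative because the mean of \<open>(j - y)\<^sup>-\<^sup>2\<^sup>k\<^sup>-\<^sup>2\<close> and \<open>(j + y)\<^sup>-\<^sup>2\<^sup>k\<^sup>-\<^sup>2\<close>
    is at least \<open>(j\<^sup>2 - y\<^sup>2)\<^sup>-\<^sup>k\<^sup>-\<^sup>1\<close>.\<close>
  define h where "h y = inverse (j - y) ^ Suc (2 * k) - inverse (j + y) ^ Suc (2 * k) - 2 * y * (real (Suc (2 * k)) * inverse j ^ (2 * k + 2))" for y
  have "h 0 \<le> h (1/2)"
  proof (rule DERIV_nonneg_imp_nondecreasing [of 0 "1/2" h])
    fix y :: real assume y: "0 \<le> y" "y \<le> 1/2"
    have pos: "j - y > 0" "j + y > 0" using y assms by auto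
    let ?a = "inverse (j - y)" and ?b = "inverse (j + y)"
    have d1: "((\<lambda>y. inverse (j - y) ^ Suc (2 * k)) has_real_derivative real (Suc (2 * k)) * ?a ^ (2 * k + 2)) (at y)"
    proof (rule DERIV_cong [OF DERIV_power])
      show "((\<lambda>y. inverse (j - y)) has_real_derivative ?a * ?a) (at y)"
        using pos by (auto intro!: derivative_eq_intros)
    qed (simp add: mult_ac)
    have d2: "((\<lambda>y. inverse (j + y) ^ Suc (2 * k)) has_real_derivative - (real (Suc (2 * k)) * ?b ^ (2 * k + 2))) (at y)"
    proof (rule DERIV_cong [OF DERIV_power])
      show "((\<lambda>y. inverse (j + y)) has_real_derivative - (?b * ?b)) (at y)"
        using pos by (auto intro!: derivative_eq_intros)
    qed (simp add: mult_ac)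
    have D: "(h has_real_derivative real (Suc (2 * k)) * ?a ^ (2 * k + 2) - - (real (Suc (2 * k)) * ?b ^ (2 * k + 2)) - 2 * (real (Suc (2 * k)) * inverse j ^ (2 * k + 2))) (at y)"
      unfolding h_def by (intro DERIV_diff d1 d2) (auto intro!: derivative_eq_intros)
    have "2 * (?a ^ Suc k * ?b ^ Suc k) \<le> (?a ^ Suc k)\<^sup>2 + (?b ^ Suc k)\<^sup>2"
      using sum_squares_bound [of "?a ^ Suc k" "?b ^ Suc k"] by simp
    moreover have "(inverse j * inverse j) ^ Suc k \<le> (?a * ?b) ^ Suc k"
    proof (rule power_mono)
      have "(j - y) * (j + y) \<le> j * j" using y by (simp add: algebra_simps)
      then have "inverse (j * j) \<le> inverse ((j - y) * (j + y))"
        using pos by (intro le_imp_inverse_le) auto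
      then show "inverse j * inverse j \<le> ?a * ?b" by simp
    qed (use assms in auto)
    moreover have "x ^ (2 * k + 2) = (x ^ Suc k)\<^sup>2" for x :: real
    proof -
      have "2 * k + 2 = Suc k * 2" by simp
      then show ?thesis by (simp only: power_mult)
    qed
    moreover have "(inverse j ^ Suc k)\<^sup>2 = (inverse j * inverse j) ^ Suc k"
      by (simp only: power2_eq_square power_mult_distrib)
    ultimately have "0 \<le> ?a ^ (2 * k + 2) + ?b ^ (2 * k + 2) - 2 * inverse j ^ (2 * k + 2)"
      by (simp only: power_mult_distrib)
    then have "0 \<le> real (Suc (2 * k)) * (?a ^ (2 * k + 2) + ?b ^ (2 * k + 2) - 2 * inverse j ^ (2 * k + 2))"
      by (intro mult_nonneg_nonneg) auto
    also have "\<dots> = real (Suc (2 * k)) * ?a ^ (2 * k + 2) - - (real (Suc (2 * k)) * ?b ^ (2 * k + 2)) - 2 * (real (Suc (2 * k)) * inverse j ^ (2 * k + 2))"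
      by (simp only: algebra_simps diff_minus_eq_add)
    finally show "\<exists>d. DERIV h y :> d \<and> 0 \<le> d"
      using D by blast
  qed simp
  then show ?thesis by (simp add: h_def)
qed

text \<open>The intervals of length \<open>1\<close> around \<open>l + 1, l + 2, \<dots>\<close> start at \<open>l + 1/2\<close>, and the integrals telescope.\<close>

lemma sum_inverse_even_power_le:
  fixes l m k :: nat
  shows "(\<Sum>j\<in>{l<..l + m}. inverse (real j) ^ (2 * k + 2)) \<le> inverse (real l + 1/2) ^ Suc (2 * k) / real (Suc (2 * k))"
proof -
  let ?p = "\<lambda>i. inverse (real l + real i + 1/2) ^ Suc (2 * k)"
  have "real (Suc (2 * k)) * (\<Sum>j\<in>{l<..l + m}. inverse (real j) ^ (2 * k + 2)) \<le> ?p 0 - ?p m"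
  proof (induction m)
    case (Suc m)
    have set: "{l<..l + Suc m} = insert (l + Suc m) {l<..l + m}" by auto
    have "real (Suc (2 * k)) * inverse (real (l + Suc m)) ^ (2 * k + 2) \<le> ?p m - ?p (Suc m)"
      using inverse_power_midpoint [of "real (l + Suc m)" k] by (simp add: add_ac)
    then show ?case
      using Suc unfolding set by (simp add: distrib_left del: power_Suc of_nat_Suc)
  qed simp
  also have "\<dots> \<le> ?p 0" by simp
  finally show ?thesis
    by (simp add: field_simps del: power_Suc of_nat_Suc)
qed

text \<open>The contribution of one coordinate to the exponent of the factor that multiplies the interpolating
  polynomial.\<close>

definition gauss_exponent :: "nat \<Rightarrow> nat \<Rightarrow> real \<Rightarrow> real" where
  "gauss_exponent N l x = (\<Sum>k=1..N. 1 / (real k * (2 * real k - 1)) * (x ^ (2 * k) / (real l + 1/2) ^ (2 * k - 1)))"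

text \<open>A bound for the terms of order greater than \<open>N\<close> in the expansion of \<open>- ln (sine_tail l x)\<close>: the geometric
  series with ratio \<open>(x / (l + 1/2))\<^sup>2\<close>, with the coefficients \<open>1 / (k (2k - 1))\<close> replaced by \<open>1\<close>.\<close>

definition tail_exponent :: "nat \<Rightarrow> nat \<Rightarrow> real \<Rightarrow> real" where
  "tail_exponent N l x = x ^ (2 * N + 2) / (real l + 1/2) ^ (2 * N + 1) / (1 - (x / (real l + 1/2))\<^sup>2)"

text \<open>Each factor of a partial product is bounded by \<open>exp_neg_log_series_le\<close>, and the resulting sums of inverse
  powers by \<open>sum_inverse_even_power_le\<close>; the bounds do not depend on the length of the product.\<close>

lemma sine_tail_lower_bound:
  assumes x: "\<bar>x\<bar> < real l + 1/2"
  shows "exp (- (gauss_exponent N l x + tail_exponent N l x)) \<le> sine_tail l x"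
proof (rule LIMSEQ_le_const [OF sine_tail_LIMSEQ], intro exI allI impI)
  fix m :: nat assume "0 \<le> m"
  let ?J = "{l<..l + m}" and ?w = "real l + 1/2"
  define y where "y = (x / ?w)\<^sup>2"
  have y: "0 \<le> y" "y < 1"
    using square_ratio_less_1 [OF x] by (auto simp: y_def)
  have u: "0 \<le> (x / real j)\<^sup>2" "(x / real j)\<^sup>2 \<le> y" "(x / real j)\<^sup>2 < 1" if "j \<in> ?J" for j
  proof -
    have "\<bar>x\<bar> / real j \<le> \<bar>x\<bar> / ?w"
      using that by (intro divide_left_mono) auto
    then have "(\<bar>x\<bar> / real j)\<^sup>2 \<le> (\<bar>x\<bar> / ?w)\<^sup>2"
      by (intro power_mono) auto
    then show "(x / real j)\<^sup>2 \<le> y" by (simp add: y_def power_divide)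
    then show "(x / real j)\<^sup>2 < 1" using y by simp
  qed simp
  have pow: "((x / real j)\<^sup>2) ^ k = x ^ (2 * k) * inverse (real j) ^ (2 * k)" for j k
    unfolding power_mult [symmetric] by (simp add: divide_inverse power_mult_distrib)
  have sum1: "(\<Sum>j\<in>?J. ((x / real j)\<^sup>2) ^ k / real k) \<le> 1 / (real k * (2 * real k - 1)) * (x ^ (2 * k) / ?w ^ (2 * k - 1))"
    if k1: "k \<ge> 1" for k
  proof -
    obtain k' where k: "k = Suc k'" using k1 by (cases k) auto
    have "(\<Sum>j\<in>?J. ((x / real j)\<^sup>2) ^ k / real k) = x ^ (2 * k) / real k * (\<Sum>j\<in>?J. inverse (real j) ^ (2 * k' + 2))"
    proof -
      have "2 * k = 2 * k' + 2" using k by simp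
      then show ?thesis
        unfolding pow sum_distrib_left by (simp only: times_divide_eq_left)
    qed
    also have "\<dots> \<le> x ^ (2 * k) / real k * (inverse ?w ^ Suc (2 * k') / real (Suc (2 * k')))"
      by (intro mult_left_mono sum_inverse_even_power_le) auto
    also have "\<dots> = 1 / (real k * (2 * real k - 1)) * (x ^ (2 * k) / ?w ^ (2 * k - 1))"
    proof -
      have "2 * k - 1 = Suc (2 * k')" "2 * real k - 1 = real (Suc (2 * k'))" using k by auto
      then show ?thesis
        by (simp only: divide_inverse power_inverse inverse_mult_distrib mult_1 mult_ac)
    qed
    finally show ?thesis .
  qed
  have sum2: "(\<Sum>j\<in>?J. ((x / real j)\<^sup>2) ^ Suc N / (1 - (x / real j)\<^sup>2)) \<le> tail_exponent N l x"
  proof -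
    have nn: "0 \<le> x ^ (2 * N + 2) / (1 - y)"
      using y by (intro divide_nonneg_nonneg zero_le_even_power) auto
    have "(\<Sum>j\<in>?J. ((x / real j)\<^sup>2) ^ Suc N / (1 - (x / real j)\<^sup>2)) \<le> (\<Sum>j\<in>?J. ((x / real j)\<^sup>2) ^ Suc N / (1 - y))"
      using u y by (intro sum_mono divide_left_mono) auto
    also have "\<dots> = x ^ (2 * N + 2) / (1 - y) * (\<Sum>j\<in>?J. inverse (real j) ^ (2 * N + 2))"
    proof -
      have "2 * Suc N = 2 * N + 2" by simp
      then show ?thesis
        unfolding pow sum_distrib_left by (simp only: times_divide_eq_left)
    qed
    also have "\<dots> \<le> x ^ (2 * N + 2) / (1 - y) * (inverse ?w ^ Suc (2 * N) / real (Suc (2 * N)))"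
      by (intro mult_left_mono sum_inverse_even_power_le nn)
    also have "\<dots> \<le> x ^ (2 * N + 2) / (1 - y) * (inverse ?w ^ Suc (2 * N) / 1)"
      by (intro mult_left_mono divide_left_mono nn) auto
    also have "\<dots> = tail_exponent N l x"
      unfolding tail_exponent_def y_def
      by (simp only: divide_inverse power_inverse Suc_eq_plus1 inverse_1 mult_1_right mult_ac)
    finally show ?thesis .
  qed
  have "(\<Sum>j\<in>?J. (\<Sum>k=1..N. ((x / real j)\<^sup>2) ^ k / real k) + ((x / real j)\<^sup>2) ^ Suc N / (1 - (x / real j)\<^sup>2))
      = (\<Sum>k=1..N. \<Sum>j\<in>?J. ((x / real j)\<^sup>2) ^ k / real k) + (\<Sum>j\<in>?J. ((x / real j)\<^sup>2) ^ Suc N / (1 - (x / real j)\<^sup>2))"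
    by (simp only: sum.distrib sum.swap [of _ "{1..N}"])
  also have "\<dots> \<le> gauss_exponent N l x + tail_exponent N l x"
    unfolding gauss_exponent_def by (intro add_mono sum_mono sum1 sum2) auto
  finally have "exp (- (gauss_exponent N l x + tail_exponent N l x))
      \<le> exp (\<Sum>j\<in>?J. - ((\<Sum>k=1..N. ((x / real j)\<^sup>2) ^ k / real k) + ((x / real j)\<^sup>2) ^ Suc N / (1 - (x / real j)\<^sup>2)))"
    unfolding sum_negf by (simp only: exp_le_cancel_iff neg_le_iff_le)
  also have "\<dots> = (\<Prod>j\<in>?J. exp (- ((\<Sum>k=1..N. ((x / real j)\<^sup>2) ^ k / real k) + ((x / real j)\<^sup>2) ^ Suc N / (1 - (x / real j)\<^sup>2))))"
    by (rule exp_sum) simp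
  also have "\<dots> \<le> (\<Prod>j\<in>?J. 1 - (x / real j)\<^sup>2)"
    by (intro prod_mono conjI exp_neg_log_series_le u) auto
  finally show "exp (- (gauss_exponent N l x + tail_exponent N l x)) \<le> (\<Prod>j\<in>?J. 1 - (x / real j)\<^sup>2)" .
qed

section \<open>Interpolating polynomials\<close>

text \<open>Euler's reflection formula in a form that holds at the integers too.\<close>

lemma sincpi_eq_rGamma: "sincpi z = rGamma (1 + z) * rGamma (1 - z)"
proof (cases "z = 0")
  case True
  then show ?thesis by (simp add: sincpi_def)
next
  case False
  have "complex_of_real (rGamma z * rGamma (1 - z)) = rGamma (of_real z) * rGamma (1 - of_real z)"
    using rGamma_complex_of_real [of z] rGamma_complex_of_real [of "1 - z"] by simp
  also have "\<dots> = complex_of_real (sin (pi * z) / pi)"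
    by (simp add: rGamma_reflection_complex sin_of_real [symmetric])
  finally have "rGamma z * rGamma (1 - z) = sin (pi * z) / pi"
    by (simp only: of_real_eq_iff)
  moreover have "rGamma z = z * rGamma (1 + z)"
    using rGamma_plus1 [of z] by (simp add: add.commute)
  ultimately have "z * (rGamma (1 + z) * rGamma (1 - z)) = sin (pi * z) / pi"
    by simp
  then show ?thesis
    using False by (simp add: sincpi_def field_simps)
qed

text \<open>The polynomial of degree \<open>2l\<close> that remains when \<open>sine_tail l\<close> is divided out of the cardinal sine centred
  at \<open>k\<close>. It is a product of two Pochhammer symbols, which come from shifting both factors \<open>1/\<Gamma>\<close>.\<close>

definition node_poly :: "nat \<Rightarrow> int \<Rightarrow> real poly" where
  "node_poly l k = smult (1 / (fact l)\<^sup>2)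
     ((\<Prod>i<nat (int l + k). [:1 - of_int k + of_nat i, 1:]) * (\<Prod>i<nat (int l - k). [:1 + of_int k + of_nat i, - 1:]))"

lemma poly_node_poly:
  "poly (node_poly l k) x = pochhammer (1 - of_int k + x) (nat (int l + k)) * pochhammer (1 + of_int k - x) (nat (int l - k)) / (fact l)\<^sup>2"
  unfolding node_poly_def poly_smult poly_mult poly_prod pochhammer_prod atLeast0LessThan
  by (simp add: algebra_simps)

lemma degree_node_poly:
  assumes "- int l \<le> k" "k \<le> int l"
  shows "degree (node_poly l k) \<le> 2 * l"
proof -
  have deg: "degree (\<Prod>i<m. [:a i, b:]) \<le> m" for a :: "nat \<Rightarrow> real" and b m
  proof -
    have "degree (\<Prod>i<m. [:a i, b:]) \<le> sum (degree \<circ> (\<lambda>i. [:a i, b:])) {..<m}"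
      by (rule degree_prod_sum_le) simp
    also have "\<dots> \<le> (\<Sum>i<m. 1)"
      by (intro sum_mono) simp
    finally show ?thesis by simp
  qed
  have "degree (node_poly l k) \<le> nat (int l + k) + nat (int l - k)"
    unfolding node_poly_def
    by (intro order_trans [OF degree_smult_le] order_trans [OF degree_mult_le] add_mono deg)
  also have "\<dots> = 2 * l" using assms by linarith
  finally show ?thesis .
qed

lemma sincpi_eq_sine_tail_node_poly:
  assumes "- int l \<le> k" "k \<le> int l"
  shows "sincpi (of_int k - x) = sine_tail l x * poly (node_poly l k) x"
proof -
  have "rGamma (1 + (of_int k - x)) = pochhammer (1 + of_int k - x) (nat (int l - k)) * rGamma (1 + real l - x)"
    using pochhammer_rGamma [of "1 + of_int k - x" "nat (int l - k)"] assms by (simp add: algebra_simps)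
  moreover have "rGamma (1 - (of_int k - x)) = pochhammer (1 - of_int k + x) (nat (int l + k)) * rGamma (1 + real l + x)"
    using pochhammer_rGamma [of "1 - of_int k + x" "nat (int l + k)"] assms by (simp add: algebra_simps)
  ultimately show ?thesis
    unfolding sincpi_eq_rGamma poly_node_poly sine_tail_def by simp
qed

text \<open>Inside \<open>(-l-1, l+1)\<close> all factors of the product lie in \<open>[0, 1]\<close>. Outside, the polynomial factor of
  the cardinal sine centred at \<open>0\<close> has absolute value at least \<open>1\<close>, so the tail is dominated by the cardinal
  sine. The bound is needed on the whole line because the nodes are not confined to the cube of size \<open>l\<close>.\<close>

lemma abs_sine_tail_le_1: "\<bar>sine_tail l x\<bar> \<le> 1"
proof -
  have pos: "\<bar>sine_tail l x\<bar> \<le> 1" if "x \<ge> 0" for x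
  proof (cases "x < real l + 1")
    case True
    have "0 \<le> (\<Prod>j\<in>{l<..l + m}. 1 - (x / real j)\<^sup>2)" for m
    proof (rule prod_nonneg)
      fix j assume "j \<in> {l<..l + m}"
      then show "0 \<le> 1 - (x / real j)\<^sup>2"
        using True \<open>x \<ge> 0\<close> square_ratio_less_1 [of x "real j"] by simp
    qed
    then have "0 \<le> sine_tail l x"
      by (intro LIMSEQ_le_const [OF sine_tail_LIMSEQ]) auto
    then show ?thesis using sine_tail_le_1 [of x l] True \<open>x \<ge> 0\<close> by simp
  next
    case False
    have "fact l \<le> pochhammer (1 + x) l"
      unfolding pochhammer_fact pochhammer_prod using \<open>x \<ge> 0\<close> by (intro prod_mono) auto
    moreover have "fact l \<le> \<bar>pochhammer (1 - x) l\<bar>"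
    proof -
      have "(fact l :: real) = (\<Prod>i\<in>{0..<l}. real (l - i))"
        using fact_prod_rev [of l] by (metis of_nat_fact of_nat_prod)
      also have "\<dots> \<le> (\<Prod>i\<in>{0..<l}. \<bar>1 - x + real i\<bar>)"
        using False by (intro prod_mono) (auto simp: of_nat_diff)
      finally show ?thesis by (simp add: pochhammer_prod abs_prod)
    qed
    ultimately have "fact l * fact l \<le> pochhammer (1 + x) l * \<bar>pochhammer (1 - x) l\<bar>"
      using \<open>x \<ge> 0\<close> by (intro mult_mono pochhammer_nonneg) auto
    then have "1 \<le> \<bar>poly (node_poly l 0) x\<bar>"
      using \<open>x \<ge> 0\<close> pochhammer_nonneg [of "1 + x" l]
      by (simp add: poly_node_poly abs_mult power2_eq_square)
    then have "\<bar>sine_tail l x\<bar> * 1 \<le> \<bar>sine_tail l x\<bar> * \<bar>poly (node_poly l 0) x\<bar>"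
      by (intro mult_left_mono) auto
    also have "\<dots> = \<bar>sincpi (of_int 0 - x)\<bar>"
      by (subst sincpi_eq_sine_tail_node_poly [of l]) (auto simp: abs_mult)
    also have "\<dots> \<le> 1" by (rule sincpi_le_1)
    finally show ?thesis by simp
  qed
  show ?thesis
    using pos [of x] pos [of "- x"] by (cases "x \<ge> 0") (auto simp: sine_tail_minus)
qed

lemma node_poly_dual:
  assumes "- int l \<le> k" "k \<le> int l"
  shows "sine_tail l (of_int m) * poly (node_poly l k) (of_int m) = (if k = m then 1 else 0)"
  using sincpi_eq_sine_tail_node_poly [OF assms, of "of_int m"] sincpi_of_int [of "k - m"] by simp

text \<open>At the integers \<open>-l, \<dots>, l\<close> the node polynomials are dual to point evaluations up to the factors
  \<open>sine_tail l k\<close>, and a polynomial of degree at most \<open>2l\<close> is determined by its values there.\<close>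

lemma lagrange_interpolation:
  fixes p :: "real poly"
  assumes "degree p \<le> 2 * l"
  shows "poly p x = (\<Sum>k\<in>{- int l..int l}. poly p (of_int k) * sine_tail l (of_int k) * poly (node_poly l k) x)"
proof -
  define q where "q = (\<Sum>k\<in>{- int l..int l}. smult (poly p (of_int k) * sine_tail l (of_int k)) (node_poly l k))"
  have "p = q"
  proof (rule poly_eqI_degree [of "of_int ` {- int l..int l}"])
    fix y :: real assume "y \<in> of_int ` {- int l..int l}"
    then obtain m where m: "m \<in> {- int l..int l}" "y = of_int m" by auto
    have nz: "sine_tail l (of_int m) \<noteq> 0"
      using node_poly_dual [of l m m] m by auto
    have "poly p (of_int k) * sine_tail l (of_int k) * poly (node_poly l k) (of_int m) = (if k = m then poly p (of_int m) else 0)"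
      if "k \<in> {- int l..int l}" for k
      using node_poly_dual [of l k m] that nz by (auto simp: mult.assoc split: if_splits)
    then show "poly p y = poly q y"
      using m by (simp add: q_def poly_sum)
  next
    have c: "card (real_of_int ` {- int l..int l}) = 2 * l + 1"
      by (subst card_image) (auto simp: inj_on_def)
    show "degree p < card (real_of_int ` {- int l..int l})"
      using assms by (simp add: c)
    have "degree q \<le> 2 * l"
      unfolding q_def by (intro degree_sum_le order_trans [OF degree_smult_le] degree_node_poly) auto
    then show "degree q < card (real_of_int ` {- int l..int l})"
      by (simp add: c)
  qed
  then show ?thesis
    by (metis (no_types, lifting) q_def poly_sum poly_smult sum.cong)
qed

lemma prod_sum_vec:
  fixes f :: "'d::finite \<Rightarrow> 'b \<Rightarrow> 'a::comm_semiring_1"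
  assumes "finite S"
  shows "(\<Prod>i\<in>UNIV. \<Sum>j\<in>S. f i j) = (\<Sum>m\<in>{m. \<forall>i. m $ i \<in> S}. \<Prod>i\<in>UNIV. f i (m $ i))"
proof -
  have "(\<Prod>i\<in>UNIV. \<Sum>j\<in>S. f i j) = (\<Sum>g\<in>Pi\<^sub>E UNIV (\<lambda>_. S). \<Prod>i\<in>UNIV. f i (g i))"
    using assms by (intro prod_sum_PiE) auto
  also have "\<dots> = (\<Sum>m\<in>{m. \<forall>i. m $ i \<in> S}. \<Prod>i\<in>UNIV. f i (m $ i))"
    by (rule sum.reindex_bij_witness [of _ vec_nth vec_lambda]) auto
  finally show ?thesis .
qed

definition node_sum :: "nat \<Rightarrow> (int^'d \<Rightarrow> complex) \<Rightarrow> real^'d \<Rightarrow> complex" where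
  "node_sum l c s = (\<Sum>n\<in>index_cube l. c n * of_real (\<Prod>i\<in>UNIV. poly (node_poly l (n $ i)) (s $ i)))"

definition sine_tail_prod :: "nat \<Rightarrow> real^'d \<Rightarrow> real" where
  "sine_tail_prod l s = (\<Prod>i\<in>UNIV. sine_tail l (s $ i))"

lemma index_cube_eq: "index_cube l = {n. \<forall>i. n $ i \<in> {- int l..int l}}"
  by (auto simp: index_cube_def)

text \<open>The bridge between the two sides: transforms of trigonometric polynomials are \<open>sine_tail_prod l\<close> times
  polynomials, with the same coefficients.\<close>

lemma cube_fourier_eq_node_sum:
  "cube_fourier (trig_poly l c) s = of_real (sine_tail_prod l s) * node_sum l c s"
proof -
  have "(\<Prod>i\<in>UNIV. sincpi (real_of_int (n $ i) - s $ i)) = sine_tail_prod l s * (\<Prod>i\<in>UNIV. poly (node_poly l (n $ i)) (s $ i))"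
    if "n \<in> index_cube l" for n
    unfolding sine_tail_prod_def prod.distrib [symmetric]
    by (intro prod.cong refl sincpi_eq_sine_tail_node_poly) (use that in \<open>auto simp: index_cube_def\<close>)
  then show ?thesis
    unfolding cube_fourier_trig_poly node_sum_def sum_distrib_left
    by (intro sum.cong refl) (simp add: mult_ac)
qed

lemma poly_eq_sum_upto:
  fixes p :: "real poly"
  assumes "degree p \<le> K"
  shows "poly p x = (\<Sum>j\<in>{..K}. coeff p j * x ^ j)"
  unfolding poly_altdef
  by (rule sum.mono_neutral_left) (use assms in \<open>auto simp: coeff_eq_0\<close>)

lemma coord_degree_node_sum:
  fixes c :: "int^'d \<Rightarrow> complex"
  shows "coord_degree_le (2 * l) (node_sum l c)"
proof -
  let ?M = "{m::nat^'d. \<forall>i. m $ i \<le> 2 * l}"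
  define a where "a n m = (\<Prod>i\<in>UNIV. coeff (node_poly l (n $ i)) (m $ i))" for n :: "int^'d" and m :: "nat^'d"
  have expand: "(\<Prod>i\<in>UNIV. poly (node_poly l (n $ i)) (s $ i)) = (\<Sum>m\<in>?M. a n m * (\<Prod>i\<in>UNIV. (s $ i) ^ (m $ i)))"
    if n: "n \<in> index_cube l" for n and s :: "real^'d"
  proof -
    have "(\<Prod>i\<in>UNIV. poly (node_poly l (n $ i)) (s $ i)) = (\<Prod>i\<in>UNIV. \<Sum>j\<in>{..2*l}. coeff (node_poly l (n $ i)) j * (s $ i) ^ j)"
      using n by (intro prod.cong refl poly_eq_sum_upto degree_node_poly) (auto simp: index_cube_def)
    also have "\<dots> = (\<Sum>m\<in>?M. a n m * (\<Prod>i\<in>UNIV. (s $ i) ^ (m $ i)))"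
      by (subst prod_sum_vec) (auto simp: prod.distrib a_def)
    finally show ?thesis .
  qed
  have "node_sum l c s = (\<Sum>m\<in>?M. (\<Sum>n\<in>index_cube l. c n * of_real (a n m)) * of_real (\<Prod>i\<in>UNIV. (s $ i) ^ (m $ i)))" for s
  proof -
    have "node_sum l c s = (\<Sum>n\<in>index_cube l. \<Sum>m\<in>?M. c n * of_real (a n m) * of_real (\<Prod>i\<in>UNIV. (s $ i) ^ (m $ i)))"
      unfolding node_sum_def by (intro sum.cong refl) (simp only: expand of_real_sum of_real_mult sum_distrib_left mult.assoc)
    also have "\<dots> = (\<Sum>m\<in>?M. \<Sum>n\<in>index_cube l. c n * of_real (a n m) * of_real (\<Prod>i\<in>UNIV. (s $ i) ^ (m $ i)))"
      by (rule sum.swap)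
    finally show ?thesis by (simp only: sum_distrib_right)
  qed
  then show ?thesis
    unfolding coord_degree_le_def by (intro exI ext)
qed

text \<open>Each power of a single variable is a combination of node polynomials by Lagrange interpolation, and
  monomials in several variables are products of such powers.\<close>

lemma coord_degree_imp_node_sum:
  fixes p :: "real^'d \<Rightarrow> complex"
  assumes "coord_degree_le (2 * l) p"
  obtains c where "p = node_sum l c"
proof -
  let ?M = "{m::nat^'d. \<forall>i. m $ i \<le> 2 * l}"
  obtain c where p: "p = (\<lambda>s. \<Sum>m\<in>?M. c m * of_real (\<Prod>i\<in>UNIV. (s $ i) ^ (m $ i)))"
    using assms by (auto simp: coord_degree_le_def)
  \<comment> \<open>The Lagrange coefficients of the monomial of degree \<open>j\<close>.\<close>
  define w where "w j k = poly (monom 1 j) (real_of_int k) * sine_tail l (of_int k)" for j k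
  define b where "b m n = (\<Prod>i\<in>UNIV. w (m $ i) (n $ i))" for m :: "nat^'d" and n :: "int^'d"
  have expand: "(\<Prod>i\<in>UNIV. (s $ i) ^ (m $ i)) = (\<Sum>n\<in>index_cube l. b m n * (\<Prod>i\<in>UNIV. poly (node_poly l (n $ i)) (s $ i)))"
    if m: "m \<in> ?M" for m and s :: "real^'d"
  proof -
    have "(\<Prod>i\<in>UNIV. (s $ i) ^ (m $ i)) = (\<Prod>i\<in>UNIV. \<Sum>k\<in>{- int l..int l}. w (m $ i) k * poly (node_poly l k) (s $ i))"
    proof (intro prod.cong refl)
      fix i
      show "(s $ i) ^ (m $ i) = (\<Sum>k\<in>{- int l..int l}. w (m $ i) k * poly (node_poly l k) (s $ i))"
        using lagrange_interpolation [of "monom 1 (m $ i)" l "s $ i"] m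
        by (simp add: w_def poly_monom degree_monom_eq)
    qed
    also have "\<dots> = (\<Sum>n\<in>index_cube l. b m n * (\<Prod>i\<in>UNIV. poly (node_poly l (n $ i)) (s $ i)))"
      by (subst prod_sum_vec) (auto simp: prod.distrib b_def index_cube_eq)
    finally show ?thesis .
  qed
  have "p s = node_sum l (\<lambda>n. \<Sum>m\<in>?M. c m * of_real (b m n)) s" for s
  proof -
    have "p s = (\<Sum>m\<in>?M. \<Sum>n\<in>index_cube l. c m * of_real (b m n) * of_real (\<Prod>i\<in>UNIV. poly (node_poly l (n $ i)) (s $ i)))"
      unfolding p by (intro sum.cong refl) (simp only: expand of_real_sum of_real_mult sum_distrib_left mult.assoc)
    also have "\<dots> = (\<Sum>n\<in>index_cube l. \<Sum>m\<in>?M. c m * of_real (b m n) * of_real (\<Prod>i\<in>UNIV. poly (node_poly l (n $ i)) (s $ i)))"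
      by (rule sum.swap)
    finally show ?thesis by (simp only: node_sum_def sum_distrib_right)
  qed
  then show thesis using that by blast
qed

lemma continuous_on_node_sum: "continuous_on S (node_sum l c)"
  unfolding node_sum_def [abs_def] by (intro continuous_intros)

lemma abs_sine_tail_prod_le_1: "\<bar>sine_tail_prod l s\<bar> \<le> 1"
  unfolding sine_tail_prod_def abs_prod by (intro prod_le_1) (auto simp: abs_sine_tail_le_1)

lemma sine_tail_prod_tendsto_1:
  fixes s :: "real^'d"
  shows "(\<lambda>l. sine_tail_prod l s) \<longlonglongrightarrow> 1"
proof -
  have "(\<lambda>l. sine_tail_prod l s) \<longlonglongrightarrow> (\<Prod>i\<in>(UNIV::'d set). 1)"
    unfolding sine_tail_prod_def by (intro tendsto_prod sine_tail_tendsto_1)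
  then show ?thesis by simp
qed

text \<open>Dominated convergence for sums over growing index cubes. Outside a large fixed cube the sum of the \<open>a n\<close> is
  small, and inside it only finitely many weights are involved.\<close>

lemma dominated_weighted_sum_tendsto_0:
  fixes a :: "int^'d \<Rightarrow> real"
  assumes a: "\<And>n. 0 \<le> a n" and bound: "\<And>l. (\<Sum>n\<in>index_cube l. a n) \<le> S"
    and w: "\<And>l n. 0 \<le> w l n" "\<And>l n. w l n \<le> W" and lim: "\<And>n. (\<lambda>l. w l n) \<longlonglongrightarrow> 0"
  shows "(\<lambda>l. \<Sum>n\<in>index_cube l. w l n * a n) \<longlonglongrightarrow> 0"
proof (rule LIMSEQ_I)
  fix e :: real assume "e > 0"
  have "W \<ge> 0" using w order_trans by blast
  define \<sigma> where "\<sigma> l = (\<Sum>n\<in>(index_cube l :: (int^'d) set). a n)" for l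
  have mono: "\<sigma> k \<le> \<sigma> l" if "k \<le> l" for k l
    unfolding \<sigma>_def using index_cube_mono [OF that] a by (intro sum_mono2) auto
  have "Bseq \<sigma>"
    using bound by (intro BseqI' [of _ S]) (simp add: \<sigma>_def a sum_nonneg)
  then have "convergent \<sigma>"
    using mono by (intro Bseq_mono_convergent) auto
  then have "Cauchy \<sigma>" by (rule convergent_Cauchy)
  moreover have "e / (2 * (W + 1)) > 0" using \<open>e > 0\<close> \<open>W \<ge> 0\<close> by simp
  ultimately obtain k where k: "\<And>l. l \<ge> k \<Longrightarrow> \<bar>\<sigma> l - \<sigma> k\<bar> < e / (2 * (W + 1))"
    unfolding Cauchy_def dist_real_def by (metis order_refl)
  have "(\<lambda>l. \<Sum>n\<in>index_cube k. w l n * a n) \<longlonglongrightarrow> (\<Sum>n\<in>index_cube k. 0 * a n)"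
    by (intro tendsto_intros lim)
  then have "\<forall>\<^sub>F l in sequentially. (\<Sum>n\<in>index_cube k. w l n * a n) < e/2"
    using \<open>e > 0\<close> by (intro order_tendstoD) auto
  then obtain k' where k': "\<And>l. l \<ge> k' \<Longrightarrow> (\<Sum>n\<in>index_cube k. w l n * a n) < e/2"
    by (auto simp: eventually_sequentially)
  have "norm ((\<Sum>n\<in>index_cube l. w l n * a n) - 0) < e" if l: "l \<ge> max k k'" for l
  proof -
    have sub: "index_cube k \<subseteq> (index_cube l :: (int^'d) set)" using l by (intro index_cube_mono) simp
    have "(\<Sum>n\<in>index_cube l. w l n * a n) = (\<Sum>n\<in>index_cube l - index_cube k. w l n * a n) + (\<Sum>n\<in>index_cube k. w l n * a n)"
      by (rule sum.subset_diff [OF sub]) simp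
    also have "(\<Sum>n\<in>index_cube l - index_cube k. w l n * a n) \<le> (\<Sum>n\<in>index_cube l - index_cube k. W * a n)"
      by (intro sum_mono mult_right_mono w a)
    also have "\<dots> = W * (\<sigma> l - \<sigma> k)"
      unfolding \<sigma>_def sum_distrib_left [symmetric] using sub by (simp add: sum_diff)
    also have "\<dots> \<le> W * (e / (2 * (W + 1)))"
      using k [of l] l \<open>W \<ge> 0\<close> by (intro mult_left_mono) auto
    also have "\<dots> \<le> e/2"
      using \<open>W \<ge> 0\<close> \<open>e > 0\<close> by (simp add: field_simps)
    finally have "(\<Sum>n\<in>index_cube l. w l n * a n) < e"
      using k' [of l] l by simp
    moreover have "0 \<le> (\<Sum>n\<in>index_cube l. w l n * a n)"
      by (intro sum_nonneg mult_nonneg_nonneg w a)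
    ultimately show ?thesis by simp
  qed
  then show "\<exists>no. \<forall>l\<ge>no. norm ((\<Sum>n\<in>index_cube l. w l n * a n) - 0) < e" by blast
qed

context section_system
begin

text \<open>If the factor vanished at a node, all transforms of trigonometric polynomials would vanish there, but their
  values can be prescribed.\<close>

lemma sine_tail_prod_node_nonzero:
  assumes "l \<ge> 1" "n \<in> index_cube l" shows "sine_tail_prod l (t n) \<noteq> 0"
proof
  assume "sine_tail_prod l (t n) = 0"
  then have "cube_fourier (trig_poly l c) (t n) = 0" for c
    by (simp add: cube_fourier_eq_node_sum)
  moreover have "\<exists>c. cube_fourier (trig_poly l c) (t n) = 1"
    using node_samples_surj [OF assms(1), of "\<lambda>_. 1"] assms(2) by auto
  ultimately show False by simp
qed

text \<open>A polynomial with the values \<open>f (t n)\<close> corresponds to a trigonometric polynomial whose transform has the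
  values \<open>sine_tail_prod l (t n) * f (t n)\<close>, so uniqueness of the interpolating polynomial is the injectivity of
  sampling at the nodes.\<close>

lemma interp_poly_eq_node_sum:
  assumes l: "l \<ge> 1"
    and c: "\<And>n. n \<in> index_cube l \<Longrightarrow> cube_fourier (trig_poly l c) (t n) = of_real (sine_tail_prod l (t n)) * f (t n)"
  shows "interp_poly t f l = node_sum l c"
  unfolding interp_poly_def
proof (rule the_equality)
  have "node_sum l c (t n) = f (t n)" if n: "n \<in> index_cube l" for n
    using c [OF n] sine_tail_prod_node_nonzero [OF l n] by (simp add: cube_fourier_eq_node_sum)
  then show "coord_degree_le (2 * l) (node_sum l c) \<and> (\<forall>n\<in>index_cube l. node_sum l c (t n) = f (t n))"
    by (simp add: coord_degree_node_sum)
next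
  fix p assume p: "coord_degree_le (2 * l) p \<and> (\<forall>n\<in>index_cube l. p (t n) = f (t n))"
  then obtain c' where c': "p = node_sum l c'" using coord_degree_imp_node_sum by blast
  have eq: "cube_fourier (trig_poly l (\<lambda>n. c' n - c n)) s
      = cube_fourier (trig_poly l c') s - cube_fourier (trig_poly l c) s" for s
    unfolding trig_poly_diff [abs_def, symmetric] by (rule cube_fourier_diff) auto
  have "c' n - c n = 0" if "n \<in> index_cube l" for n
  proof (rule node_samples_inj [OF l _ that])
    fix m :: "int^'d" assume m: "m \<in> index_cube l"
    show "cube_fourier (trig_poly l (\<lambda>n. c' n - c n)) (t m) = 0"
      unfolding eq c [OF m] using p m c' by (simp add: cube_fourier_eq_node_sum)
  qed
  then show "p = node_sum l c"
    unfolding c' node_sum_def [abs_def] by (intro ext sum.cong) auto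
qed

text \<open>The trigonometric polynomial belonging to the interpolating polynomial is compared with the Fourier partial
  sum of \<open>F\<close> through their values at the nodes.\<close>

lemma interpolants_converge:
  assumes F: "F \<in> L2 cube_pi"
  obtains c where "\<And>l. l \<ge> 1 \<Longrightarrow> interp_poly t (cube_fourier F) l = node_sum l (c l)"
    and "(\<lambda>l. l2norm cube_pi (\<lambda>x. F x - trig_poly l (c l) x)) \<longlonglongrightarrow> 0"
proof -
  let ?f = "cube_fourier F" and ?P = "\<lambda>l. trig_poly l (fourier_coeff F)"
  define c where "c l = (SOME c. \<forall>n\<in>index_cube l. cube_fourier (trig_poly l c) (t n) = of_real (sine_tail_prod l (t n)) * ?f (t n))" for l
  have c: "cube_fourier (trig_poly l (c l)) (t n) = of_real (sine_tail_prod l (t n)) * ?f (t n)"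
    if l: "l \<ge> 1" and n: "n \<in> index_cube l" for l n
    using someI_ex [OF node_samples_surj [OF l, of "\<lambda>n. of_real (sine_tail_prod l (t n)) * ?f (t n)"], folded c_def] n
    by (rule bspec)
  define \<rho> where "\<rho> l = l2norm cube_pi (\<lambda>x. F x - ?P l x)" for l
  have \<rho>: "\<rho> \<longlonglongrightarrow> 0" unfolding \<rho>_def by (rule fourier_partial_sums_converge [OF F])
  \<comment> \<open>The squared \<open>\<ell>\<^sub>2\<close> norm of the perturbation of the data by the factors \<open>sine_tail_prod l (t n)\<close>.\<close>
  define \<eta> where "\<eta> l = (\<Sum>n\<in>index_cube l. (1 - sine_tail_prod l (t n))\<^sup>2 * (cmod (?f (t n)))\<^sup>2)" for l
  have "\<eta> \<longlonglongrightarrow> 0"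
    unfolding \<eta>_def
  proof (rule dominated_weighted_sum_tendsto_0)
    show "(\<Sum>n\<in>index_cube l. (cmod (?f (t n)))\<^sup>2) \<le> (B * l2norm cube_pi F)\<^sup>2" for l
      by (rule node_samples_bessel [OF F])
    show "(1 - sine_tail_prod l (t n))\<^sup>2 \<le> 2\<^sup>2" for l n
      unfolding abs_le_square_iff [symmetric] using abs_sine_tail_prod_le_1 [of l "t n"] by simp
    have "(\<lambda>l. (1 - sine_tail_prod l (t n))\<^sup>2) \<longlonglongrightarrow> (1 - 1)\<^sup>2" for n
      by (intro tendsto_intros sine_tail_prod_tendsto_1)
    then show "(\<lambda>l. (1 - sine_tail_prod l (t n))\<^sup>2) \<longlonglongrightarrow> 0" for n by simp
  qed auto
  then have "(\<lambda>l. \<rho> l + C * (sqrt (\<eta> l) + B * \<rho> l)) \<longlonglongrightarrow> 0 + C * (sqrt 0 + B * 0)"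
    by (intro tendsto_intros \<rho>)
  then have lim: "(\<lambda>l. \<rho> l + C * (sqrt (\<eta> l) + B * \<rho> l)) \<longlonglongrightarrow> 0" by simp
  have est: "l2norm cube_pi (\<lambda>x. F x - trig_poly l (c l) x) \<le> \<rho> l + C * (sqrt (\<eta> l) + B * \<rho> l)" if l: "l \<ge> 1" for l
  proof -
    define d where "d n = fourier_coeff F n - c l n" for n
    have FP: "(\<lambda>x. F x - ?P l x) \<in> L2 cube_pi" by (intro L2_diff F trig_poly_L2)
    have d: "cube_fourier (trig_poly l d) (t n) = of_real (1 - sine_tail_prod l (t n)) * ?f (t n) + - cube_fourier (\<lambda>x. F x - ?P l x) (t n)"
      if n: "n \<in> index_cube l" for n
    proof -
      have "cube_fourier (trig_poly l d) (t n) = cube_fourier (?P l) (t n) - cube_fourier (trig_poly l (c l)) (t n)"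
        unfolding d_def trig_poly_diff [abs_def, symmetric] by (rule cube_fourier_diff) auto
      then show ?thesis
        by (simp add: c [OF l n] cube_fourier_diff F algebra_simps)
    qed
    have "sqrt (\<Sum>n\<in>index_cube l. (cmod (cube_fourier (trig_poly l d) (t n)))\<^sup>2)
        \<le> sqrt (\<Sum>n\<in>index_cube l. (cmod (of_real (1 - sine_tail_prod l (t n)) * ?f (t n)) + cmod (cube_fourier (\<lambda>x. F x - ?P l x) (t n)))\<^sup>2)"
    proof (intro real_sqrt_le_mono sum_mono power_mono norm_ge_zero)
      fix n :: "int^'d" assume n: "n \<in> index_cube l"
      show "cmod (cube_fourier (trig_poly l d) (t n)) \<le> cmod (of_real (1 - sine_tail_prod l (t n)) * ?f (t n)) + cmod (cube_fourier (\<lambda>x. F x - ?P l x) (t n))"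
        unfolding d [OF n] by (rule order_trans [OF norm_triangle_ineq]) simp
    qed
    also have "\<dots> \<le> sqrt (\<Sum>n\<in>index_cube l. (cmod (of_real (1 - sine_tail_prod l (t n)) * ?f (t n)))\<^sup>2) + sqrt (\<Sum>n\<in>index_cube l. (cmod (cube_fourier (\<lambda>x. F x - ?P l x) (t n)))\<^sup>2)"
      using L2_set_triangle_ineq by (simp add: L2_set_def)
    also have "(\<Sum>n\<in>index_cube l. (cmod (of_real (1 - sine_tail_prod l (t n)) * ?f (t n)))\<^sup>2) = \<eta> l"
      unfolding \<eta>_def norm_mult norm_of_real power_mult_distrib power2_abs ..
    also have "sqrt (\<Sum>n\<in>index_cube l. (cmod (cube_fourier (\<lambda>x. F x - ?P l x) (t n)))\<^sup>2) \<le> sqrt ((B * \<rho> l)\<^sup>2)"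
      unfolding \<rho>_def by (intro real_sqrt_le_mono node_samples_bessel FP)
    also have "sqrt ((B * \<rho> l)\<^sup>2) = B * \<rho> l"
      using nonneg by (simp add: \<rho>_def)
    finally have "C * sqrt (\<Sum>n\<in>index_cube l. (cmod (cube_fourier (trig_poly l d) (t n)))\<^sup>2) \<le> C * (sqrt (\<eta> l) + B * \<rho> l)"
      using nonneg by (intro mult_left_mono) auto
    with node_samples_stable [OF l, of d]
    have "l2norm cube_pi (trig_poly l d) \<le> C * (sqrt (\<eta> l) + B * \<rho> l)" by linarith
    moreover have "trig_poly l d = (\<lambda>x. ?P l x - trig_poly l (c l) x)"
      by (simp add: d_def [abs_def] trig_poly_diff)
    moreover have "l2norm cube_pi (\<lambda>x. F x - trig_poly l (c l) x) \<le> \<rho> l + l2norm cube_pi (\<lambda>x. ?P l x - trig_poly l (c l) x)"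
      unfolding \<rho>_def by (intro l2norm_triangle_diff F trig_poly_L2)
    ultimately show ?thesis by simp
  qed
  show thesis
  proof
    show "interp_poly t ?f l = node_sum l (c l)" if "l \<ge> 1" for l
      by (rule interp_poly_eq_node_sum [OF that c [OF that]])
    show "(\<lambda>l. l2norm cube_pi (\<lambda>x. F x - trig_poly l (c l) x)) \<longlonglongrightarrow> 0"
      by (rule tendsto_sandwich [OF _ _ tendsto_const lim])
         (auto simp: eventually_sequentially intro!: exI [of _ 1] est)
  qed
qed

end

section \<open>Convergence on growing cubes\<close>

text \<open>The quotient of the explicit factor in \<open>interpolant\<close> by the product of sine tails; the interpolant is this
  times the transform of a trigonometric polynomial.\<close>

definition correction :: "nat \<Rightarrow> nat \<Rightarrow> real^'d \<Rightarrow> real" where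
  "correction N l s = exp (- (\<Sum>i\<in>UNIV. gauss_exponent N l (s $ i))) / sine_tail_prod l s"

lemma interpolant_eq:
  assumes "interp_poly t f l = node_sum l c" and "sine_tail_prod l s \<noteq> 0"
  shows "interpolant N t f l s = cube_fourier (trig_poly l c) s * of_real (correction N l s)"
proof -
  have "(\<Sum>k=1..N. 1 / (real k * (2 * real k - 1)) * ((\<Sum>i\<in>UNIV. (s $ i) ^ (2 * k)) / (real l + 1 / 2) ^ (2 * k - 1)))
      = (\<Sum>i\<in>UNIV. gauss_exponent N l (s $ i))"
    unfolding gauss_exponent_def sum_divide_distrib sum_distrib_left by (rule sum.swap)
  then show ?thesis
    unfolding interpolant_def assms(1) cube_fourier_eq_node_sum correction_def using assms(2) by simp
qed

lemma continuous_on_interpolant: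
  assumes "interp_poly t f l = node_sum l c"
  shows "continuous_on S (interpolant N t f l)"
  unfolding interpolant_def [abs_def] assms by (intro continuous_intros continuous_on_node_sum) auto

lemma sine_tail_pos: "\<bar>x\<bar> < real l + 1/2 \<Longrightarrow> 0 < sine_tail l x"
  using sine_tail_lower_bound [of x l 0] by (meson exp_gt_zero less_le_trans)

lemma sine_tail_prod_pos:
  assumes "\<And>i. \<bar>s $ i\<bar> < real l + 1/2" shows "0 < sine_tail_prod l s"
  unfolding sine_tail_prod_def by (intro prod_pos sine_tail_pos assms)

lemma correction_le:
  assumes "\<And>i. \<bar>s $ i\<bar> < real l + 1/2"
  shows "correction N l s \<le> exp (\<Sum>i\<in>UNIV. tail_exponent N l (s $ i))"
proof -
  have "exp (- (\<Sum>i\<in>UNIV. gauss_exponent N l (s $ i)) - (\<Sum>i\<in>UNIV. tail_exponent N l (s $ i)))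
      = exp (\<Sum>i\<in>UNIV. - (gauss_exponent N l (s $ i) + tail_exponent N l (s $ i)))"
    by (simp add: sum_subtractf sum_negf)
  also have "\<dots> = (\<Prod>i\<in>UNIV. exp (- (gauss_exponent N l (s $ i) + tail_exponent N l (s $ i))))"
    by (rule exp_sum) simp
  also have "\<dots> \<le> sine_tail_prod l s"
    unfolding sine_tail_prod_def by (intro prod_mono conjI sine_tail_lower_bound assms) auto
  finally have "exp (- (\<Sum>i\<in>UNIV. gauss_exponent N l (s $ i))) \<le> exp (\<Sum>i\<in>UNIV. tail_exponent N l (s $ i)) * sine_tail_prod l s"
    by (simp add: exp_diff divide_le_eq mult.commute)
  then show ?thesis
    using sine_tail_prod_pos [OF assms] by (simp add: correction_def divide_le_eq)
qed

lemma correction_ge: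
  assumes "\<And>i. \<bar>s $ i\<bar> < real l + 1/2"
  shows "exp (- (\<Sum>i\<in>UNIV. gauss_exponent N l (s $ i))) \<le> correction N l s"
  using sine_tail_prod_pos [OF assms] abs_sine_tail_prod_le_1 [of l s]
  by (simp add: correction_def le_divide_eq mult_left_le)

lemma gauss_exponent_mono:
  assumes "\<bar>x\<bar> \<le> R" shows "gauss_exponent N l x \<le> gauss_exponent N l R"
proof -
  have "x ^ (2 * k) \<le> R ^ (2 * k)" for k
    using power_mono [OF assms, of "2 * k"] by (simp add: power_even_abs)
  then show ?thesis
    unfolding gauss_exponent_def by (intro sum_mono mult_left_mono divide_right_mono) auto
qed

lemma tail_exponent_le:
  assumes "\<bar>x\<bar> \<le> R" "R \<le> (real l + 1/2) / 2"
  shows "tail_exponent N l x \<le> 4/3 * (R ^ (2 * N + 2) / (real l + 1/2) ^ (2 * N + 1))"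
proof -
  let ?w = "real l + 1/2"
  have "\<bar>x / ?w\<bar> \<le> 1/2"
    using assms by (simp add: abs_divide divide_le_eq)
  then have "(x / ?w)\<^sup>2 \<le> (1/2)\<^sup>2"
    unfolding abs_le_square_iff [symmetric] by simp
  then have y: "3/4 \<le> 1 - (x / ?w)\<^sup>2" by (simp add: power2_eq_square)
  have "x ^ (2 * N + 2) \<le> R ^ (2 * N + 2)"
    using power_mono [OF assms(1), of "2 * N + 2"] by (simp add: power_even_abs)
  then have a: "x ^ (2 * N + 2) / ?w ^ (2 * N + 1) \<le> R ^ (2 * N + 2) / ?w ^ (2 * N + 1)"
    by (intro divide_right_mono) auto
  have "0 \<le> R" using assms(1) by linarith
  then have nn: "0 \<le> R ^ (2 * N + 2) / ?w ^ (2 * N + 1)" by (intro divide_nonneg_nonneg) auto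
  have "tail_exponent N l x \<le> R ^ (2 * N + 2) / ?w ^ (2 * N + 1) / (3/4)"
    unfolding tail_exponent_def by (intro frac_le nn a y) simp
  moreover have "z / (3/4) = 4/3 * z" for z :: real by simp
  ultimately show ?thesis by (simp only:)
qed

lemma half_le_of_le_half:
  fixes w :: real assumes "R \<le> w / 2" "\<bar>x\<bar> \<le> R" "w > 0" shows "\<bar>x\<bar> < w"
  using assms by linarith

text \<open>On a fixed cube both exponents in \<open>correction_ge\<close> and \<open>correction_le\<close> are at most a constant times a negative
  power of \<open>l + 1/2\<close>.\<close>

lemma correction_uniformly_tendsto_1:
  fixes R e :: real
  assumes "e > 0"
  shows "\<forall>\<^sub>F l in sequentially. \<forall>s\<in>sym_cube R :: (real^'d) set. \<bar>1 - correction N l s\<bar> < e"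
proof -
  define S where "S l = real CARD('d) * gauss_exponent N l R" for l
  define T where "T l = real CARD('d) * (4/3 * (R ^ (2 * N + 2) / (real l + 1/2) ^ (2 * N + 1)))" for l
  have inv: "(\<lambda>l. inverse (real l + 1/2)) \<longlonglongrightarrow> 0" by real_asymp
  have "(\<lambda>l. real CARD('d) * (\<Sum>k=1..N. 1 / (real k * (2 * real k - 1)) * (R ^ (2 * k) * inverse (real l + 1/2) ^ (2 * k - 1))))
    \<longlonglongrightarrow> real CARD('d) * (\<Sum>k=1..N. 1 / (real k * (2 * real k - 1)) * (R ^ (2 * k) * 0 ^ (2 * k - 1)))"
    by (intro tendsto_intros inv)
  moreover have "(\<Sum>k=1..N. 1 / (real k * (2 * real k - 1)) * (R ^ (2 * k) * 0 ^ (2 * k - 1))) = 0"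
    by (intro sum.neutral) auto
  moreover have "gauss_exponent N l R
      = (\<Sum>k=1..N. 1 / (real k * (2 * real k - 1)) * (R ^ (2 * k) * inverse (real l + 1/2) ^ (2 * k - 1)))" for l
    unfolding gauss_exponent_def divide_inverse power_inverse ..
  ultimately have S: "S \<longlonglongrightarrow> 0"
    unfolding S_def by (simp only: mult_zero_right)
  have "(\<lambda>l. real CARD('d) * (4/3 * (R ^ (2 * N + 2) * inverse (real l + 1/2) ^ (2 * N + 1))))
    \<longlonglongrightarrow> real CARD('d) * (4/3 * (R ^ (2 * N + 2) * 0 ^ (2 * N + 1)))"
    by (intro tendsto_intros inv)
  moreover have "R ^ (2 * N + 2) / (real l + 1/2) ^ (2 * N + 1) = R ^ (2 * N + 2) * inverse (real l + 1/2) ^ (2 * N + 1)" for l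
    by (simp only: divide_inverse power_inverse)
  ultimately have T: "T \<longlonglongrightarrow> 0"
    unfolding T_def by (simp only:) simp
  have "(\<lambda>l. exp (T l)) \<longlonglongrightarrow> exp 0" by (intro tendsto_intros T)
  then have "\<forall>\<^sub>F l in sequentially. exp (T l) < 1 + e"
    using assms by (intro order_tendstoD) auto
  moreover have "(\<lambda>l. exp (- S l)) \<longlonglongrightarrow> exp (- 0)" by (intro tendsto_intros S)
  then have "\<forall>\<^sub>F l in sequentially. exp (- S l) > 1 - e"
    using assms by (intro order_tendstoD) auto
  moreover have "\<forall>\<^sub>F l in sequentially. R \<le> (real l + 1/2) / 2"
    by real_asymp
  ultimately show ?thesis
  proof eventually_elim
    case (elim l)
    show ?case
    proof
      fix s :: "real^'d" assume "s \<in> sym_cube R"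
      then have s: "\<bar>s $ i\<bar> \<le> R" for i by (auto simp: sym_cube_def abs_le_iff minus_le_iff)
      have lt: "\<bar>s $ i\<bar> < real l + 1/2" for i
        by (rule half_le_of_le_half [OF elim(3) s]) simp
      have "(\<Sum>i\<in>(UNIV::'d set). tail_exponent N l (s $ i)) \<le> (\<Sum>i\<in>(UNIV::'d set). 4/3 * (R ^ (2 * N + 2) / (real l + 1/2) ^ (2 * N + 1)))"
        by (intro sum_mono tail_exponent_le s elim)
      then have "correction N l s \<le> exp (T l)"
        using correction_le [OF lt, of N] by (auto simp: T_def intro: order_trans)
      moreover have "(\<Sum>i\<in>(UNIV::'d set). gauss_exponent N l (s $ i)) \<le> (\<Sum>i\<in>(UNIV::'d set). gauss_exponent N l R)"
        by (intro sum_mono gauss_exponent_mono s)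
      then have "exp (- S l) \<le> exp (- (\<Sum>i\<in>(UNIV::'d set). gauss_exponent N l (s $ i)))"
        by (simp add: S_def)
      then have "exp (- S l) \<le> correction N l s"
        using correction_ge [OF lt, of N] by linarith
      ultimately show "\<bar>1 - correction N l s\<bar> < e"
        using elim by linarith
    qed
  qed
qed

lemma E_radius_eventually:
  assumes "A > 0"
  shows "\<forall>\<^sub>F l in sequentially. E_radius l N A \<le> (real l + 1/2) / 2"
proof -
  define p where "p = 1 / (2 * real N + 2)"
  have p: "p > 0" by (simp add: p_def)
  have "(\<lambda>l. A * (real l + 1/2) powr (- p)) \<longlonglongrightarrow> 0"
    using p by real_asymp
  then have "\<forall>\<^sub>F l in sequentially. A * (real l + 1/2) powr (- p) < 1/2"
    by (rule order_tendstoD) simp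
  then show ?thesis
  proof eventually_elim
    case (elim l)
    have e: "(2 * real N + 1) / (2 * real N + 2) = 1 + (- p)"
      by (simp add: p_def field_simps)
    have "E_radius l N A = (real l + 1/2) * (A * (real l + 1/2) powr (- p))"
      unfolding E_radius_def e powr_add by simp
    also have "\<dots> \<le> (real l + 1/2) * (1/2)"
      using elim by (intro mult_left_mono) auto
    finally show ?case by simp
  qed
qed

text \<open>This identity explains the exponent in the radius: at the boundary of the cube the bound for the omitted
  terms of the expansion does not depend on \<open>l\<close>.\<close>

lemma E_radius_power:
  "E_radius l N A ^ (2 * N + 2) / (real l + 1/2) ^ (2 * N + 1) = A ^ (2 * N + 2)"
proof -
  have w: "real l + 1/2 > 0" by simp
  have "((real l + 1/2) powr ((2 * real N + 1) / (2 * real N + 2))) ^ (2 * N + 2)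
      = (real l + 1/2) powr ((2 * real N + 1) / (2 * real N + 2) * real (2 * N + 2))"
  proof -
    have "(v powr a) ^ n = v powr (a * real n)" if "v > 0" for v a :: real and n
      using that by (simp add: powr_powr flip: powr_realpow)
    from this [OF w] show ?thesis .
  qed
  also have "(2 * real N + 1) / (2 * real N + 2) * real (2 * N + 2) = real (2 * N + 1)"
    by (simp add: field_simps)
  also have "(real l + 1/2) powr real (2 * N + 1) = (real l + 1/2) ^ (2 * N + 1)"
    by (rule powr_realpow [OF w])
  finally have "E_radius l N A ^ (2 * N + 2) = A ^ (2 * N + 2) * (real l + 1/2) ^ (2 * N + 1)"
    unfolding E_radius_def power_mult_distrib by simp
  then show ?thesis using w by simp
qed

lemma correction_bounded:
  fixes s :: "real^'d"
  assumes "E_radius l N A \<le> (real l + 1/2) / 2" "s \<in> sym_cube (E_radius l N A)"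
  shows "0 < sine_tail_prod l s" "0 \<le> correction N l s" "correction N l s \<le> exp (real CARD('d) * (4/3 * A ^ (2 * N + 2)))"
proof -
  have s: "\<bar>s $ i\<bar> \<le> E_radius l N A" for i
    using assms(2) by (auto simp: sym_cube_def abs_le_iff minus_le_iff)
  have lt: "\<bar>s $ i\<bar> < real l + 1/2" for i
    by (rule half_le_of_le_half [OF assms(1) s]) simp
  show pos: "0 < sine_tail_prod l s" by (rule sine_tail_prod_pos [OF lt])
  then show "0 \<le> correction N l s" by (simp add: correction_def)
  have "(\<Sum>i\<in>UNIV. tail_exponent N l (s $ i)) \<le> (\<Sum>i\<in>(UNIV::'d set). 4/3 * (E_radius l N A ^ (2 * N + 2) / (real l + 1/2) ^ (2 * N + 1)))"
    by (intro sum_mono tail_exponent_le s assms)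
  also have "\<dots> = real CARD('d) * (4/3 * A ^ (2 * N + 2))"
    unfolding E_radius_power by simp
  finally show "correction N l s \<le> exp (real CARD('d) * (4/3 * A ^ (2 * N + 2)))"
    using correction_le [OF lt, of N] by (auto intro: order_trans)
qed

lemma l2norm_lebesgue_on_cube:
  "l2norm (lebesgue_on (sym_cube R)) u = l2norm lebesgue (\<lambda>s. if s \<in> sym_cube R then u s else 0)"
proof -
  have "(LINT s|lebesgue_on (sym_cube R). (cmod (u s))\<^sup>2) = (LINT s|lebesgue. indicator (sym_cube R) s *\<^sub>R (cmod (u s))\<^sup>2)"
    by (rule integral_restrict_space) simp
  also have "\<dots> = (LINT s|lebesgue. (cmod (if s \<in> sym_cube R then u s else 0))\<^sup>2)"
    by (intro Bochner_Integration.integral_cong refl) (auto simp: indicator_def)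
  finally show ?thesis by (simp add: l2norm_def)
qed

lemma borel_measurable_correction:
  "(\<lambda>s::real^'d. correction N l s) \<in> borel_measurable borel"
proof -
  have "continuous_on UNIV (\<lambda>s::real^'d. sine_tail_prod l s)"
    unfolding sine_tail_prod_def
    by (intro continuous_on_prod continuous_on_compose2 [OF continuous_on_gtail [of UNIV]] continuous_intros) auto
  then have [measurable]: "(\<lambda>s::real^'d. sine_tail_prod l s) \<in> borel_measurable borel"
    by (rule borel_measurable_continuous_onI)
  have "continuous_on UNIV (\<lambda>s::real^'d. exp (- (\<Sum>i\<in>UNIV. gauss_exponent N l (s $ i))))"
    unfolding gauss_exponent_def by (intro continuous_intros) auto
  then have [measurable]: "(\<lambda>s::real^'d. exp (- (\<Sum>i\<in>UNIV. gauss_exponent N l (s $ i)))) \<in> borel_measurable borel"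
    by (rule borel_measurable_continuous_onI)
  show ?thesis
    unfolding correction_def by measurable
qed

text \<open>The lower bound is a separate premise because an essential supremum over a null set is \<open>- \<infinity>\<close>.\<close>

lemma ereal_tendsto_0I:
  fixes X :: "nat \<Rightarrow> ereal"
  assumes "\<forall>\<^sub>F n in sequentially. 0 \<le> X n" "\<And>e::real. e > 0 \<Longrightarrow> \<forall>\<^sub>F n in sequentially. X n \<le> ereal e"
  shows "X \<longlonglongrightarrow> 0"
proof (rule order_tendstoI)
  fix a :: ereal assume "a < 0"
  show "\<forall>\<^sub>F n in sequentially. a < X n"
    using assms(1) by eventually_elim (use \<open>a < 0\<close> in \<open>rule less_le_trans\<close>)
next
  fix a :: ereal assume "0 < a"
  then obtain r where r: "0 < ereal r" "ereal r < a" using ereal_dense2 by blast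
  then have "\<forall>\<^sub>F n in sequentially. X n \<le> ereal r" by (intro assms(2)) simp
  then show "\<forall>\<^sub>F n in sequentially. X n < a"
    by eventually_elim (use r in \<open>auto intro: le_less_trans\<close>)
qed

lemma Linf_norm_cube:
  fixes u :: "real^'d \<Rightarrow> complex"
  assumes "continuous_on UNIV u" "r > 0" "\<And>s. s \<in> sym_cube r \<Longrightarrow> cmod (u s) \<le> e"
  shows "0 \<le> Linf_norm (lebesgue_on (sym_cube r)) u" "Linf_norm (lebesgue_on (sym_cube r)) u \<le> ereal e"
proof -
  have [measurable]: "u \<in> borel_measurable (lebesgue_on (sym_cube r))"
    by (rule measurable_cube_continuous [OF assms(1)])
  show "Linf_norm (lebesgue_on (sym_cube r)) u \<le> ereal e"
    unfolding Linf_norm_def using assms(3) by (intro esssup_I AE_I2) auto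
  have "emeasure lebesgue (sym_cube r :: (real^'d) set) \<noteq> 0"
  proof -
    have "measure lebesgue (sym_cube r :: (real^'d) set) = (\<Prod>i\<in>(UNIV::'d set). 2 * r)"
      unfolding sym_cube_eq_cbox using assms(2)
      by (simp add: content_cbox_cart interval_ne_empty_cart)
    then have "measure lebesgue (sym_cube r :: (real^'d) set) > 0"
      using assms(2) by simp
    then show ?thesis by (auto simp: measure_def)
  qed
  then have ne: "emeasure (lebesgue_on (sym_cube r :: (real^'d) set)) (space (lebesgue_on (sym_cube r))) \<noteq> 0"
    by (simp add: emeasure_restrict_space)
  have "esssup (lebesgue_on (sym_cube r :: (real^'d) set)) (\<lambda>_. 0::ereal) = 0"
    by (rule esssup_const [OF ne])
  moreover have "esssup (lebesgue_on (sym_cube r :: (real^'d) set)) (\<lambda>_. 0::ereal) \<le> esssup (lebesgue_on (sym_cube r)) (\<lambda>x. ereal (cmod (u x)))"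
    by (rule esssup_mono) auto
  ultimately show "0 \<le> Linf_norm (lebesgue_on (sym_cube r)) u"
    by (simp add: Linf_norm_def)
qed

theorem theorem5p1:
  fixes t :: "int^'d \<Rightarrow> real^'d"
    and f :: "real^'d \<Rightarrow> complex"
    and N :: nat
    and A :: real
  assumes "uniformly_invertible_Riesz_basis (\<lambda>n. expo (t n))"
    and "A > 0"
    and "f \<in> PW (sym_cube pi)"
  shows "((\<lambda>l. L2_norm (lebesgue_on (sym_cube (E_radius l N A)))
             (\<lambda>s. f s - interpolant N t f l s)) \<longlonglongrightarrow> 0) \<and>
         ((\<lambda>l. Linf_norm (lebesgue_on (sym_cube (E_radius l N A)))
             (\<lambda>s. f s - interpolant N t f l s)) \<longlonglongrightarrow> 0)"
proof -
  obtain L B C where "section_system t L B C"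
    using uniformly_invertible_section_system [OF assms(1)] .
  then interpret section_system t L B C .
  obtain F where F: "F \<in> L2 cube_pi" and fF: "\<And>s. f s = cube_fourier F s"
    using PW_cube_fourier [OF assms(3)] by blast
  have feq: "f = cube_fourier F" using fF by blast
  have contf: "continuous_on UNIV f" and fL2: "f \<in> L2 lebesgue"
    using assms(3) by (auto simp: PW_def)
  obtain c where c: "\<And>l. l \<ge> 1 \<Longrightarrow> interp_poly t f l = node_sum l (c l)"
    and conv: "(\<lambda>l. l2norm cube_pi (\<lambda>x. F x - trig_poly l (c l) x)) \<longlonglongrightarrow> 0"
    using interpolants_converge [OF F] unfolding feq [symmetric] by blast
  define E where "E l = E_radius l N A" for l
  define M where "M = (correction N :: nat \<Rightarrow> real^'d \<Rightarrow> real)"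
  \<comment> \<open>A bound for the correction factor on the growing cubes, valid from the index \<open>l0\<close> below on.\<close>
  define K where "K = exp (real CARD('d) * (4/3 * A ^ (2 * N + 2)))"
  define H where "H l = cube_fourier (trig_poly l (c l))" for l
  define I where "I = interpolant N t f"
  define \<delta> where "\<delta> l = l2norm cube_pi (\<lambda>x. F x - trig_poly l (c l) x)" for l
  have "K > 0" by (simp add: K_def)
  have E_pos: "E l > 0" for l using assms(2) by (simp add: E_def E_radius_def)
  \<comment> \<open>From \<open>l0\<close> on the cubes stay within half of the region where all sine tails are positive; moreover
    \<open>l0 \<ge> 1\<close>, because invertibility of the finite sections is assumed only from \<open>1\<close> on.\<close>
  obtain l0 where l0: "\<And>l. l \<ge> l0 \<Longrightarrow> E l \<le> (real l + 1/2) / 2" "l0 \<ge> 1"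
  proof -
    obtain k where "\<And>l. l \<ge> k \<Longrightarrow> E l \<le> (real l + 1/2) / 2"
      using E_radius_eventually [OF assms(2), of N] unfolding E_def eventually_sequentially by blast
    then show thesis by (intro that [of "max k 1"]) auto
  qed
  have M: "0 \<le> M l s" "M l s \<le> K" "\<bar>1 - M l s\<bar> \<le> 1 + K" if "l \<ge> l0" "s \<in> sym_cube (E l)" for l s
    using correction_bounded [of l N A s] l0(1) [OF that(1)] that(2) \<open>K > 0\<close> by (auto simp: E_def M_def K_def)
  have I: "I l s = H l s * of_real (M l s)" if "l \<ge> l0" "s \<in> sym_cube (E l)" for l s
    unfolding I_def H_def M_def using c [of l] correction_bounded(1) [of l N A s] l0(1) [OF that(1)] l0(2) that
    by (intro interpolant_eq) (auto simp: E_def)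
  have contI: "continuous_on UNIV (\<lambda>s. f s - I l s)" if "l \<ge> l0" for l
    unfolding I_def using c [of l] l0(2) that
    by (intro continuous_intros contf continuous_on_interpolant [of t f l "c l"]) auto
  have fH: "f s - H l s = cube_fourier (\<lambda>x. F x - trig_poly l (c l) x) s" for l s
    unfolding H_def fF by (rule cube_fourier_diff [OF F trig_poly_L2, symmetric])
  have FH: "(\<lambda>x. F x - trig_poly l (c l) x) \<in> L2 cube_pi" for l by (intro L2_diff F trig_poly_L2)
  have sup_fH: "cmod (f s - H l s) \<le> \<delta> l" for l s
    unfolding fH \<delta>_def by (rule norm_cube_fourier_le [OF FH])
  have split: "cmod (f s - I l s) \<le> cmod (f s) * \<bar>1 - M l s\<bar> + K * cmod (f s - H l s)"
    if "l \<ge> l0" "s \<in> sym_cube (E l)" for l s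
  proof -
    have "f s - I l s = f s * of_real (1 - M l s) + of_real (M l s) * (f s - H l s)"
      unfolding I [OF that] by (simp add: algebra_simps)
    then have "cmod (f s - I l s) \<le> cmod (f s) * \<bar>1 - M l s\<bar> + \<bar>M l s\<bar> * cmod (f s - H l s)"
      by (metis norm_triangle_ineq norm_mult norm_of_real)
    also have "\<bar>M l s\<bar> * cmod (f s - H l s) \<le> K * cmod (f s - H l s)"
      using M [OF that] by (intro mult_right_mono) auto
    finally show ?thesis by simp
  qed
  have Munif: "\<forall>\<^sub>F l in sequentially. \<forall>s\<in>sym_cube R. \<bar>1 - M l s\<bar> < e" if "e > 0" for R e
    unfolding M_def by (rule correction_uniformly_tendsto_1 [OF that])

  \<comment> \<open>Inside a large cube \<open>1 - M l\<close> is small and \<open>f\<close> bounded; outside it \<open>f\<close> is small and \<open>1 - M l\<close> bounded.\<close>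
  have uniform: "\<forall>\<^sub>F l in sequentially. \<forall>s\<in>sym_cube (E l). cmod (f s - I l s) \<le> e" if "e > 0" for e
  proof -
    have cancel: "z * (e / (2 * z)) = e / 2" if "z \<noteq> 0" for z :: real using that by simp
    define a where "a = l2norm cube_pi F"
    have "a \<ge> 0" by (simp add: a_def)
    have fa: "cmod (f s) \<le> a" for s unfolding fF a_def by (rule norm_cube_fourier_le [OF F])
    obtain R where R: "\<And>s. s \<notin> sym_cube R \<Longrightarrow> cmod (f s) < e / (2 * (1 + K))"
      using cube_fourier_vanishes_at_infinity [OF F, of "e / (2 * (1 + K))"] \<open>e > 0\<close> \<open>K > 0\<close> unfolding fF by auto
    have "\<forall>\<^sub>F l in sequentially. \<delta> l < e / (2 * K)"
      using conv \<open>e > 0\<close> \<open>K > 0\<close> unfolding \<delta>_def by (intro order_tendstoD) auto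
    moreover have "\<forall>\<^sub>F l in sequentially. \<forall>s\<in>sym_cube R. \<bar>1 - M l s\<bar> < e / (2 * (a + 1))"
      using \<open>e > 0\<close> \<open>a \<ge> 0\<close> by (intro Munif) auto
    moreover have "\<forall>\<^sub>F l in sequentially. l \<ge> l0" by (rule eventually_ge_at_top)
    ultimately show ?thesis
    proof eventually_elim
      case (elim l)
      show ?case
      proof
        fix s :: "real^'d" assume s: "s \<in> sym_cube (E l)"
        have "cmod (f s) * \<bar>1 - M l s\<bar> \<le> e/2"
        proof (cases "s \<in> sym_cube R")
          case True
          have "cmod (f s) * \<bar>1 - M l s\<bar> \<le> (a + 1) * (e / (2 * (a + 1)))"
            using fa [of s] elim(2) True \<open>a \<ge> 0\<close> by (intro mult_mono) (auto intro: less_imp_le)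
          also have "\<dots> = e / 2" using \<open>a \<ge> 0\<close> by (intro cancel) linarith
          finally show ?thesis .
        next
          case False
          have "\<bar>1 - M l s\<bar> * cmod (f s) \<le> (1 + K) * (e / (2 * (1 + K)))"
            using R [OF False] M(3) [OF elim(3) s] \<open>K > 0\<close> \<open>e > 0\<close> by (intro mult_mono) auto
          also have "\<dots> = e / 2" using \<open>K > 0\<close> by (intro cancel) linarith
          finally show ?thesis by (simp only: mult.commute)
        qed
        moreover have "K * cmod (f s - H l s) \<le> K * (e / (2 * K))"
          using sup_fH [of s l] elim(1) \<open>K > 0\<close> by (intro mult_left_mono) auto
        then have "K * cmod (f s - H l s) \<le> e/2" using \<open>K > 0\<close> by simp
        ultimately show "cmod (f s - I l s) \<le> e"
          using split [OF elim(3) s] by linarith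
      qed
    qed
  qed

  have Linf: "(\<lambda>l. Linf_norm (lebesgue_on (sym_cube (E l))) (\<lambda>s. f s - I l s)) \<longlonglongrightarrow> 0"
  proof (rule ereal_tendsto_0I)
    have bound: "\<forall>\<^sub>F l in sequentially. 0 \<le> Linf_norm (lebesgue_on (sym_cube (E l))) (\<lambda>s. f s - I l s)
        \<and> Linf_norm (lebesgue_on (sym_cube (E l))) (\<lambda>s. f s - I l s) \<le> ereal e" if "e > 0" for e
      using uniform [OF that] eventually_ge_at_top [of l0]
    proof eventually_elim
      case (elim l)
      then show ?case
        using Linf_norm_cube [OF contI [OF elim(2)] E_pos, of l e] by blast
    qed
    show "\<forall>\<^sub>F l in sequentially. 0 \<le> Linf_norm (lebesgue_on (sym_cube (E l))) (\<lambda>s. f s - I l s)"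
      using bound [of 1] by (auto elim: eventually_mono)
    show "\<forall>\<^sub>F l in sequentially. Linf_norm (lebesgue_on (sym_cube (E l))) (\<lambda>s. f s - I l s) \<le> ereal e" if "e > 0" for e
      using bound [OF that] by (auto elim: eventually_mono)
  qed

  \<comment> \<open>Extended by \<open>0\<close> outside the growing cubes, so that dominated convergence applies on the whole space.\<close>
  define u where "u l s = (if l \<ge> l0 \<and> s \<in> sym_cube (E l) then f s * of_real (1 - M l s) else 0)" for l s
  have [measurable]: "f \<in> borel_measurable lebesgue" by (rule L2_measurable [OF fL2])
  have [measurable]: "M l \<in> borel_measurable lebesgue" for l
    unfolding M_def using borel_measurable_correction [of N l] by (intro measurable_completion) simp
  have u_meas [measurable]: "u l \<in> borel_measurable lebesgue" for l
    unfolding u_def by measurable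
  have u_norm: "cmod (u l s) = (if l \<ge> l0 \<and> s \<in> sym_cube (E l) then cmod (f s) * \<bar>1 - M l s\<bar> else 0)" for l s
    unfolding u_def if_distrib [of cmod] norm_mult norm_of_real norm_zero ..
  have u_le: "cmod (u l s) \<le> (1 + K) * cmod (f s)" for l s
    unfolding u_norm using M(3) [of l s] \<open>K > 0\<close>
    by (auto simp: mult.commute [of "1 + K"] intro!: mult_left_mono)
  have u_L2: "u l \<in> L2 lebesgue" for l
    by (rule L2_bound [OF L2_cmult [OF fL2, of "of_real (1 + K)"] u_meas])
       (use u_le [of l] \<open>K > 0\<close> in \<open>simp only: norm_mult norm_of_real abs_of_pos add_pos_pos zero_less_one\<close>)
  have "(\<lambda>l. l2norm lebesgue (\<lambda>s. 0 - u l s)) \<longlonglongrightarrow> 0"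
  proof (rule l2norm_tendsto_0 [OF _ u_meas])
    show "AE s in lebesgue. (\<lambda>l. u l s) \<longlonglongrightarrow> 0"
    proof (intro AE_I2 tendstoI)
      fix s :: "real^'d" and e :: real assume "e > 0"
      have "- norm s \<le> s $ i \<and> s $ i \<le> norm s" for i
        using component_le_norm_cart [of s i] by linarith
      then have s: "s \<in> sym_cube (norm s)" by (simp add: sym_cube_def)
      have "e / (cmod (f s) + 1) > 0" using \<open>e > 0\<close> by (simp add: add_nonneg_pos)
      from Munif [OF this, of "norm s"]
      show "\<forall>\<^sub>F l in sequentially. dist (u l s) 0 < e"
      proof eventually_elim
        case (elim l)
        then have m: "\<bar>1 - M l s\<bar> < e / (cmod (f s) + 1)" using s by blast
        have "cmod (u l s) \<le> cmod (f s) * \<bar>1 - M l s\<bar>"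
          unfolding u_norm by simp
        also have "\<dots> \<le> cmod (f s) * (e / (cmod (f s) + 1))"
          using m by (intro mult_left_mono) auto
        also have "\<dots> < e"
        proof -
          have "cmod (f s) + 1 > 0" by (simp add: add_nonneg_pos)
          then show ?thesis
            using \<open>e > 0\<close> by (simp add: pos_divide_less_eq distrib_left mult.commute)
        qed
        finally show ?case by simp
      qed
    qed
    show "integrable lebesgue (\<lambda>s. (1 + K)\<^sup>2 * (cmod (f s))\<^sup>2)"
      using L2_integrable_square [OF fL2] by simp
    show "AE s in lebesgue. (cmod (0 - u l s))\<^sup>2 \<le> (1 + K)\<^sup>2 * (cmod (f s))\<^sup>2" for l
      using u_le [of l] by (intro AE_I2) (simp add: power_mono flip: power_mult_distrib)
  qed simp
  then have u_lim: "(\<lambda>l. l2norm lebesgue (u l)) \<longlonglongrightarrow> 0"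
    by (simp add: l2norm_def)
  have est: "l2norm (lebesgue_on (sym_cube (E l))) (\<lambda>s. f s - I l s) \<le> l2norm lebesgue (u l) + K * \<delta> l" if l: "l \<ge> l0" for l
  proof -
    let ?Q = "lebesgue_on (sym_cube (E l)) :: (real^'d) measure"
    have uQ: "l2norm ?Q (u l) = l2norm lebesgue (u l)"
      unfolding l2norm_lebesgue_on_cube by (rule arg_cong [of _ _ "l2norm lebesgue"]) (auto simp: u_def)
    have uQ2: "u l \<in> L2 ?Q"
      using u_L2 [of l] integrable_mult_indicator [OF sets_sym_cube [of "E l"] L2_integrable_square [OF u_L2 [of l]]]
      by (simp add: L2_def measurable_restrict_space1 integrable_restrict_space)
    have contfH: "continuous_on UNIV (\<lambda>s. f s - H l s)"
      unfolding fH by (rule continuous_on_cube_fourier [OF FH])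
    have fHQ: "(\<lambda>s. of_real (M l s) * (f s - H l s)) \<in> L2 ?Q"
    proof (rule L2_bound [OF L2_cmult [OF L2_cube_continuous [OF contfH], of "of_real K"]])
      show "(\<lambda>s. complex_of_real (M l s) * (f s - H l s)) \<in> borel_measurable ?Q"
      proof -
        have "M l \<in> borel_measurable ?Q" by (intro measurable_restrict_space1) measurable
        moreover have "(\<lambda>s. f s - H l s) \<in> borel_measurable ?Q" by (rule measurable_cube_continuous [OF contfH])
        ultimately show ?thesis by measurable
      qed
      fix s :: "real^'d" assume "s \<in> space ?Q"
      then show "cmod (complex_of_real (M l s) * (f s - H l s)) \<le> cmod (complex_of_real K * (f s - H l s))"
        unfolding norm_mult using M [OF l, of s] \<open>K > 0\<close> by (intro mult_right_mono) auto
    qed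
    have "l2norm ?Q (\<lambda>s. f s - I l s) = l2norm ?Q (\<lambda>s. u l s + of_real (M l s) * (f s - H l s))"
      unfolding l2norm_def
      by (intro arg_cong [of _ _ sqrt] Bochner_Integration.integral_cong refl)
         (use l I [OF l] in \<open>simp add: u_def algebra_simps\<close>)
    also have "\<dots> \<le> l2norm ?Q (u l) + l2norm ?Q (\<lambda>s. of_real (M l s) * (f s - H l s))"
      by (rule l2norm_triangle [OF uQ2 fHQ])
    also have "l2norm ?Q (\<lambda>s. of_real (M l s) * (f s - H l s)) \<le> l2norm ?Q (\<lambda>s. of_real K * (f s - H l s))"
    proof (rule l2norm_mono [OF L2_cmult [OF L2_cube_continuous [OF contfH]] L2_measurable [OF fHQ]])
      fix s :: "real^'d" assume "s \<in> space ?Q"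
      then show "cmod (complex_of_real (M l s) * (f s - H l s)) \<le> cmod (complex_of_real K * (f s - H l s))"
        unfolding norm_mult using M [OF l, of s] \<open>K > 0\<close> by (intro mult_right_mono) auto
    qed
    also have "\<dots> = K * l2norm ?Q (\<lambda>s. f s - H l s)"
      using \<open>K > 0\<close> by (simp add: l2norm_cmult)
    also have "\<dots> \<le> K * \<delta> l"
      unfolding fH \<delta>_def using l2norm_cube_fourier_le [OF FH] \<open>K > 0\<close> by (intro mult_left_mono) auto
    finally show ?thesis by (simp add: uQ)
  qed
  have "(\<lambda>l. l2norm lebesgue (u l) + K * \<delta> l) \<longlonglongrightarrow> 0 + K * 0"
    unfolding \<delta>_def by (intro tendsto_intros u_lim conv)
  then have lim: "(\<lambda>l. l2norm lebesgue (u l) + K * \<delta> l) \<longlonglongrightarrow> 0" by simp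
  have "(\<lambda>l. l2norm (lebesgue_on (sym_cube (E l))) (\<lambda>s. f s - I l s)) \<longlonglongrightarrow> 0"
    by (rule tendsto_sandwich [OF _ _ tendsto_const lim])
       (auto simp: eventually_sequentially intro!: exI [of _ l0] est)
  then have "(\<lambda>l. ereal (l2norm (lebesgue_on (sym_cube (E l))) (\<lambda>s. f s - I l s))) \<longlonglongrightarrow> ereal 0"
    by (rule tendsto_ereal)
  moreover have "\<forall>\<^sub>F l in sequentially. ereal (l2norm (lebesgue_on (sym_cube (E l))) (\<lambda>s. f s - I l s))
      = L2_norm (lebesgue_on (sym_cube (E l))) (\<lambda>s. f s - I l s)"
    using eventually_ge_at_top [of l0]
  proof eventually_elim
    case (elim l)
    then show ?case by (intro L2_norm_eq_l2norm [symmetric] L2_cube_continuous contI)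
  qed
  ultimately have "(\<lambda>l. L2_norm (lebesgue_on (sym_cube (E l))) (\<lambda>s. f s - I l s)) \<longlonglongrightarrow> 0"
    unfolding zero_ereal_def by (rule Lim_transform_eventually)
  with Linf show ?thesis
    unfolding E_def I_def by blast
qed

end
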